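(* Let $u$ be a nonconstant real symmetric inner function, $A\in\mathcal{T}(u)$ and $B\in\mathcal{H}(u)$. Then $AB\in\mathcal{H}(u)$ if and only if one of the following conditions holds: (1) $A=cI$ or $B=cD$ for some $c\in\mathbb{C}$; (2) there exists $\alpha\in\widehat{\mathbb{C}}=\mathbb{C}\cup\{\infty\}$ such that $AS_u^\alpha=S_u^\alpha A$ and $B(S_u^{\overline\alpha})^*=S_u^\alpha B$.
   Context: $L^2=L^2(\mathbb{T})$, $H^2\subset L^2$ is the Hardy space, $P:L^2\to H^2$ the orthogonal projection. For an inner function $u$, $K_u=H^2\ominus uH^2$ with orthogonal projection $P_u:L^2\to K_u$; $C_uf=u\,\overline{zf}$ (on $\mathbb{T}$) is a conjugation on $K_u$; $Uf(z)=\widehat f(z)=\overline{f(\overline z)}$. $u$ is real symmetric if $u=\widehat u$; then $U$ maps $K_u$ onto $K_u$ and $D:=C_uU$ is a linear operator on $K_u$ with $D=D^*$, $D^2=I$. $J:L^2\to L^2$ is $Jf(z)=\overline zf(\overline z)$. For $\phi\in L^2$, the densely defined operators $A^u_\phi f=P_u(\phi f)$ and $B^u_\phi f=P_uJ(I-P)(\phi f)$ on $K_u$ are the truncated Toeplitz and truncated Hankel operators; $\mathcal{T}(u)$ and $\mathcal{H}(u)$ are the spaces of all bounded ones, respectively. $(f\otimes g)h=\langle h,g\rangle f$. $k_0^u=1-\overline{u(0)}u$, $\widetilde{k_0^u}=C_uk_0^u=(u-u(0))/z$. $S_uf=P_u(zf)$ on $K_u$, and for $|\alpha|\le1$, $S_u^\alpha=S_u+\frac{\alpha}{1-\alpha\overline{u(0)}}\,k_0^u\otimes\widetilde{k_0^u}$.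 For $|\alpha|>1$ (including $\alpha=\infty$, with $\overline\infty=\infty$ and $1/\infty=0$) the symbol $S_u^\alpha$ denotes $(S_u^{1/\overline\alpha})^*$. *)

theory Defs
  imports "HOL-Analysis.Analysis"
begin

section \<open>Square-integrable functions on the unit circle\<close>

text \<open>Normalised arc length, as a Borel measure on the plane carried by the unit circle.\<close>

definition circle :: "complex measure" where
  "circle = distr (uniform_measure lborel {-pi..pi}) borel cis"

lemma sets_circle [simp, measurable_cong]: "sets circle = sets borel"
  by (simp add: circle_def)

lemma space_circle [simp]: "space circle = UNIV"
  by (simp add: circle_def)

lemma cis_borel_measurable [measurable]: "cis \<in> borel_measurable borel"
  by (intro borel_measurable_continuous_onI continuous_intros)

lemma cnj_borel_measurable [measurable]: "cnj \<in> borel_measurable borel"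
  by (intro borel_measurable_continuous_onI continuous_intros)

lemma emeasure_circle: "emeasure circle UNIV = 1"
proof -
  have "cis -` UNIV \<inter> space (uniform_measure lborel {-pi..pi}) = UNIV" by simp
  then show ?thesis
    unfolding circle_def by (subst emeasure_distr) (auto simp: divide_eq_1_ennreal)
qed

lemma finite_measure_circle: "finite_measure circle"
  by (intro finite_measureI) (simp add: emeasure_circle)

lemma AE_circle_norm: "AE z in circle. cmod z = 1"
  unfolding circle_def by (subst AE_distr_iff) auto

lemma uniform_uminus:
  "distr (uniform_measure lborel {-pi..pi}) borel uminus = uniform_measure lborel {-pi..pi}"
proof (rule measure_eqI)
  fix A assume "A \<in> sets (distr (uniform_measure lborel {-pi..pi}) borel uminus)"
  then have A [measurable]: "A \<in> sets borel" by simp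
  have "emeasure lborel ({-pi..pi} \<inter> uminus -` A)
      = emeasure lborel (uminus -` ({-pi..pi} \<inter> A))"
    by (rule arg_cong[where f = "emeasure lborel"]) auto
  also have "\<dots> = emeasure (distr lborel borel uminus) ({-pi..pi} \<inter> A)"
    by (subst emeasure_distr) auto
  also have "\<dots> = emeasure lborel ({-pi..pi} \<inter> A)"
    by (simp add: lborel_distr_uminus)
  finally have *: "emeasure lborel ({-pi..pi} \<inter> uminus -` A)
      = emeasure lborel ({-pi..pi} \<inter> A)" .
  have m: "uminus -` A \<in> sets borel"
    using measurable_sets[of "uminus :: real \<Rightarrow> real" borel borel A] by simp
  show "emeasure (distr (uniform_measure lborel {-pi..pi}) borel uminus) A
      = emeasure (uniform_measure lborel {-pi..pi}) A"
    using m by (simp add: emeasure_distr *)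
qed simp

lemma circle_cnj: "distr circle borel cnj = circle"
proof -
  have "distr circle borel cnj
      = distr (uniform_measure lborel {-pi..pi}) borel (cnj \<circ> cis)"
    unfolding circle_def by (subst distr_distr) auto
  also have "cnj \<circ> cis = cis \<circ> uminus"
    by (auto simp: cis_cnj)
  also have "distr (uniform_measure lborel {-pi..pi}) borel (cis \<circ> uminus)
      = distr (distr (uniform_measure lborel {-pi..pi}) borel uminus) borel cis"
    by (subst distr_distr) auto
  finally show ?thesis by (simp add: uniform_uminus circle_def)
qed

lemma AE_circle_cnj:
  assumes "AE z in circle. P z"
  shows "AE z in circle. P (cnj z)"
proof -
  have "AE z in distr circle borel cnj. P z" using assms unfolding circle_cnj .
  then show ?thesis by (rule AE_distrD[rotated]) simp
qed

definition square_integrable :: "(complex \<Rightarrow> complex) \<Rightarrow> bool" where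
  "square_integrable f \<longleftrightarrow>
     f \<in> borel_measurable circle \<and> integrable circle (\<lambda>z. (cmod (f z))\<^sup>2)"

lemma square_integrable_measurable [measurable_dest]:
  "square_integrable f \<Longrightarrow> f \<in> borel_measurable circle"
  by (simp add: square_integrable_def)

lemma square_integrable_norm_cong:
  assumes "square_integrable f" "g \<in> borel_measurable circle"
    "AE z in circle. cmod (g z) = cmod (f z)"
  shows "square_integrable g"
proof -
  have "integrable circle (\<lambda>z. (cmod (g z))\<^sup>2) \<longleftrightarrow> integrable circle (\<lambda>z. (cmod (f z))\<^sup>2)"
    using assms by (intro integrable_cong_AE) (auto simp: square_integrable_def)
  with assms show ?thesis by (simp add: square_integrable_def)
qed

lemma square_integrable_bounded:
  assumes "f \<in> borel_measurable circle" "AE z in circle. cmod (f z) \<le> c"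
  shows "square_integrable f"
proof -
  interpret finite_measure circle by (rule finite_measure_circle)
  have "integrable circle (\<lambda>z. (cmod (f z))\<^sup>2)"
  proof (rule integrable_const_bound[where B = "c\<^sup>2"])
    show "AE z in circle. norm ((cmod (f z))\<^sup>2) \<le> c\<^sup>2"
      using assms(2) by eventually_elim (auto intro: power_mono)
  qed (use assms(1) in measurable)
  with assms(1) show ?thesis by (simp add: square_integrable_def)
qed

lemma square_integrable_add:
  assumes f: "square_integrable f" and g: "square_integrable g"
  shows "square_integrable (\<lambda>z. f z + g z)"
proof -
  have [measurable]: "f \<in> borel_measurable circle" "g \<in> borel_measurable circle"
    using f g by (auto simp: square_integrable_def)
  have "integrable circle (\<lambda>z. (cmod (f z + g z))\<^sup>2)"
  proof (rule Bochner_Integration.integrable_bound)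
    show "integrable circle (\<lambda>z. 2 * (cmod (f z))\<^sup>2 + 2 * (cmod (g z))\<^sup>2)"
      using f g by (auto simp: square_integrable_def)
    show "AE z in circle. norm ((cmod (f z + g z))\<^sup>2)
        \<le> norm (2 * (cmod (f z))\<^sup>2 + 2 * (cmod (g z))\<^sup>2)"
    proof (rule AE_I2)
      fix z
      have "(cmod (f z + g z))\<^sup>2 \<le> (cmod (f z) + cmod (g z))\<^sup>2"
        by (intro power_mono norm_triangle_ineq) auto
      also have "\<dots> \<le> 2 * (cmod (f z))\<^sup>2 + 2 * (cmod (g z))\<^sup>2"
        using sum_squares_bound[of "cmod (f z)" "cmod (g z)"] by (simp add: power2_sum)
      finally show "norm ((cmod (f z + g z))\<^sup>2)
        \<le> norm (2 * (cmod (f z))\<^sup>2 + 2 * (cmod (g z))\<^sup>2)" by simp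
    qed
  qed measurable
  then show ?thesis by (simp add: square_integrable_def)
qed

lemma square_integrable_scale:
  "square_integrable f \<Longrightarrow> square_integrable (\<lambda>z. c * f z)"
  by (auto simp: square_integrable_def norm_mult power_mult_distrib)

lemma square_integrable_integrable_mult:
  assumes f: "square_integrable f" and g: "square_integrable g"
  shows "integrable circle (\<lambda>z. f z * cnj (g z))"
proof (rule Bochner_Integration.integrable_bound)
  have [measurable]: "f \<in> borel_measurable circle" "g \<in> borel_measurable circle"
    using f g by (auto simp: square_integrable_def)
  show "(\<lambda>z. f z * cnj (g z)) \<in> borel_measurable circle" by measurable
  show "integrable circle (\<lambda>z. (cmod (f z))\<^sup>2 + (cmod (g z))\<^sup>2)"
    using f g by (auto simp: square_integrable_def)
  show "AE z in circle. norm (f z * cnj (g z)) \<le> norm ((cmod (f z))\<^sup>2 + (cmod (g z))\<^sup>2)"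
  proof (rule AE_I2)
    fix z
    have "2 * (cmod (f z) * cmod (g z)) \<le> (cmod (f z))\<^sup>2 + (cmod (g z))\<^sup>2"
      using sum_squares_bound[of "cmod (f z)" "cmod (g z)"] by simp
    moreover have "0 \<le> cmod (f z) * cmod (g z)" by simp
    ultimately show "norm (f z * cnj (g z)) \<le> norm ((cmod (f z))\<^sup>2 + (cmod (g z))\<^sup>2)"
      unfolding norm_mult complex_mod_cnj real_norm_def by linarith
  qed
qed

lemma square_integrable_cnj_arg:
  assumes "square_integrable f"
  shows "square_integrable (\<lambda>z. f (cnj z))"
proof -
  have [measurable]: "f \<in> borel_measurable borel"
    using assms by (simp add: square_integrable_def cong: measurable_cong_sets)
  have "integrable (distr circle borel cnj) (\<lambda>z. (cmod (f z))\<^sup>2)"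
    using assms by (simp add: circle_cnj square_integrable_def)
  then have "integrable circle (\<lambda>z. (cmod (f (cnj z)))\<^sup>2)"
    by (subst (asm) integrable_distr_eq) auto
  then show ?thesis by (simp add: square_integrable_def)
qed

section \<open>The Hilbert space of square-integrable functions modulo null sets\<close>

quotient_type l2T = "complex \<Rightarrow> complex" / partial:
  "\<lambda>f g. square_integrable f \<and> square_integrable g \<and> (AE z in circle. f z = g z)"
proof (rule part_equivpI)
  show "\<exists>f. square_integrable f \<and> square_integrable f \<and> (AE z in circle. f z = f z)"
    by (rule exI[of _ "\<lambda>_. 0"]) (simp add: square_integrable_def)
  show "symp (\<lambda>f g. square_integrable f \<and> square_integrable g \<and> (AE z in circle. f z = g z))"
    by (rule sympI) auto
  show "transp (\<lambda>f g. square_integrable f \<and> square_integrable g \<and> (AE z in circle. f z = g z))"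
    by (rule transpI) (auto elim: AE_mp)
qed

lift_definition cinner :: "l2T \<Rightarrow> l2T \<Rightarrow> complex" is
  "\<lambda>f g. \<integral>z. f z * cnj (g z) \<partial>circle"
  by (intro integral_cong_AE) auto

lift_definition scaleC :: "complex \<Rightarrow> l2T \<Rightarrow> l2T" (infixr \<open>*\<^sub>C\<close> 75) is "\<lambda>c f z. c * f z"
  by (auto intro: square_integrable_scale)

instantiation l2T :: real_inner
begin

lift_definition zero_l2T :: l2T is "\<lambda>_. 0" by (simp add: square_integrable_def)

lift_definition plus_l2T :: "l2T \<Rightarrow> l2T \<Rightarrow> l2T" is "\<lambda>f g z. f z + g z"
  by (auto intro: square_integrable_add)

lift_definition uminus_l2T :: "l2T \<Rightarrow> l2T" is "\<lambda>f z. - f z"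
  by (auto simp: square_integrable_def)

definition minus_l2T :: "l2T \<Rightarrow> l2T \<Rightarrow> l2T" where "f - g = f + - g" for f g :: l2T

definition scaleR_l2T :: "real \<Rightarrow> l2T \<Rightarrow> l2T" where "r *\<^sub>R f = complex_of_real r *\<^sub>C f"

definition inner_l2T :: "l2T \<Rightarrow> l2T \<Rightarrow> real" where "f \<bullet> g = Re (cinner f g)"

definition norm_l2T :: "l2T \<Rightarrow> real" where "norm f = sqrt (f \<bullet> f)" for f :: l2T

definition sgn_l2T :: "l2T \<Rightarrow> l2T" where "sgn f = inverse (norm f) *\<^sub>R f" for f :: l2T

definition dist_l2T :: "l2T \<Rightarrow> l2T \<Rightarrow> real" where "dist f g = norm (f - g)" for f g :: l2T

definition uniformity_l2T :: "(l2T \<times> l2T) filter" where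
  "uniformity = (INF e\<in>{0<..}. principal {(f :: l2T, g). dist f g < e})"

definition open_l2T :: "l2T set \<Rightarrow> bool" where
  "open S = (\<forall>f\<in>S. \<forall>\<^sub>F (f', g) in uniformity. f' = f \<longrightarrow> g \<in> S)" for S :: "l2T set"

instance
proof
  fix f g h :: l2T and r s :: real
  show "f + g + h = f + (g + h)"
    by transfer (auto intro: square_integrable_add simp: add.assoc)
  show "f + g = g + f"
    by transfer (auto intro: square_integrable_add simp: add.commute)
  show "0 + f = f" by transfer auto
  show "- f + f = 0" by transfer (auto simp: square_integrable_def)
  show "f - g = f + - g" by (fact minus_l2T_def)
  show "r *\<^sub>R (f + g) = r *\<^sub>R f + r *\<^sub>R g"
    unfolding scaleR_l2T_def
    by transfer (auto intro!: square_integrable_add square_integrable_scale simp: distrib_left)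
  show "(r + s) *\<^sub>R f = r *\<^sub>R f + s *\<^sub>R f"
    unfolding scaleR_l2T_def
    by transfer (auto intro!: square_integrable_add square_integrable_scale
        simp: distrib_right)
  show "r *\<^sub>R s *\<^sub>R f = (r * s) *\<^sub>R f"
    unfolding scaleR_l2T_def
    by transfer (auto intro!: square_integrable_scale simp: mult.assoc simp flip: of_real_mult)
  show "1 *\<^sub>R f = f"
    unfolding scaleR_l2T_def by transfer auto
  show "sgn f = inverse (norm f) *\<^sub>R f" by (fact sgn_l2T_def)
  show "dist f g = norm (f - g)" by (fact dist_l2T_def)
  show "uniformity = (INF e\<in>{0<..}. principal {(f :: l2T, g). dist f g < e})"
    by (fact uniformity_l2T_def)
  show "open S = (\<forall>f\<in>S. \<forall>\<^sub>F (f', g) in uniformity. f' = f \<longrightarrow> g \<in> S)" for S :: "l2T set"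
    by (fact open_l2T_def)
  show "norm f = sqrt (f \<bullet> f)" by (fact norm_l2T_def)
  have "cinner g f = cnj (cinner f g)"
    by transfer (simp flip: Bochner_Integration.integral_cnj add: mult.commute)
  then show "f \<bullet> g = g \<bullet> f" by (simp add: inner_l2T_def)
  have "cinner (f + g) h = cinner f h + cinner g h"
    by transfer (simp add: distrib_right Bochner_Integration.integral_add
        square_integrable_integrable_mult)
  then show "(f + g) \<bullet> h = f \<bullet> h + g \<bullet> h" by (simp add: inner_l2T_def)
  have "cinner (complex_of_real r *\<^sub>C f) g = complex_of_real r * cinner f g"
    by transfer (simp add: mult.assoc)
  then show "(r *\<^sub>R f) \<bullet> g = r * (f \<bullet> g)" by (simp add: inner_l2T_def scaleR_l2T_def)
  have sq: "z * cnj z = complex_of_real ((cmod z)\<^sup>2)" for z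
    by (rule complex_norm_square[symmetric])
  have "Re (cinner f f) \<ge> 0 \<and> (Re (cinner f f) = 0 \<longleftrightarrow> f = 0)"
  proof transfer
    fix f assume "square_integrable f \<and> square_integrable f \<and> (AE z in circle. f z = f z)"
    then have f: "square_integrable f" by simp
    have "(\<integral>z. f z * cnj (f z) \<partial>circle) = complex_of_real (\<integral>z. (cmod (f z))\<^sup>2 \<partial>circle)"
      unfolding sq by (rule integral_complex_of_real)
    moreover have "(\<integral>z. (cmod (f z))\<^sup>2 \<partial>circle) \<ge> 0" by simp
    moreover have "(\<integral>z. (cmod (f z))\<^sup>2 \<partial>circle) = 0 \<longleftrightarrow> (AE z in circle. f z = 0)"
      using f by (subst integral_nonneg_eq_0_iff_AE) (auto simp: square_integrable_def)
    ultimately show "0 \<le> Re (\<integral>z. f z * cnj (f z) \<partial>circle)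
        \<and> (Re (\<integral>z. f z * cnj (f z) \<partial>circle) = 0) =
          (square_integrable f \<and> square_integrable (\<lambda>_. 0) \<and> (AE z in circle. f z = 0))"
      using f by (simp add: square_integrable_def[of "\<lambda>_. 0"])
  qed
  then show "0 \<le> f \<bullet> f" "(f \<bullet> f = 0) = (f = 0)" by (auto simp: inner_l2T_def)
qed

end

text \<open>Pointwise product. It is the product in \<open>L\<^sup>2\<close> whenever the latter exists (in particular if
  one factor is essentially bounded), and \<open>0\<close> by convention otherwise.\<close>

lift_definition mult_l2T :: "l2T \<Rightarrow> l2T \<Rightarrow> l2T" (infixl \<open>\<odot>\<close> 70) is
  "\<lambda>f g. if square_integrable (\<lambda>z. f z * g z) then (\<lambda>z. f z * g z) else (\<lambda>_. 0)"
proof -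
  fix f f' g g' :: "complex \<Rightarrow> complex"
  assume f: "square_integrable f \<and> square_integrable f' \<and> (AE z in circle. f z = f' z)"
    and g: "square_integrable g \<and> square_integrable g' \<and> (AE z in circle. g z = g' z)"
  have ae: "AE z in circle. f z * g z = f' z * g' z"
    using f g by auto
  have m: "(\<lambda>z. f z * g z) \<in> borel_measurable circle" "(\<lambda>z. f' z * g' z) \<in> borel_measurable circle"
    using f g by (auto intro!: borel_measurable_times simp: square_integrable_def)
  have "square_integrable (\<lambda>z. f z * g z) \<longleftrightarrow> square_integrable (\<lambda>z. f' z * g' z)"
    using m ae
    by (auto intro: square_integrable_norm_cong[OF _ m(2)] square_integrable_norm_cong[OF _ m(1)]
       )
  moreover have "square_integrable (\<lambda>_. 0)" by (simp add: square_integrable_def)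
  ultimately show "square_integrable
         (if square_integrable (\<lambda>z. f z * g z) then (\<lambda>z. f z * g z) else (\<lambda>_. 0)) \<and>
        square_integrable
         (if square_integrable (\<lambda>z. f' z * g' z) then (\<lambda>z. f' z * g' z) else (\<lambda>_. 0)) \<and>
        (AE z in circle. (if square_integrable (\<lambda>z. f z * g z) then (\<lambda>z. f z * g z) else (\<lambda>_. 0)) z =
           (if square_integrable (\<lambda>z. f' z * g' z) then (\<lambda>z. f' z * g' z) else (\<lambda>_. 0)) z)"
    using ae by auto
qed

lift_definition const_l2T :: "complex \<Rightarrow> l2T" is "\<lambda>c _. c"
  by (auto intro: square_integrable_bounded)

lift_definition id_l2T :: l2T is "\<lambda>z. z"
proof -
  have "AE z in circle. cmod z \<le> 1"
    using AE_circle_norm by eventually_elim simp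
  then have "square_integrable (\<lambda>z. z)" by (intro square_integrable_bounded) auto
  then show "square_integrable (\<lambda>z. z) \<and> square_integrable (\<lambda>z. z) \<and> (AE z in circle. z = z)"
    by simp
qed

lift_definition cnj_l2T :: "l2T \<Rightarrow> l2T" is "\<lambda>f z. cnj (f z)"
  by (auto simp: square_integrable_def)

lift_definition ess_bounded :: "l2T \<Rightarrow> bool" is "\<lambda>f. \<exists>c. AE z in circle. cmod (f z) \<le> c"
proof -
  fix f g :: "complex \<Rightarrow> complex"
  assume "square_integrable f \<and> square_integrable g \<and> (AE z in circle. f z = g z)"
  then have ae: "AE z in circle. f z = g z" by simp
  have "(AE z in circle. cmod (f z) \<le> c) \<longleftrightarrow> (AE z in circle. cmod (g z) \<le> c)" for c
    using ae by auto
  then show "(\<exists>c. AE z in circle. cmod (f z) \<le> c) = (\<exists>c. AE z in circle. cmod (g z) \<le> c)"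
    by simp
qed

lift_definition unimodular :: "l2T \<Rightarrow> bool" is "\<lambda>f. AE z in circle. cmod (f z) = 1"
  by auto

lift_definition hat_op :: "l2T \<Rightarrow> l2T" is "\<lambda>f z. cnj (f (cnj z))"
proof -
  fix f g :: "complex \<Rightarrow> complex"
  assume a: "square_integrable f \<and> square_integrable g \<and> (AE z in circle. f z = g z)"
  have "AE z in circle. f (cnj z) = g (cnj z)" using a by (intro AE_circle_cnj) simp
  then have "AE z in circle. cnj (f (cnj z)) = cnj (g (cnj z))" by eventually_elim simp
  moreover have "square_integrable (\<lambda>z. cnj (h (cnj z)))" if "square_integrable h" for h
    using square_integrable_cnj_arg[OF that] by (auto simp: square_integrable_def)
  ultimately show "square_integrable (\<lambda>z. cnj (f (cnj z))) \<and> square_integrable (\<lambda>z. cnj (g (cnj z))) \<and>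
        (AE z in circle. cnj (f (cnj z)) = cnj (g (cnj z)))" using a by simp
qed

lift_definition J_op :: "l2T \<Rightarrow> l2T" is "\<lambda>f z. cnj z * f (cnj z)"
proof -
  fix f g :: "complex \<Rightarrow> complex"
  assume a: "square_integrable f \<and> square_integrable g \<and> (AE z in circle. f z = g z)"
  have "AE z in circle. f (cnj z) = g (cnj z)" using a by (intro AE_circle_cnj) simp
  then have "AE z in circle. cnj z * f (cnj z) = cnj z * g (cnj z)" by eventually_elim simp
  moreover have "square_integrable (\<lambda>z. cnj z * h (cnj z))" if "square_integrable h" for h
  proof (rule square_integrable_norm_cong[OF square_integrable_cnj_arg[OF that]])
    have "(\<lambda>z. h (cnj z)) \<in> borel_measurable circle"
      using square_integrable_cnj_arg[OF that] by (simp add: square_integrable_def)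
    then show "(\<lambda>z. cnj z * h (cnj z)) \<in> borel_measurable circle" by measurable
    show "AE z in circle. cmod (cnj z * h (cnj z)) = cmod (h (cnj z))"
      using AE_circle_norm by eventually_elim (simp add: norm_mult)
  qed
  ultimately show "square_integrable (\<lambda>z. cnj z * f (cnj z)) \<and> square_integrable (\<lambda>z. cnj z * g (cnj z)) \<and>
        (AE z in circle. cnj z * f (cnj z) = cnj z * g (cnj z))" using a by simp
qed

lift_definition fourier_coeff :: "l2T \<Rightarrow> int \<Rightarrow> complex" is
  "\<lambda>f n. \<integral>z. f z * z powi (- n) \<partial>circle"
proof (rule ext)
  fix f g :: "complex \<Rightarrow> complex" and n :: int
  assume a: "square_integrable f \<and> square_integrable g \<and> (AE z in circle. f z = g z)"
  have [measurable]: "f \<in> borel_measurable circle" "g \<in> borel_measurable circle"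
    using a by (auto simp: square_integrable_def)
  have [measurable]: "(\<lambda>z::complex. z powi (- n)) \<in> borel_measurable circle"
    unfolding power_int_def by measurable
  have "AE z in circle. f z * z powi (- n) = g z * z powi (- n)" using a by auto
  then show "(\<integral>z. f z * z powi (- n) \<partial>circle) = (\<integral>z. g z * z powi (- n) \<partial>circle)"
    by (intro integral_cong_AE) measurable
qed

section \<open>Hilbert space operators\<close>

definition orth_proj :: "l2T set \<Rightarrow> l2T \<Rightarrow> l2T" where
  "orth_proj M f = (THE g. g \<in> M \<and> (\<forall>h\<in>M. cinner (f - g) h = 0))"

text \<open>An operator on a subspace \<open>M\<close> is represented by a map defined on all of \<open>L\<^sup>2\<close>, of which only
  the restriction to \<open>M\<close> is relevant.\<close>

definition bounded_operator_on :: "l2T set \<Rightarrow> (l2T \<Rightarrow> l2T) \<Rightarrow> bool" where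
  "bounded_operator_on M T \<longleftrightarrow>
     (\<forall>f\<in>M. T f \<in> M) \<and>
     (\<forall>f\<in>M. \<forall>g\<in>M. T (f + g) = T f + T g) \<and>
     (\<forall>c. \<forall>f\<in>M. T (c *\<^sub>C f) = c *\<^sub>C T f) \<and>
     (\<exists>C. \<forall>f\<in>M. norm (T f) \<le> C * norm f)"

definition adjoint_on :: "l2T set \<Rightarrow> (l2T \<Rightarrow> l2T) \<Rightarrow> l2T \<Rightarrow> l2T" where
  "adjoint_on M T g = (THE h. h \<in> M \<and> (\<forall>f\<in>M. cinner (T f) g = cinner f h))"

definition rank_one :: "l2T \<Rightarrow> l2T \<Rightarrow> l2T \<Rightarrow> l2T" where
  "rank_one f g h = cinner h g *\<^sub>C f"

section \<open>Inner functions and model spaces\<close>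

definition hardy :: "l2T set" where
  "hardy = {f. \<forall>n<0. fourier_coeff f n = 0}"

text \<open>Value at a point of the open disc of the holomorphic extension of a function in \<open>H\<^sup>2\<close>.\<close>

definition disc_value :: "l2T \<Rightarrow> complex \<Rightarrow> complex" where
  "disc_value f w = (\<Sum>n. fourier_coeff f (int n) * w ^ n)"

text \<open>Inner functions are identified with their boundary functions.\<close>

definition inner_function :: "l2T \<Rightarrow> bool" where
  "inner_function u \<longleftrightarrow> u \<in> hardy \<and> unimodular u"

definition real_symmetric :: "l2T \<Rightarrow> bool" where
  "real_symmetric u \<longleftrightarrow> u = hat_op u"

definition model_space :: "l2T \<Rightarrow> l2T set" where
  "model_space u = {f \<in> hardy. \<forall>h\<in>hardy. cinner f (u \<odot> h) = 0}"

abbreviation P_model :: "l2T \<Rightarrow> l2T \<Rightarrow> l2T" where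
  "P_model u \<equiv> orth_proj (model_space u)"

definition C_op :: "l2T \<Rightarrow> l2T \<Rightarrow> l2T" where
  "C_op u f = u \<odot> cnj_l2T (id_l2T \<odot> f)"

definition D_op :: "l2T \<Rightarrow> l2T \<Rightarrow> l2T" where
  "D_op u f = C_op u (hat_op f)"

section \<open>Truncated Toeplitz and Hankel operators\<close>

text \<open>The operators with symbol \<open>\<phi>\<close> are densely defined, namely on the bounded functions in the
  model space; a bounded operator has symbol \<open>\<phi>\<close> if it agrees with the formula there.\<close>

definition trunc_toeplitz :: "l2T \<Rightarrow> (l2T \<Rightarrow> l2T) set" where
  "trunc_toeplitz u = {A. bounded_operator_on (model_space u) A \<and>
     (\<exists>\<phi>. \<forall>f\<in>model_space u. ess_bounded f \<longrightarrow> A f = P_model u (\<phi> \<odot> f))}"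

definition trunc_hankel :: "l2T \<Rightarrow> (l2T \<Rightarrow> l2T) set" where
  "trunc_hankel u = {B. bounded_operator_on (model_space u) B \<and>
     (\<exists>\<phi>. \<forall>f\<in>model_space u. ess_bounded f \<longrightarrow>
        B f = P_model u (J_op (\<phi> \<odot> f - orth_proj hardy (\<phi> \<odot> f))))}"

section \<open>Generalised compressed shifts\<close>

definition k0 :: "l2T \<Rightarrow> l2T" where
  "k0 u = const_l2T 1 - cnj (disc_value u 0) *\<^sub>C u"

definition k0_conj :: "l2T \<Rightarrow> l2T" where
  "k0_conj u = C_op u (k0 u)"

definition shift_op :: "l2T \<Rightarrow> l2T \<Rightarrow> l2T" where
  "shift_op u f = P_model u (id_l2T \<odot> f)"

text \<open>The operator \<open>S\<^sub>u\<^sup>\<alpha>\<close> for \<open>\<bar>\<alpha>\<bar> \<le> 1\<close>.\<close>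

definition shift_pert_disc :: "l2T \<Rightarrow> complex \<Rightarrow> l2T \<Rightarrow> l2T" where
  "shift_pert_disc u \<alpha> f =
     shift_op u f + (\<alpha> / (1 - \<alpha> * cnj (disc_value u 0))) *\<^sub>C rank_one (k0 u) (k0_conj u) f"

text \<open>The extended complex plane.\<close>

datatype ext_complex = Finite complex | Infinity

fun ext_cnj :: "ext_complex \<Rightarrow> ext_complex" where
  "ext_cnj (Finite \<alpha>) = Finite (cnj \<alpha>)"
| "ext_cnj Infinity = Infinity"

fun shift_pert :: "l2T \<Rightarrow> ext_complex \<Rightarrow> l2T \<Rightarrow> l2T" where
  "shift_pert u (Finite \<alpha>) =
     (if cmod \<alpha> \<le> 1 then shift_pert_disc u \<alpha>
      else adjoint_on (model_space u) (shift_pert_disc u (1 / cnj \<alpha>)))"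
| "shift_pert u Infinity = adjoint_on (model_space u) (shift_pert_disc u 0)"

end

(*
  On K_u one has D f = u J f, so B |-> B D maps the truncated Hankel operators onto the truncated
  Toeplitz operators.  Since moreover D S_u^alpha D is the adjoint of S_u^(conj alpha), the theorem
  is equivalent to Sedlock's description of the products of two truncated Toeplitz operators A, B
  that are again truncated Toeplitz: A or B is scalar, or both commute with one S_u^alpha.

  By Sarason, A is truncated Toeplitz iff A - S A S^* = psi (x) k + k (x) xi, where S = S_u and
  k = k_0^u.  Choose psi, xi orthogonal to k (up to a multiple of k (x) k), and let V be the
  conjugation f |-> S C f = u conj f on the orthogonal complement of k.  Using C A C = A^*, one finds
  that A B - S A B S^* compresses on that complement to psi (x) xi' - V xi (x) V psi', where the
  primed symbols belong to B.  This vanishes iff A or B is scalar, or psi = psi' = 0, or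
  V xi = alpha psi and V xi' = alpha psi' for one alpha; the latter two conditions say that A and B
  commute with S_u^alpha (with alpha = oo in the first of them).
*)
theory Submission
  imports Defs
begin

text \<open>Computing \<open>A B\<close> from the displacements leaves the values of
  \<open>A\<close> and \<open>adj B\<close> at \<open>k'\<close> undetermined, and these two vectors
  are the real obstacle. Against \<open>g\<close> orthogonal to \<open>k\<close>, the displacement
  of \<open>A\<close> at \<open>k\<close> is one linear equation for the numbers given by
  \<open>A k\<close> and \<open>S (A k')\<close>; that of the adjoint, carried back by the
  conjugation, is a second one. The determinant is \<open>cinner k k\<close>, that is
  \<open>1 - t * cnj t\<close>, nonzero because \<open>u\<close> is nonconstant. Solving this system
  is what brings in \<open>V \<xi>\<close>. The same solution explains the constant in the
  generalised shift: if \<open>V \<xi> = \<alpha> *\<^sub>C \<psi>\<close>, the commutator of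
  \<open>A\<close> with S plus a times the rank-one operator of \<open>k\<close> and
  \<open>k'\<close> is governed by a (1 - \<alpha> t) - \<alpha>, which vanishes exactly for the a
  used there. Passing to adjoints exchanges \<psi> and \<xi>, hence \<alpha> and 1 / cnj \<alpha>;
  this is the convention outside the disc. Conversely, commuting with one fixed generalised shift is
  inherited by products, and it alone forces a bounded operator to be truncated Toeplitz. Adjoints
  are explicit throughout: \<open>L\<close> is that of \<open>S\<close>, and \<open>C A C\<close>
  that of \<open>A\<close>.\<close>

section \<open>Representatives of classes of square-integrable functions\<close>

definition represents :: "(complex \<Rightarrow> complex) \<Rightarrow> l2T \<Rightarrow> bool" where
  "represents r f \<longleftrightarrow> square_integrable r \<and> f = abs_l2T r"

lemma represents_rep: "represents (rep_l2T f) f"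
  using Quotient3_abs_rep[OF Quotient3_l2T, of f] Quotient3_rep_reflp[OF Quotient3_l2T, of f]
  by (simp add: represents_def)

lemma represents_abs: "square_integrable r \<Longrightarrow> represents r (abs_l2T r)"
  by (simp add: represents_def)

lemma represents_square_integrable: "represents r f \<Longrightarrow> square_integrable r"
  by (simp add: represents_def)

lemma represents_eq_iff:
  assumes "represents r f" "represents s g"
  shows "f = g \<longleftrightarrow> (AE z in circle. r z = s z)"
  using assms Quotient3_rel[OF Quotient3_l2T, of r s] by (auto simp: represents_def)

lemmas represents_eqI = represents_eq_iff[THEN iffD2]

lemma represents_add: "represents r f \<Longrightarrow> represents s g \<Longrightarrow> represents (\<lambda>z. r z + s z) (f + g)"
  by (auto simp: represents_def plus_l2T.abs_eq square_integrable_add)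

lemma represents_zero: "represents (\<lambda>_. 0) 0"
  by (auto simp: represents_def zero_l2T_def square_integrable_def)

lemma represents_scaleC: "represents r f \<Longrightarrow> represents (\<lambda>z. c * r z) (c *\<^sub>C f)"
  by (auto simp: represents_def scaleC.abs_eq square_integrable_scale)

lemma represents_uminus: "represents r f \<Longrightarrow> represents (\<lambda>z. - r z) (- f)"
  using square_integrable_scale[of r "-1"] by (auto simp: represents_def uminus_l2T.abs_eq)

lemma represents_diff: "represents r f \<Longrightarrow> represents s g \<Longrightarrow> represents (\<lambda>z. r z - s z) (f - g)"
  using represents_add[OF _ represents_uminus, of r f s g] by simp

lemma represents_const: "represents (\<lambda>_. c) (const_l2T c)"
  by (auto simp: represents_def const_l2T_def intro: square_integrable_bounded)

lemma represents_id: "represents (\<lambda>z. z) id_l2T"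
proof -
  have "AE z in circle. cmod z \<le> 1"
    using AE_circle_norm by eventually_elim simp
  then show ?thesis
    by (auto simp: represents_def id_l2T_def intro: square_integrable_bounded)
qed

lemma represents_cnj: "represents r f \<Longrightarrow> represents (\<lambda>z. cnj (r z)) (cnj_l2T f)"
  by (auto simp: represents_def cnj_l2T.abs_eq square_integrable_def)

lemma represents_hat: "represents r f \<Longrightarrow> represents (\<lambda>z. cnj (r (cnj z))) (hat_op f)"
  using square_integrable_cnj_arg[of r] 
  by (auto simp: represents_def hat_op.abs_eq square_integrable_def)

lemma ess_bounded_iff: "represents r f \<Longrightarrow> ess_bounded f \<longleftrightarrow> (\<exists>c. AE z in circle. cmod (r z) \<le> c)"
  by (auto simp: represents_def ess_bounded.abs_eq)

lemma unimodular_iff: "represents r f \<Longrightarrow> unimodular f \<longleftrightarrow> (AE z in circle. cmod (r z) = 1)"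
  by (auto simp: represents_def unimodular.abs_eq)

lemma square_integrable_mult:
  assumes "square_integrable r" "square_integrable s" "AE z in circle. cmod (r z) \<le> c"
  shows "square_integrable (\<lambda>z. r z * s z)"
proof -
  have [measurable]: "r \<in> borel_measurable circle" "s \<in> borel_measurable circle"
    using assms by (auto simp: square_integrable_def)
  have "integrable circle (\<lambda>z. (cmod (r z * s z))\<^sup>2)"
  proof (rule Bochner_Integration.integrable_bound)
    show "integrable circle (\<lambda>z. c\<^sup>2 * (cmod (s z))\<^sup>2)"
      using assms by (auto simp: square_integrable_def)
    show "AE z in circle. norm ((cmod (r z * s z))\<^sup>2) \<le> norm (c\<^sup>2 * (cmod (s z))\<^sup>2)"
      using assms(3)
      by eventually_elim (auto simp: norm_mult power_mult_distrib intro!: mult_right_mono power_mono)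
  qed measurable
  then show ?thesis by (simp add: square_integrable_def)
qed

text \<open>A bounded factor keeps the product square-integrable, so the default value 0 of
  \<open>\<odot>\<close> is avoided.\<close>

lemma represents_mult:
  assumes "represents r f" "represents s g" "ess_bounded f \<or> ess_bounded g"
  shows "represents (\<lambda>z. r z * s z) (f \<odot> g)"
proof -
  have "square_integrable (\<lambda>z. r z * s z)"
    using assms(3)
  proof
    assume "ess_bounded f"
    then obtain c where "AE z in circle. cmod (r z) \<le> c" using ess_bounded_iff[OF assms(1)] by auto
    then show ?thesis using assms by (intro square_integrable_mult) (auto simp: represents_def)
  next
    assume "ess_bounded g"
    then obtain c where "AE z in circle. cmod (s z) \<le> c" using ess_bounded_iff[OF assms(2)] by auto
    then have "square_integrable (\<lambda>z. s z * r z)" using assms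
      by (intro square_integrable_mult) (auto simp: represents_def)
    then show ?thesis by (simp add: mult.commute)
  qed
  then show ?thesis using assms by (auto simp: represents_def mult_l2T.abs_eq)
qed

lemma represents_J: assumes "represents r f" shows "represents (\<lambda>z. cnj z * r (cnj z)) (J_op f)"
proof -
  have b: "ess_bounded (cnj_l2T id_l2T)"
    unfolding ess_bounded_iff[OF represents_cnj[OF represents_id]]
    using AE_circle_norm by (intro exI[of _ 1], eventually_elim) simp
  \<comment> \<open>Measurability and integrability come for free once \<open>J_op f\<close> is
    written as a product with the bounded function \<open>cnj_l2T id_l2T\<close>; the double
    conjugation then cancels.\<close>
  have "represents (\<lambda>z. cnj z * cnj (cnj (r (cnj z)))) (cnj_l2T id_l2T \<odot> cnj_l2T (hat_op f))"
    by (intro represents_mult represents_cnj represents_id represents_hat assms disjI1 b)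
  with assms show ?thesis by (auto simp: represents_def J_op.abs_eq)
qed

text \<open>Identities between classes are reduced to pointwise ones: these rules compute a
  representative along the structure of a term, and \<open>represents_eqI\<close> leaves an
  almost-everywhere identity.\<close>

lemmas represents_intros = represents_add represents_zero represents_scaleC represents_uminus
  represents_diff represents_const represents_id represents_cnj represents_hat represents_mult
  represents_J

lemma cinner_eq:
  "represents r f \<Longrightarrow> represents s g \<Longrightarrow> cinner f g = (\<integral>z. r z * cnj (s z) \<partial>circle)"
  by (auto simp: represents_def cinner.abs_eq)

lemma fourier_coeff_eq:
  "represents r f \<Longrightarrow> fourier_coeff f n = (\<integral>z. r z * z powi (- n) \<partial>circle)"
  by (auto simp: represents_def fourier_coeff.abs_eq)

lemma represents_integrable_mult:
  "represents r f \<Longrightarrow> represents s g \<Longrightarrow> integrable circle (\<lambda>z. r z * cnj (s z))"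
  by (auto simp: represents_def intro: square_integrable_integrable_mult)

section \<open>The complex inner product\<close>

lemma cinner_commute: "cinner g f = cnj (cinner f g)"
  unfolding cinner_eq[OF represents_rep represents_rep]
  by (simp flip: Bochner_Integration.integral_cnj add: mult.commute)

lemma cinner_add_left: "cinner (f + g) h = cinner f h + cinner g h"
  unfolding cinner_eq[OF represents_rep represents_rep, of f h]
    cinner_eq[OF represents_rep represents_rep, of g h]
    cinner_eq[OF represents_add[OF represents_rep represents_rep] represents_rep]
  by (subst Bochner_Integration.integral_add[symmetric])
     (auto intro!: represents_integrable_mult represents_rep simp: distrib_right)

lemma cinner_scaleC_left: "cinner (c *\<^sub>C f) g = c * cinner f g"
  unfolding cinner_eq[OF represents_rep represents_rep, of f g]
    cinner_eq[OF represents_scaleC[OF represents_rep] represents_rep]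
  by (simp add: mult.assoc)

lemma cinner_add_right: "cinner h (f + g) = cinner h f + cinner h g"
  by (metis cinner_commute cinner_add_left complex_cnj_add)

lemma cinner_scaleC_right: "cinner g (c *\<^sub>C f) = cnj c * cinner g f"
  by (metis cinner_commute cinner_scaleC_left complex_cnj_mult)

lemma cinner_zero_left [simp]: "cinner 0 f = 0"
  using cinner_add_left[of 0 0 f] by simp

lemma cinner_zero_right [simp]: "cinner f 0 = 0"
  using cinner_add_right[of f 0 0] by simp

lemma cinner_minus_left: "cinner (- f) g = - cinner f g"
  using cinner_add_left[of "-f" f g] by (simp add: eq_neg_iff_add_eq_0)

lemma cinner_minus_right: "cinner f (- g) = - cinner f g"
  using cinner_add_right[of f "-g" g] by (simp add: eq_neg_iff_add_eq_0)

lemma cinner_diff_left: "cinner (f - g) h = cinner f h - cinner g h"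
  using cinner_add_left[of f "-g" h] by (simp add: cinner_minus_left)

lemma cinner_diff_right: "cinner h (f - g) = cinner h f - cinner h g"
  using cinner_add_right[of h f "-g"] by (simp add: cinner_minus_right)

lemmas cinner_simps = cinner_add_left cinner_add_right cinner_diff_left cinner_diff_right
  cinner_scaleC_left cinner_scaleC_right cinner_minus_left cinner_minus_right

lemma cinner_self: "cinner f f = complex_of_real ((norm f)\<^sup>2)"
proof -
  have "Im (cinner f f) = 0"
    using cinner_commute[of f f] by (metis Reals_cnj_iff complex_is_Real_iff)
  moreover have "Re (cinner f f) = (norm f)\<^sup>2"
    by (simp add: norm_eq_sqrt_inner inner_l2T_def[symmetric])
  ultimately show ?thesis by (simp add: complex_eq_iff)
qed

lemma cinner_eq_zero_iff: "cinner f f = 0 \<longleftrightarrow> f = 0"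
  by (simp add: cinner_self)

lemma scaleC_add_right: "c *\<^sub>C (f + g) = c *\<^sub>C f + c *\<^sub>C g"
  by (rule represents_eqI, (rule represents_intros represents_rep)+) (simp add: algebra_simps)

lemma scaleC_add_left: "(c + d) *\<^sub>C f = c *\<^sub>C f + d *\<^sub>C f"
  by (rule represents_eqI, (rule represents_intros represents_rep)+) (simp add: algebra_simps)

lemma scaleC_diff_right: "c *\<^sub>C (f - g) = c *\<^sub>C f - c *\<^sub>C g"
  by (rule represents_eqI, (rule represents_intros represents_rep)+) (simp add: algebra_simps)

lemma scaleC_diff_left: "(c - d) *\<^sub>C f = c *\<^sub>C f - d *\<^sub>C f"
  by (rule represents_eqI, (rule represents_intros represents_rep)+) (simp add: algebra_simps)

lemma scaleC_scaleC: "c *\<^sub>C d *\<^sub>C f = (c * d) *\<^sub>C f"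
  by (rule represents_eqI, (rule represents_intros represents_rep)+) (simp add: algebra_simps)

lemma scaleC_one [simp]: "1 *\<^sub>C f = f"
  by (rule represents_eqI, (rule represents_intros represents_rep)+) simp

lemma scaleC_zero_left [simp]: "0 *\<^sub>C f = 0"
  by (rule represents_eqI, (rule represents_intros represents_rep)+) simp

lemma scaleC_zero_right [simp]: "c *\<^sub>C (0::l2T) = 0"
  by (rule represents_eqI, (rule represents_intros represents_rep)+) simp

lemma scaleC_minus_left: "(- c) *\<^sub>C f = - (c *\<^sub>C f)"
  by (rule represents_eqI, (rule represents_intros represents_rep)+) simp

lemma scaleC_minus_right: "c *\<^sub>C (- f) = - (c *\<^sub>C f)"
  by (rule represents_eqI, (rule represents_intros represents_rep)+) simp

lemma scaleR_scaleC: "r *\<^sub>R f = complex_of_real r *\<^sub>C f" for f :: l2T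
  by (simp add: scaleR_l2T_def)

lemma norm_scaleC: "norm (c *\<^sub>C f) = cmod c * norm f"
proof -
  have "cinner (c *\<^sub>C f) (c *\<^sub>C f) = (c * cnj c) * cinner f f"
    by (simp add: cinner_simps)
  also have "\<dots> = complex_of_real ((cmod c * norm f)\<^sup>2)"
    unfolding cinner_self complex_norm_square[symmetric] by (simp add: power_mult_distrib)
  finally show ?thesis
    unfolding cinner_self of_real_eq_iff by (simp add: power2_eq_iff_nonneg)
qed

lemma cinner_cauchy_schwarz: "cmod (cinner f g) \<le> norm f * norm g"
proof (cases "cinner f g = 0")
  case False
  \<comment> \<open>Rotating \<open>f\<close> by this unimodular constant makes the inner product
    real and nonnegative, so that the real Cauchy-Schwarz inequality gives the complex one.\<close>
  define c where "c = cnj (sgn (cinner f g))"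
  have c: "cmod c = 1" using False by (simp add: c_def norm_sgn)
  have "c * cinner f g = (cinner f g * cnj (cinner f g)) / complex_of_real (cmod (cinner f g))"
    by (simp add: c_def sgn_eq mult.commute)
  also have "\<dots> = complex_of_real (cmod (cinner f g))"
    using False unfolding complex_norm_square[symmetric] by (simp add: power2_eq_square)
  finally have "complex_of_real (cmod (cinner f g)) = c * cinner f g" ..
  then have "cmod (cinner f g) = Re (cinner (c *\<^sub>C f) g)"
    by (metis Re_complex_of_real cinner_scaleC_left)
  also have "\<dots> \<le> norm (c *\<^sub>C f) * norm g"
    using norm_cauchy_schwarz[of "c *\<^sub>C f" g] by (simp add: inner_l2T_def)
  finally show ?thesis by (simp add: norm_scaleC c)
qed simp

lemma bounded_linear_scaleC: "bounded_linear (\<lambda>f. c *\<^sub>C f)"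
  by (rule bounded_linear_intro[where K = "cmod c"])
     (auto simp: scaleC_add_right scaleR_scaleC scaleC_scaleC mult.commute norm_scaleC)

lemma bounded_linear_cinner_left: "bounded_linear (\<lambda>f. cinner f g)"
  by (rule bounded_linear_intro[where K = "norm g"])
     (auto simp: cinner_simps scaleR_scaleC scaleR_conv_of_real cinner_cauchy_schwarz)

section \<open>Multiplication by bounded functions\<close>

lemma ess_bounded_scaleC: "ess_bounded f \<Longrightarrow> ess_bounded (c *\<^sub>C f)"
proof -
  assume "ess_bounded f"
  then obtain d where "AE z in circle. cmod (rep_l2T f z) \<le> d"
    using ess_bounded_iff[OF represents_rep] by auto
  then have "AE z in circle. cmod (c * rep_l2T f z) \<le> cmod c * d"
    by eventually_elim (auto simp: norm_mult mult_left_mono)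
  then show ?thesis using ess_bounded_iff[OF represents_scaleC[OF represents_rep]] by blast
qed

lemma ess_bounded_add: "ess_bounded f \<Longrightarrow> ess_bounded g \<Longrightarrow> ess_bounded (f + g)"
proof -
  assume "ess_bounded f" "ess_bounded g"
  then obtain c d where "AE z in circle. cmod (rep_l2T f z) \<le> c" "AE z in circle. cmod (rep_l2T g z) \<le> d"
    using ess_bounded_iff[OF represents_rep] by meson
  then have "AE z in circle. cmod (rep_l2T f z + rep_l2T g z) \<le> c + d"
    by eventually_elim (auto intro: order_trans[OF norm_triangle_ineq] add_mono)
  then show ?thesis using ess_bounded_iff[OF represents_add[OF represents_rep represents_rep]] by blast
qed

lemma ess_bounded_uminus: "ess_bounded f \<Longrightarrow> ess_bounded (- f)"
  using ess_bounded_scaleC[of f "-1"] by (simp add: scaleC_minus_left)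

lemma ess_bounded_diff: "ess_bounded f \<Longrightarrow> ess_bounded g \<Longrightarrow> ess_bounded (f - g)"
  using ess_bounded_add[of f "-g"] by (simp add: ess_bounded_uminus)

lemma ess_bounded_const [simp]: "ess_bounded (const_l2T c)"
  unfolding ess_bounded_iff[OF represents_const] by auto

lemma ess_bounded_cnj: "ess_bounded f \<Longrightarrow> ess_bounded (cnj_l2T f)"
  using ess_bounded_iff[OF represents_rep, of f] ess_bounded_iff[OF represents_cnj[OF represents_rep], of f]
  by simp

lemma ess_bounded_hat: "ess_bounded f \<Longrightarrow> ess_bounded (hat_op f)"
proof -
  assume "ess_bounded f"
  then obtain c where "AE z in circle. cmod (rep_l2T f z) \<le> c"
    using ess_bounded_iff[OF represents_rep] by auto
  then have "AE z in circle. cmod (cnj (rep_l2T f (cnj z))) \<le> c"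
    by (intro AE_circle_cnj[of "\<lambda>z. cmod (cnj (rep_l2T f z)) \<le> c"]) simp
  then show ?thesis using ess_bounded_iff[OF represents_hat[OF represents_rep]] by blast
qed

lemma ess_bounded_mult: "ess_bounded f \<Longrightarrow> ess_bounded g \<Longrightarrow> ess_bounded (f \<odot> g)"
proof -
  assume b: "ess_bounded f" "ess_bounded g"
  then obtain c d where "AE z in circle. cmod (rep_l2T f z) \<le> c" "AE z in circle. cmod (rep_l2T g z) \<le> d"
    using ess_bounded_iff[OF represents_rep] by meson
  then have "AE z in circle. cmod (rep_l2T f z * rep_l2T g z) \<le> c * d"
    by eventually_elim
       (auto simp: norm_mult intro!: mult_mono intro: order_trans[OF norm_ge_zero])
  then show ?thesis
    using ess_bounded_iff[OF represents_mult[OF represents_rep represents_rep]] b by blast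
qed

lemma unimodular_ess_bounded:
  assumes "unimodular f" shows "ess_bounded f"
proof -
  have "AE z in circle. cmod (rep_l2T f z) \<le> 1"
    using assms[unfolded unimodular_iff[OF represents_rep]] by eventually_elim simp
  then show ?thesis using ess_bounded_iff[OF represents_rep] by blast
qed

lemma unimodular_id: "unimodular id_l2T"
  unfolding unimodular_iff[OF represents_id] by (rule AE_circle_norm)

lemma unimodular_cnj: "unimodular f \<Longrightarrow> unimodular (cnj_l2T f)"
  using unimodular_iff[OF represents_rep, of f] unimodular_iff[OF represents_cnj[OF represents_rep], of f]
  by simp

lemma unimodular_mult: "unimodular a \<Longrightarrow> unimodular b \<Longrightarrow> unimodular (a \<odot> b)"
proof -
  assume a: "unimodular a" and b: "unimodular b"
  then have "AE z in circle. cmod (rep_l2T a z) = 1" "AE z in circle. cmod (rep_l2T b z) = 1"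
    using unimodular_iff[OF represents_rep] by auto
  then have "AE z in circle. cmod (rep_l2T a z * rep_l2T b z) = 1"
    by eventually_elim (simp add: norm_mult)
  then show ?thesis
    using a b unimodular_iff[OF represents_mult[OF represents_rep represents_rep]] unimodular_ess_bounded by blast
qed

lemmas ess_bounded_id = unimodular_ess_bounded[OF unimodular_id]

lemmas ess_bounded_intros = ess_bounded_scaleC ess_bounded_add ess_bounded_uminus ess_bounded_diff
  ess_bounded_const ess_bounded_cnj ess_bounded_hat ess_bounded_mult ess_bounded_id

lemma mult_l2T_commute: "f \<odot> g = g \<odot> f"
  by transfer (auto simp: mult.commute square_integrable_def)

text \<open>With unbounded multipliers the law can fail: an inner product of functions may take the
  default value 0 although the full product is square-integrable.\<close>

lemma mult_l2T_assoc:
  assumes "ess_bounded a" "ess_bounded b"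
  shows "a \<odot> (b \<odot> f) = (a \<odot> b) \<odot> f"
  by (rule represents_eqI, (rule represents_intros represents_rep disjI1 assms ess_bounded_mult)+)
     (simp add: mult.assoc)

lemma mult_l2T_left_commute:
  assumes "ess_bounded a" "ess_bounded b"
  shows "a \<odot> (b \<odot> f) = b \<odot> (a \<odot> f)"
  using assms by (simp add: mult_l2T_assoc mult_l2T_commute[of a b])

lemma mult_l2T_add_right: "ess_bounded a \<Longrightarrow> a \<odot> (f + g) = a \<odot> f + a \<odot> g"
  by (rule represents_eqI, (rule represents_intros represents_rep disjI1 | assumption)+)
     (simp add: distrib_left)

lemma mult_l2T_diff_right: "ess_bounded a \<Longrightarrow> a \<odot> (f - g) = a \<odot> f - a \<odot> g"
  by (rule represents_eqI, (rule represents_intros represents_rep disjI1 | assumption)+)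
     (simp add: right_diff_distrib)

lemma mult_l2T_scaleC_right: "ess_bounded a \<Longrightarrow> a \<odot> (c *\<^sub>C f) = c *\<^sub>C (a \<odot> f)"
  by (rule represents_eqI, (rule represents_intros represents_rep disjI1 | assumption)+) simp

lemma mult_l2T_add_left: "ess_bounded f \<Longrightarrow> (a + b) \<odot> f = a \<odot> f + b \<odot> f"
  using mult_l2T_add_right[of f a b] by (simp add: mult_l2T_commute)

lemma mult_l2T_const: "const_l2T c \<odot> f = c *\<^sub>C f"
  by (rule represents_eqI, (rule represents_intros represents_rep disjI1 ess_bounded_const)+) simp

lemma mult_l2T_const_right: "f \<odot> const_l2T c = c *\<^sub>C f"
  by (simp add: mult_l2T_commute[of f] mult_l2T_const)

lemma cnj_l2T_mult: "ess_bounded a \<Longrightarrow> cnj_l2T (a \<odot> f) = cnj_l2T a \<odot> cnj_l2T f"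
  by (rule represents_eqI, (rule represents_intros represents_rep disjI1 ess_bounded_cnj | assumption)+)
     simp

lemma cnj_l2T_cnj [simp]: "cnj_l2T (cnj_l2T f) = f"
  by (rule represents_eqI, (rule represents_intros represents_rep)+) simp

lemma cnj_l2T_add: "cnj_l2T (f + g) = cnj_l2T f + cnj_l2T g"
  by (rule represents_eqI, (rule represents_intros represents_rep)+) simp

lemma cnj_l2T_scaleC: "cnj_l2T (c *\<^sub>C f) = cnj c *\<^sub>C cnj_l2T f"
  by (rule represents_eqI, (rule represents_intros represents_rep)+) simp

lemma scaleC_const: "c *\<^sub>C const_l2T d = const_l2T (c * d)"
  by (rule represents_eqI, (rule represents_intros represents_rep)+) simp

lemma const_l2T_zero [simp]: "const_l2T 0 = 0"
  by (rule represents_eqI, (rule represents_intros represents_rep)+) simp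

lemma hat_op_mult: "ess_bounded a \<Longrightarrow> hat_op (a \<odot> f) = hat_op a \<odot> hat_op f"
  by (rule represents_eqI, (rule represents_intros represents_rep disjI1 ess_bounded_hat | assumption)+)
     simp

lemma hat_op_hat [simp]: "hat_op (hat_op f) = f"
  by (rule represents_eqI, (rule represents_intros represents_rep)+) simp

lemma hat_op_add: "hat_op (f + g) = hat_op f + hat_op g"
  by (rule represents_eqI, (rule represents_intros represents_rep)+) simp

lemma hat_op_diff: "hat_op (f - g) = hat_op f - hat_op g"
  by (rule represents_eqI, (rule represents_intros represents_rep)+) simp

lemma hat_op_scaleC: "hat_op (c *\<^sub>C f) = cnj c *\<^sub>C hat_op f"
  by (rule represents_eqI, (rule represents_intros represents_rep)+) simp

lemma hat_op_const [simp]: "hat_op (const_l2T c) = const_l2T (cnj c)"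
  by (rule represents_eqI, (rule represents_intros represents_rep)+) simp

lemma hat_op_id [simp]: "hat_op id_l2T = id_l2T"
  by (rule represents_eqI, (rule represents_intros represents_rep)+) simp

lemma hat_op_cnj: "hat_op (cnj_l2T f) = cnj_l2T (hat_op f)"
  by (rule represents_eqI, (rule represents_intros represents_rep)+) simp

lemma J_op_eq: "J_op f = cnj_l2T id_l2T \<odot> cnj_l2T (hat_op f)"
  by (rule represents_eqI, (rule represents_intros represents_rep disjI1 ess_bounded_intros)+) simp

lemma unimodular_mult_cnj: "unimodular a \<Longrightarrow> a \<odot> cnj_l2T a = const_l2T 1"
proof (rule represents_eqI, (rule represents_intros represents_rep disjI1 unimodular_ess_bounded | assumption)+)
  assume "unimodular a"
  then have "AE z in circle. cmod (rep_l2T a z) = 1" by (simp add: unimodular_iff[OF represents_rep])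
  then show "AE z in circle. rep_l2T a z * cnj (rep_l2T a z) = 1"
    by eventually_elim (simp add: complex_norm_square[symmetric] flip: complex_norm_square)
qed

lemma unimodular_cancel: "unimodular a \<Longrightarrow> a \<odot> (cnj_l2T a \<odot> f) = f"
  by (simp add: mult_l2T_assoc unimodular_ess_bounded ess_bounded_cnj unimodular_mult_cnj mult_l2T_const)

lemma unimodular_cancel': "unimodular a \<Longrightarrow> cnj_l2T a \<odot> (a \<odot> f) = f"
  using unimodular_cancel[OF unimodular_cnj, of a f] by simp

lemma cinner_mult_left: "ess_bounded a \<Longrightarrow> cinner (a \<odot> f) g = cinner f (cnj_l2T a \<odot> g)"
  by (subst cinner_eq, (rule represents_intros represents_rep disjI1 | assumption)+,
      subst cinner_eq, (rule represents_intros represents_rep disjI1 ess_bounded_cnj | assumption)+)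
     (simp add: mult_ac)

lemma cinner_mult_right: "ess_bounded a \<Longrightarrow> cinner f (a \<odot> g) = cinner (cnj_l2T a \<odot> f) g"
  using cinner_mult_left[OF ess_bounded_cnj, of a f g] by simp

lemma cinner_cnj: "cinner (cnj_l2T f) (cnj_l2T g) = cinner g f"
  by (subst cinner_eq[OF represents_cnj[OF represents_rep] represents_cnj[OF represents_rep]],
      subst cinner_eq[OF represents_rep represents_rep]) (simp add: mult.commute)

lemma cinner_unimodular: "unimodular a \<Longrightarrow> cinner (a \<odot> f) (a \<odot> g) = cinner f g"
  by (simp add: cinner_mult_left unimodular_ess_bounded unimodular_cancel')

lemma norm_l2T_cinner: "norm f = norm g" if "cinner f f = cinner g g" for f g :: l2T
  using that by (simp add: cinner_self flip: of_real_power)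

lemma norm_unimodular: "unimodular a \<Longrightarrow> norm (a \<odot> f) = norm f"
  by (rule norm_l2T_cinner) (simp add: cinner_unimodular)

text \<open>The circle measure is invariant under \<open>cnj\<close>, and the outer conjugation in
  \<open>hat_op\<close> exchanges the two arguments.\<close>

lemma cinner_hat: "cinner (hat_op f) (hat_op g) = cinner g f"
proof -
  let ?f = "rep_l2T f" and ?g = "rep_l2T g"
  have [measurable]: "?f \<in> borel_measurable borel" "?g \<in> borel_measurable borel"
    using represents_square_integrable[OF represents_rep]
    by (auto simp: square_integrable_def cong: measurable_cong_sets)
  have "cinner g f = (\<integral>z. ?g z * cnj (?f z) \<partial>(distr circle borel cnj))"
    by (simp add: circle_cnj cinner_eq[OF represents_rep represents_rep])
  also have "\<dots> = (\<integral>z. ?g (cnj z) * cnj (?f (cnj z)) \<partial>circle)"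
    by (subst integral_distr) auto
  finally show ?thesis
    by (simp add: cinner_eq[OF represents_hat[OF represents_rep] represents_hat[OF represents_rep]] mult.commute)
qed

section \<open>Completeness\<close>

lemma norm_eq_represents:
  assumes "represents r f"
  shows "ennreal ((norm f)\<^sup>2) = (\<integral>\<^sup>+z. ennreal ((cmod (r z))\<^sup>2) \<partial>circle)"
proof -
  have i: "integrable circle (\<lambda>z. (cmod (r z))\<^sup>2)"
    using represents_square_integrable[OF assms] by (simp add: square_integrable_def)
  have "complex_of_real ((norm f)\<^sup>2) = (\<integral>z. r z * cnj (r z) \<partial>circle)"
    by (simp only: cinner_self[symmetric] cinner_eq[OF assms assms])
  also have "\<dots> = complex_of_real (\<integral>z. (cmod (r z))\<^sup>2 \<partial>circle)"
    unfolding complex_norm_square[symmetric] by (rule integral_complex_of_real)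
  finally have "(norm f)\<^sup>2 = (\<integral>z. (cmod (r z))\<^sup>2 \<partial>circle)"
    by (simp only: of_real_eq_iff)
  then show ?thesis using i by (simp add: nn_integral_eq_integral)
qed

text \<open>Cauchy-Schwarz against the constant 1, which has norm one because the circle has total
  mass one. It turns norm estimates into pointwise convergence below.\<close>

lemma nn_integral_cmod_le:
  assumes "represents r f"
  shows "(\<integral>\<^sup>+z. ennreal (cmod (r z)) \<partial>circle) \<le> ennreal (norm f)"
proof -
  have sq: "square_integrable r" by (rule represents_square_integrable[OF assms])
  then have [measurable]: "r \<in> borel_measurable circle" by (simp add: square_integrable_def)
  have 1: "represents (\<lambda>z. complex_of_real (cmod (r z))) (abs_l2T (\<lambda>z. complex_of_real (cmod (r z))))"
    by (intro represents_abs square_integrable_norm_cong[OF sq]) auto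
  have n: "norm (const_l2T 1) = 1"
    using norm_eq_represents[OF represents_const, of 1] emeasure_circle
    by (simp add: power2_eq_1_iff ennreal_eq_1) (smt (verit) norm_ge_zero)
  have n': "norm (abs_l2T (\<lambda>z. complex_of_real (cmod (r z)))) = norm f"
  proof -
    have "ennreal ((norm (abs_l2T (\<lambda>z. complex_of_real (cmod (r z)))))\<^sup>2) = ennreal ((norm f)\<^sup>2)"
      unfolding norm_eq_represents[OF 1] norm_eq_represents[OF assms] by simp
    then show ?thesis by simp
  qed
  have i: "integrable circle (\<lambda>z. cmod (r z))"
    using represents_integrable_mult[OF 1 represents_const[of 1]] by (simp add: complex_of_real_integrable_eq)
  have "cmod (cinner (abs_l2T (\<lambda>z. complex_of_real (cmod (r z)))) (const_l2T 1)) \<le> norm f"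
    using cinner_cauchy_schwarz[of "abs_l2T (\<lambda>z. complex_of_real (cmod (r z)))" "const_l2T 1"] n n' by simp
  then have "cmod (\<integral>z. complex_of_real (cmod (r z)) \<partial>circle) \<le> norm f"
    by (simp add: cinner_eq[OF 1 represents_const])
  then have "(\<integral>z. cmod (r z) \<partial>circle) \<le> norm f"
    by (simp add: integral_complex_of_real)
  then show ?thesis using i by (simp add: nn_integral_eq_integral ennreal_leI)
qed

text \<open>The Riesz-Fischer argument: the increments are summable in mean, so the representatives
  converge almost everywhere, and Fatou's lemma shows that the pointwise limit is also the limit in
  norm.\<close>

lemma fast_Cauchy_convergent:
  fixes X :: "nat \<Rightarrow> l2T"
  assumes X: "\<And>n. norm (X (Suc n) - X n) \<le> (1/2) ^ n"
  shows "convergent X"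
proof -
  define r where "r n = rep_l2T (X n)" for n
  have rep: "represents (r n) (X n)" for n by (simp add: r_def represents_rep)
  have sq: "square_integrable (r n)" for n by (rule represents_square_integrable[OF rep])
  have [measurable]: "r n \<in> borel_measurable circle" for n
    using sq by (simp add: square_integrable_def)
  have "(\<integral>\<^sup>+z. (\<Sum>n. ennreal (cmod (r (Suc n) z - r n z))) \<partial>circle)
      = (\<Sum>n. \<integral>\<^sup>+z. ennreal (cmod (r (Suc n) z - r n z)) \<partial>circle)"
    by (intro nn_integral_suminf) measurable
  also have "\<dots> \<le> (\<Sum>n. ennreal ((1/2) ^ n))"
    by (intro suminf_le summableI
        order_trans[OF nn_integral_cmod_le[OF represents_diff[OF rep rep]] ennreal_leI[OF X]])
  also have "\<dots> = ennreal (\<Sum>n. (1/2) ^ n)"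
    by (intro suminf_ennreal2) (auto intro: summable_geometric)
  also have "\<dots> < \<infinity>" by simp
  finally have "AE z in circle. (\<Sum>n. ennreal (cmod (r (Suc n) z - r n z))) \<noteq> \<infinity>"
    by (intro nn_integral_PInf_AE) auto
  then have conv: "AE z in circle. convergent (\<lambda>n. r n z)"
  proof eventually_elim
    case (elim z)
    then have "summable (\<lambda>n. cmod (r (Suc n) z - r n z))"
      by (intro summable_suminf_not_top) auto
    then have "summable (\<lambda>n. r (Suc n) z - r n z)" by (rule summable_norm_cancel)
    then have "convergent (\<lambda>n. r n z - r 0 z)"
      unfolding summable_iff_convergent sum_lessThan_telescope[of "\<lambda>n. r n z"] .
    from convergent_add[OF this convergent_const[of "r 0 z"]] show ?case by simp
  qed
  define F where "F z = lim (\<lambda>n. r n z)" for z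
  have [measurable]: "F \<in> borel_measurable circle" unfolding F_def by (rule borel_measurable_lim_metric) simp
  have lim: "AE z in circle. (\<lambda>n. r n z) \<longlonglongrightarrow> F z"
    using conv by eventually_elim (simp add: F_def convergent_LIMSEQ_iff)
  have tail: "norm (X m - X n) \<le> 2 * (1/2) ^ n" if "n \<le> m" for n m
  proof -
    \<comment> \<open>Subtracting the last term gives the exact partial geometric sum, and the
      induction on \<open>m\<close> closes only in this form.\<close>
    have "norm (X m - X n) \<le> 2 * (1/2) ^ n - 2 * (1/2) ^ m" using that
    proof (induction m rule: dec_induct)
      case (step m)
      have "norm (X (Suc m) - X n) \<le> norm (X (Suc m) - X m) + norm (X m - X n)"
        using norm_triangle_ineq[of "X (Suc m) - X m" "X m - X n"] by simp
      with step X[of m] show ?case by simp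
    qed simp
    moreover have "(0::real) \<le> 2 * (1/2) ^ m" by simp
    ultimately show ?thesis by linarith
  qed
  have est: "(\<integral>\<^sup>+z. ennreal ((cmod (F z - r n z))\<^sup>2) \<partial>circle) \<le> ennreal ((2 * (1/2) ^ n)\<^sup>2)" for n
  proof -
    have "(\<integral>\<^sup>+z. ennreal ((cmod (F z - r n z))\<^sup>2) \<partial>circle)
        = (\<integral>\<^sup>+z. liminf (\<lambda>m. ennreal ((cmod (r m z - r n z))\<^sup>2)) \<partial>circle)"
    proof (rule nn_integral_cong_AE)
      show "AE z in circle. ennreal ((cmod (F z - r n z))\<^sup>2) = liminf (\<lambda>m. ennreal ((cmod (r m z - r n z))\<^sup>2))"
        using lim
      proof eventually_elim
        case (elim z)
        then have "(\<lambda>m. ennreal ((cmod (r m z - r n z))\<^sup>2)) \<longlonglongrightarrow> ennreal ((cmod (F z - r n z))\<^sup>2)"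
          by (intro tendsto_intros)
        from lim_imp_Liminf[OF _ this] show ?case by simp
      qed
    qed
    also have "\<dots> \<le> liminf (\<lambda>m. \<integral>\<^sup>+z. ennreal ((cmod (r m z - r n z))\<^sup>2) \<partial>circle)"
      by (intro nn_integral_liminf) measurable
    also have "\<dots> = liminf (\<lambda>m. ennreal ((norm (X m - X n))\<^sup>2))"
      by (simp add: norm_eq_represents[OF represents_diff[OF rep rep]])
    also have "\<dots> \<le> ennreal ((2 * (1/2) ^ n)\<^sup>2)"
    proof (rule Liminf_le)
      show "\<forall>\<^sub>F m in sequentially. ennreal ((norm (X m - X n))\<^sup>2) \<le> ennreal ((2 * (1/2) ^ n)\<^sup>2)"
        using eventually_ge_at_top[of n]
        by eventually_elim (intro ennreal_leI power_mono tail norm_ge_zero)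
    qed simp
    finally show ?thesis .
  qed
  have sqd: "square_integrable (\<lambda>z. F z - r n z)" for n
    unfolding square_integrable_def
  proof
    show "integrable circle (\<lambda>z. (cmod (F z - r n z))\<^sup>2)"
      using le_less_trans[OF est[of n]] by (intro integrableI_bounded) auto
  qed measurable
  have "square_integrable F" using square_integrable_add[OF sqd[of 0] sq[of 0]] by simp
  then have rF: "represents F (abs_l2T F)" by (rule represents_abs)
  have le: "norm (X n - abs_l2T F) \<le> 2 * (1/2) ^ n" for n
  proof -
    have "ennreal ((norm (abs_l2T F - X n))\<^sup>2) \<le> ennreal ((2 * (1/2) ^ n)\<^sup>2)"
      unfolding norm_eq_represents[OF represents_diff[OF rF rep]] by (rule est)
    then have "(norm (abs_l2T F - X n))\<^sup>2 \<le> (2 * (1/2) ^ n)\<^sup>2" 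
      by (subst (asm) ennreal_le_iff) auto
    then have "norm (abs_l2T F - X n) \<le> 2 * (1/2) ^ n" by (rule power2_le_imp_le) simp
    then show ?thesis by (simp add: norm_minus_commute)
  qed
  have "(\<lambda>n. 2 * (1/2) ^ n :: real) \<longlonglongrightarrow> 2 * 0"
    by (intro tendsto_intros LIMSEQ_power_zero) simp
  then have "(\<lambda>n. 2 * (1/2) ^ n :: real) \<longlonglongrightarrow> 0" by simp
  then have "(\<lambda>n. X n - abs_l2T F) \<longlonglongrightarrow> 0"
    by (rule Lim_null_comparison[OF always_eventually[OF allI[OF le]]])
  then have "X \<longlonglongrightarrow> abs_l2T F" by (rule LIM_zero_cancel)
  then show ?thesis by (rule convergentI)
qed

instance l2T :: complete_space
proof
  fix X :: "nat \<Rightarrow> l2T" assume X: "Cauchy X"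
  have "\<exists>N. \<forall>m\<ge>N. \<forall>n\<ge>N. norm (X m - X n) < (1/2) ^ k" for k
    using X by (intro CauchyD) auto
  then obtain N where N: "\<And>k m n. m \<ge> N k \<Longrightarrow> n \<ge> N k \<Longrightarrow> norm (X m - X n) < (1/2) ^ k"
    by metis
  \<comment> \<open>Partial sums of \<open>Suc (N i)\<close> increase strictly and stay above each
    \<open>N k\<close>, so consecutive terms of the subsequence are close enough for
    \<open>fast_Cauchy_convergent\<close>.\<close>
  define s where "s k = (\<Sum>i\<le>k. Suc (N i))" for k
  have s: "strict_mono s" by (intro strict_monoI_Suc) (simp add: s_def)
  have sN: "N k \<le> s k" for k
  proof -
    have "Suc (N k) \<le> s k" unfolding s_def by (intro member_le_sum) auto
    then show ?thesis by simp
  qed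
  have "convergent (X \<circ> s)"
  proof (rule fast_Cauchy_convergent)
    fix n
    have "N n \<le> s (Suc n)" using sN[of n] strict_mono_less[OF s, of n "Suc n"] by linarith
    with sN[of n] N[of n "s (Suc n)" "s n"] show "norm ((X \<circ> s) (Suc n) - (X \<circ> s) n) \<le> (1/2) ^ n"
      by simp
  qed
  then obtain l where "(X \<circ> s) \<longlonglongrightarrow> l" by (auto simp: convergent_def)
  then show "convergent X" using X Cauchy_converges_subseq[OF X s] by (auto simp: convergent_def)
qed

section \<open>Orthogonal projections\<close>

definition csubspace_l2T :: "l2T set \<Rightarrow> bool" where
  "csubspace_l2T M \<longleftrightarrow> 0 \<in> M \<and> (\<forall>f\<in>M. \<forall>g\<in>M. f + g \<in> M) \<and> (\<forall>c. \<forall>f\<in>M. c *\<^sub>C f \<in> M)"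

lemma csubspace_l2T_zero: "csubspace_l2T M \<Longrightarrow> 0 \<in> M"
  and csubspace_l2T_add: "csubspace_l2T M \<Longrightarrow> f \<in> M \<Longrightarrow> g \<in> M \<Longrightarrow> f + g \<in> M"
  and csubspace_l2T_scaleC: "csubspace_l2T M \<Longrightarrow> f \<in> M \<Longrightarrow> c *\<^sub>C f \<in> M"
  by (auto simp: csubspace_l2T_def)

lemma csubspace_l2T_uminus: "csubspace_l2T M \<Longrightarrow> f \<in> M \<Longrightarrow> - f \<in> M"
  using csubspace_l2T_scaleC[of M f "-1"] by (simp add: scaleC_minus_left)

lemma csubspace_l2T_diff: "csubspace_l2T M \<Longrightarrow> f \<in> M \<Longrightarrow> g \<in> M \<Longrightarrow> f - g \<in> M"
  using csubspace_l2T_add[of M f "-g"] csubspace_l2T_uminus[of M g] by simp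

lemma csubspace_l2T_closure:
  assumes "csubspace_l2T M" shows "csubspace_l2T (closure M)"
proof -
  have "f + g \<in> closure M" if "f \<in> closure M" "g \<in> closure M" for f g
  proof -
    obtain x y where xy: "\<And>n. x n \<in> M" "x \<longlonglongrightarrow> f" "\<And>n. y n \<in> M" "y \<longlonglongrightarrow> g"
      using \<open>f \<in> closure M\<close> \<open>g \<in> closure M\<close> unfolding closure_sequential by blast
    have "(\<lambda>n. x n + y n) \<longlonglongrightarrow> f + g" using xy by (intro tendsto_intros)
    with xy csubspace_l2T_add[OF assms] show ?thesis unfolding closure_sequential
      by (intro exI[of _ "\<lambda>n. x n + y n"]) auto
  qed
  moreover have "c *\<^sub>C f \<in> closure M" if "f \<in> closure M" for c f
  proof -
    obtain x where xy: "\<And>n. x n \<in> M" "x \<longlonglongrightarrow> f"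
      using \<open>f \<in> closure M\<close> unfolding closure_sequential by blast
    have "(\<lambda>n. c *\<^sub>C x n) \<longlonglongrightarrow> c *\<^sub>C f"
      using xy by (intro bounded_linear.tendsto[OF bounded_linear_scaleC])
    with xy csubspace_l2T_scaleC[OF assms] show ?thesis unfolding closure_sequential
      by (intro exI[of _ "\<lambda>n. c *\<^sub>C x n"]) auto
  qed
  ultimately show ?thesis
    using csubspace_l2T_zero[OF assms] closure_subset[of M] by (auto simp: csubspace_l2T_def)
qed

text \<open>A minimising sequence for the distance to \<open>M\<close> is Cauchy by the parallelogram law.\<close>

lemma orth_proj_ex:
  assumes M: "csubspace_l2T M" "closed M"
  shows "\<exists>g\<in>M. \<forall>h\<in>M. cinner (f - g) h = 0"
proof -
  define d where "d = (INF g\<in>M. (norm (f - g))\<^sup>2)"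
  have ne: "M \<noteq> {}" using csubspace_l2T_zero[OF M(1)] by auto
  have bb: "bdd_below ((\<lambda>g. (norm (f - g))\<^sup>2) ` M)" by (rule bdd_belowI2[of _ 0]) simp
  have d: "d \<le> (norm (f - g))\<^sup>2" if "g \<in> M" for g
    unfolding d_def by (rule cINF_lower[OF bb that])
  have "\<exists>g\<in>M. (norm (f - g))\<^sup>2 < d + inverse (real (Suc n))" for n
    using cINF_less_iff[OF ne bb, of "d + inverse (real (Suc n))"] by (simp add: d_def)
  then obtain x where x: "\<And>n. x n \<in> M" "\<And>n. (norm (f - x n))\<^sup>2 < d + inverse (real (Suc n))"
    by metis
  have est: "(norm (x m - x n))\<^sup>2 \<le> 2 * inverse (real (Suc m)) + 2 * inverse (real (Suc n))" for m n
  proof -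
    define a b where "a = f - x m" and "b = f - x n"
    have "(norm (a - b))\<^sup>2 + (norm (a + b))\<^sup>2 = 2 * (norm a)\<^sup>2 + 2 * (norm b)\<^sup>2"
      by (simp add: power2_norm_eq_inner inner_diff_left inner_diff_right inner_add_left inner_add_right
          inner_commute)
    moreover have "(norm (a + b))\<^sup>2 \<ge> 4 * d"
    proof -
      have mid: "(1/2) *\<^sub>R (x m + x n) \<in> M"
        unfolding scaleR_scaleC by (intro csubspace_l2T_scaleC csubspace_l2T_add M x)
      have "a + b = 2 *\<^sub>R (f - (1/2) *\<^sub>R (x m + x n))"
        by (simp add: a_def b_def algebra_simps scaleR_2)
      then have "(norm (a + b))\<^sup>2 = 4 * (norm (f - (1/2) *\<^sub>R (x m + x n)))\<^sup>2"
        by (simp add: power_mult_distrib)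
      with d[OF mid] show ?thesis by simp
    qed
    moreover have "(norm a)\<^sup>2 < d + inverse (real (Suc m))" "(norm b)\<^sup>2 < d + inverse (real (Suc n))"
      unfolding a_def b_def by (rule x)+
    moreover have "norm (a - b) = norm (x m - x n)" by (simp add: a_def b_def norm_minus_commute)
    ultimately show ?thesis by simp
  qed
  have "Cauchy x"
  proof (rule CauchyI)
    fix e :: real assume e: "e > 0"
    obtain k where k: "inverse (real (Suc k)) < e\<^sup>2 / 4" using reals_Archimedean[of "e\<^sup>2/4"] e by auto
    show "\<exists>K. \<forall>m\<ge>K. \<forall>n\<ge>K. norm (x m - x n) < e"
    proof (intro exI[of _ k] allI impI)
      fix m n assume mn: "k \<le> m" "k \<le> n"
      have "inverse (real (Suc m)) \<le> inverse (real (Suc k))" "inverse (real (Suc n)) \<le> inverse (real (Suc k))"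
        using mn by (auto intro: le_imp_inverse_le)
      with est[of m n] k have "(norm (x m - x n))\<^sup>2 < e\<^sup>2" by linarith
      then show "norm (x m - x n) < e" by (rule power2_less_imp_less) (use e in simp)
    qed
  qed
  then obtain g where g: "x \<longlonglongrightarrow> g" using Cauchy_convergent_iff convergent_def by blast
  have gM: "g \<in> M" using closed_sequentially[OF M(2)] x(1) g by blast
  have "(\<lambda>n. (norm (f - x n))\<^sup>2) \<longlonglongrightarrow> (norm (f - g))\<^sup>2" using g by (intro tendsto_intros)
  moreover have "(\<lambda>n. d + inverse (real (Suc n))) \<longlonglongrightarrow> d"
    using tendsto_add[OF tendsto_const LIMSEQ_inverse_real_of_nat, of d] by simp
  ultimately have gd: "(norm (f - g))\<^sup>2 \<le> d"
    using x(2) by (intro LIMSEQ_le) (auto intro: less_imp_le)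
  have re: "Re (cinner (f - g) h) = 0" if h: "h \<in> M" for h
  proof (cases "h = 0")
    case False
    \<comment> \<open>This \<open>r\<close> minimises the quadratic polynomial
      \<open>r \<mapsto> (norm ((f - g) - r *\<^sub>R h))\<^sup>2\<close>.\<close>
    define r where "r = (f - g) \<bullet> h / (h \<bullet> h)"
    have "g + r *\<^sub>R h \<in> M" unfolding scaleR_scaleC by (intro csubspace_l2T_add csubspace_l2T_scaleC M gM h)
    from order_trans[OF gd d[OF this]] have "(norm (f - g))\<^sup>2 \<le> (norm ((f - g) - r *\<^sub>R h))\<^sup>2"
      by (simp only: diff_diff_eq)
    also have "\<dots> = (norm (f - g))\<^sup>2 - 2 * r * ((f - g) \<bullet> h) + r\<^sup>2 * (h \<bullet> h)"
      unfolding power2_norm_eq_inner inner_diff_left[of _ "r *\<^sub>R h"] inner_diff_right[of _ _ "r *\<^sub>R h"]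
      by (simp add: inner_commute power2_eq_square algebra_simps)
    finally have "0 \<le> - 2 * r * ((f - g) \<bullet> h) + r\<^sup>2 * (h \<bullet> h)" by simp
    also have "\<dots> = - ((f - g) \<bullet> h)\<^sup>2 / (h \<bullet> h)"
      using False by (simp add: r_def power2_eq_square field_simps)
    finally have "((f - g) \<bullet> h)\<^sup>2 / (h \<bullet> h) \<le> 0" by simp
    moreover have "h \<bullet> h > 0" using False by simp
    ultimately have "((f - g) \<bullet> h)\<^sup>2 \<le> 0" by (simp add: divide_le_0_iff)
    then have "(f - g) \<bullet> h = 0" by simp
    then show ?thesis by (simp add: inner_l2T_def)
  qed simp
  \<comment> \<open>The imaginary part of the inner product with \<open>h\<close> is the real part
    of the one with \<open>\<i> *\<^sub>C h\<close>, which also lies in \<open>M\<close>.\<close>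
  have "cinner (f - g) h = 0" if h: "h \<in> M" for h
    using re[OF h] re[OF csubspace_l2T_scaleC[OF M(1) h], of \<i>]
    by (simp add: cinner_simps complex_eq_iff)
  with gM show ?thesis by blast
qed

lemma orth_proj_unique:
  assumes "csubspace_l2T M" "g \<in> M" "\<And>h. h \<in> M \<Longrightarrow> cinner (f - g) h = 0"
  shows "orth_proj M f = g"
  unfolding orth_proj_def
proof (rule the_equality)
  show "g \<in> M \<and> (\<forall>h\<in>M. cinner (f - g) h = 0)" using assms by simp
  fix g' assume g': "g' \<in> M \<and> (\<forall>h\<in>M. cinner (f - g') h = 0)"
  have m: "g' - g \<in> M" using g' assms(1,2) by (simp add: csubspace_l2T_diff)
  have "cinner (g' - g) (g' - g) = cinner (f - g) (g' - g) - cinner (f - g') (g' - g)"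
    by (simp add: cinner_diff_left)
  also have "\<dots> = 0" using g' assms(3) m by simp
  finally show "g' = g" by (simp add: cinner_eq_zero_iff)
qed

lemma
  assumes "csubspace_l2T M" "closed M"
  shows orth_proj_in: "orth_proj M f \<in> M"
    and orth_proj_orth: "h \<in> M \<Longrightarrow> cinner (f - orth_proj M f) h = 0"
  using orth_proj_ex[OF assms, of f] orth_proj_unique[OF assms(1)] by metis+

lemma cinner_orth_proj:
  assumes "csubspace_l2T M" "closed M" "h \<in> M"
  shows "cinner (orth_proj M f) h = cinner f h"
  using orth_proj_orth[OF assms] by (simp add: cinner_simps)

text \<open>The residual of the projection onto the closure of \<open>M\<close> lies in
  \<open>K\<close> and is orthogonal to \<open>M\<close>. Both density results below, for powers of
  z and for bounded functions, come from this criterion.\<close>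

lemma closure_if_no_orth:
  assumes "csubspace_l2T K" "csubspace_l2T M" "M \<subseteq> K" "closed K"
    and "\<And>f. f \<in> K \<Longrightarrow> (\<And>g. g \<in> M \<Longrightarrow> cinner f g = 0) \<Longrightarrow> f = 0"
  shows "K \<subseteq> closure M"
proof
  fix f assume f: "f \<in> K"
  have c: "csubspace_l2T (closure M)" using assms(2) by (rule csubspace_l2T_closure)
  let ?g = "orth_proj (closure M) f"
  have g: "?g \<in> closure M" by (rule orth_proj_in[OF c closed_closure])
  have "closure M \<subseteq> K" using assms(3,4) by (rule closure_minimal)
  with g have "?g \<in> K" by auto
  then have "f - ?g = 0"
    using orth_proj_orth[OF c closed_closure, of _ f] closure_subset[of M] f
    by (intro assms(5) csubspace_l2T_diff[OF assms(1)]) auto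
  with g show "f \<in> closure M" by simp
qed

section \<open>Fourier coefficients\<close>

definition zpow :: "int \<Rightarrow> l2T" where
  "zpow n = abs_l2T (\<lambda>z. z powi n)"

lemma powi_borel_measurable [measurable]: "(\<lambda>z::complex. z powi n) \<in> borel_measurable borel"
  unfolding power_int_def by measurable

lemma represents_zpow: "represents (\<lambda>z. z powi n) (zpow n)"
proof -
  have "AE z in circle. cmod (z powi n) \<le> 1"
    using AE_circle_norm by eventually_elim (simp add: norm_power_int)
  then show ?thesis unfolding zpow_def by (intro represents_abs square_integrable_bounded) auto
qed

lemma unimodular_zpow: "unimodular (zpow n)"
  unfolding unimodular_iff[OF represents_zpow]
  using AE_circle_norm by eventually_elim (simp add: norm_power_int)

lemmas ess_bounded_zpow = unimodular_ess_bounded[OF unimodular_zpow]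

lemma cnj_unit: "cmod z = 1 \<Longrightarrow> cnj z = inverse z"
  using inverse_unique[of z "cnj z"] complex_norm_square[of z] by simp

lemma cnj_powi_unit: "cmod z = 1 \<Longrightarrow> cnj z powi n = z powi (- n)"
  by (simp add: cnj_unit power_int_inverse power_int_minus)

lemma powi_add_unit: "cmod z = 1 \<Longrightarrow> z powi (m + n) = z powi m * z powi n"
  by (rule power_int_add) auto

lemma fourier_coeff_cinner: "fourier_coeff f n = cinner f (zpow n)"
  unfolding fourier_coeff_eq[OF represents_rep] cinner_eq[OF represents_rep represents_zpow]
proof (rule integral_cong_AE)
  show "AE z in circle. rep_l2T f z * z powi - n = rep_l2T f z * cnj (z powi n)"
    using AE_circle_norm by eventually_elim (simp add: cnj_powi_unit)
qed (use represents_square_integrable[OF represents_rep, of f] in \<open>auto simp: square_integrable_def\<close>)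

lemma zpow_0: "zpow 0 = const_l2T 1"
  by (rule represents_eqI[OF represents_zpow represents_const]) simp

lemma mult_zpow: "zpow m \<odot> zpow n = zpow (m + n)"
proof (rule represents_eqI[OF represents_mult[OF represents_zpow represents_zpow] represents_zpow])
  show "AE z in circle. z powi m * z powi n = z powi (m + n)"
    using AE_circle_norm by eventually_elim (simp add: powi_add_unit)
qed (simp add: ess_bounded_zpow)

lemma id_zpow: "id_l2T = zpow 1"
  by (rule represents_eqI[OF represents_id represents_zpow]) simp

lemma cnj_zpow: "cnj_l2T (zpow n) = zpow (- n)"
proof (rule represents_eqI[OF represents_cnj[OF represents_zpow] represents_zpow])
  show "AE z in circle. cnj (z powi n) = z powi (- n)"
    using AE_circle_norm by eventually_elim (simp add: cnj_powi_unit)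
qed

lemma fourier_coeff_mult_zpow: "fourier_coeff (zpow m \<odot> f) n = fourier_coeff f (n - m)"
  by (simp add: fourier_coeff_cinner cinner_mult_left ess_bounded_zpow cnj_zpow mult_zpow)

lemma integral_circle_powi:
  assumes "n \<noteq> 0" shows "(\<integral>z. z powi n \<partial>circle) = 0"
proof -
  have "(\<integral>z. z powi n \<partial>circle) = (\<integral>x. cis x powi n \<partial>(uniform_measure lborel {-pi..pi}))"
    unfolding circle_def by (subst integral_distr) auto
  also have "\<dots> = (\<integral>x. (indicator {-pi..pi} x / (2 * pi)) *\<^sub>R cis x powi n \<partial>lborel)"
  proof -
    have u: "uniform_measure lborel {-pi..pi} = density lborel (\<lambda>x. ennreal (indicator {-pi..pi} x / (2 * pi)))"
      unfolding uniform_measure_def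
      by (intro density_cong) (auto simp: indicator_def divide_ennreal[of 1 "2 * pi", simplified])
    then show ?thesis by (subst u, subst integral_density) auto
  qed
  also have "\<dots> = (\<integral>x. indicator {-pi..pi} x *\<^sub>R (cis (real_of_int n * x) / (2 * pi)) \<partial>lborel)"
    by (intro Bochner_Integration.integral_cong) (auto simp: cis_power_int scaleR_conv_of_real indicator_def)
  also have "\<dots> = cis (real_of_int n * pi) / (\<i> * n * (2 * pi)) - cis (real_of_int n * (- pi)) / (\<i> * n * (2 * pi))"
  proof (rule integral_FTC_atLeastAtMost)
    fix x :: real
    have "((\<lambda>x. cis (real_of_int n * x)) has_vector_derivative (real_of_int n) *\<^sub>R (\<i> * cis (real_of_int n * x))) (at x within {-pi..pi})"
      using exp_scaleR_has_vector_derivative_right[of "\<i> * n" x "{-pi..pi}"]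
      by (simp add: cis_conv_exp scaleR_conv_of_real mult_ac)
    then have "((\<lambda>x. cis (real_of_int n * x) / (\<i> * n * (2 * pi))) has_vector_derivative
        (real_of_int n) *\<^sub>R (\<i> * cis (real_of_int n * x)) / (\<i> * n * (2 * pi))) (at x within {-pi..pi})"
      by (rule has_vector_derivative_divide)
    also have "(real_of_int n) *\<^sub>R (\<i> * cis (real_of_int n * x)) / (\<i> * n * (2 * pi)) = cis (real_of_int n * x) / (2 * pi)"
      using assms by (simp add: scaleR_conv_of_real field_simps)
    finally show "((\<lambda>x. cis (real_of_int n * x) / (\<i> * n * (2 * pi))) has_vector_derivative
        cis (real_of_int n * x) / (2 * pi)) (at x within {-pi..pi})" .
  qed (auto intro!: continuous_intros)
  also have "cis (real_of_int n * (- pi)) = cis (real_of_int n * pi)"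
    by (rule complex_eqI) (auto simp: mult.commute)
  finally show ?thesis by simp
qed

lemma fourier_coeff_zpow: "fourier_coeff (zpow m) n = (if m = n then 1 else 0)"
proof -
  have "fourier_coeff (zpow m) n = (\<integral>z. z powi m * z powi (- n) \<partial>circle)"
    by (rule fourier_coeff_eq[OF represents_zpow])
  also have "\<dots> = (\<integral>z. z powi (m - n) \<partial>circle)"
  proof (rule integral_cong_AE)
    show "AE z in circle. z powi m * z powi (- n) = z powi (m - n)"
      using AE_circle_norm by eventually_elim (simp add: powi_add_unit flip: add_uminus_conv_diff)
  qed auto
  also have "\<dots> = (if m = n then 1 else 0)"
    using integral_circle_powi[of "m - n"] emeasure_circle by (simp add: measure_def)
  finally show ?thesis .
qed

section \<open>Uniqueness of Fourier coefficients\<close>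

text \<open>Stated for integrable functions and not for classes in \<open>l2T\<close>, since the
  argument multiplies by polynomials and then integrates over Borel sets.\<close>

definition fourier_null :: "(complex \<Rightarrow> complex) \<Rightarrow> bool" where
  "fourier_null r \<longleftrightarrow> integrable circle r \<and> (\<forall>n::int. (\<integral>z. r z * z powi n \<partial>circle) = 0)"

lemma integrable_mult_powi:
  assumes "integrable circle r" shows "integrable circle (\<lambda>z. r z * z powi n)"
proof (rule Bochner_Integration.integrable_bound[OF assms])
  show "AE z in circle. norm (r z * z powi n) \<le> norm (r z)"
    using AE_circle_norm by eventually_elim (simp add: norm_mult norm_power_int)
qed (use assms in measurable)

lemma fourier_null_add: "fourier_null r \<Longrightarrow> fourier_null s \<Longrightarrow> fourier_null (\<lambda>z. r z + s z)"
  by (auto simp: fourier_null_def distrib_right Bochner_Integration.integral_add integrable_mult_powi)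

lemma fourier_null_scale: "fourier_null r \<Longrightarrow> fourier_null (\<lambda>z. c * r z)"
  by (auto simp: fourier_null_def mult.assoc)

lemma fourier_null_cong:
  assumes "fourier_null r" "AE z in circle. r z = s z" "s \<in> borel_measurable circle"
  shows "fourier_null s"
proof -
  have [measurable]: "r \<in> borel_measurable circle" using assms(1) by (auto simp: fourier_null_def)
  have "integrable circle s \<longleftrightarrow> integrable circle r"
    using assms by (intro integrable_cong_AE) auto
  moreover have "(\<integral>z. s z * z powi n \<partial>circle) = (\<integral>z. r z * z powi n \<partial>circle)" for n
    using assms by (intro integral_cong_AE) auto
  ultimately show ?thesis using assms(1) by (simp add: fourier_null_def)
qed

lemma fourier_null_powi: 
  assumes "fourier_null r" shows "fourier_null (\<lambda>z. r z * z powi m)"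
proof -
  have [measurable]: "r \<in> borel_measurable circle" using assms(1) by (auto simp: fourier_null_def)
  have "(\<integral>z. r z * z powi m * z powi n \<partial>circle) = (\<integral>z. r z * z powi (m + n) \<partial>circle)" for n
  proof (rule integral_cong_AE)
    show "AE z in circle. r z * z powi m * z powi n = r z * z powi (m + n)"
      using AE_circle_norm by eventually_elim (simp add: powi_add_unit)
  qed auto
  with assms show ?thesis by (simp add: fourier_null_def integrable_mult_powi)
qed

text \<open>On the circle a real-linear form is a combination of z and 1/z, so multiplying by it
  only shifts and combines Fourier coefficients.\<close>

lemma fourier_null_polynomial:
  fixes p :: "complex \<Rightarrow> real"
  assumes "real_polynomial_function p" "fourier_null r"
  shows "fourier_null (\<lambda>z. r z * complex_of_real (p z))"
  using assms
proof (induction arbitrary: r rule: real_polynomial_function.induct)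
  case (linear f)
  then have [measurable]: "f \<in> borel_measurable borel" 
    by (intro borel_measurable_continuous_onI linear_continuous_on)
  have [measurable]: "r \<in> borel_measurable circle" using linear(2) by (auto simp: fourier_null_def)
  \<comment> \<open>The weights used next come from Re z = (z + 1/z) / 2 and Im z = (z - 1/z) / (2
    i) on the unit circle.\<close>
  define a b where "a = complex_of_real (f 1)" and "b = complex_of_real (f \<i>)"
  have n: "fourier_null (\<lambda>z. ((a - \<i> * b) / 2) * (r z * z powi 1) + ((a + \<i> * b) / 2) * (r z * z powi (-1)))"
    by (intro fourier_null_add fourier_null_scale fourier_null_powi linear)
  show ?case
  proof (rule fourier_null_cong[OF n])
    show "AE z in circle. ((a - \<i> * b) / 2) * (r z * z powi 1) + ((a + \<i> * b) / 2) * (r z * z powi (-1))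
        = r z * complex_of_real (f z)"
      using AE_circle_norm
    proof eventually_elim
      case (elim z)
      have "f z = f (Re z *\<^sub>R 1 + Im z *\<^sub>R \<i>)" by (rule arg_cong[where f = f]) (simp add: complex_eq_iff)
      also have "\<dots> = Re z * f 1 + Im z * f \<i>"
        using linear(1) by (simp add: linear_simps bounded_linear.linear linear_add linear_scale)
      finally have fz: "complex_of_real (f z) = Re z * a + Im z * b" by (simp add: a_def b_def)
      have "z powi (-1) = cnj z" using cnj_powi_unit[OF elim, of 1] by simp
      moreover have "((a - \<i> * b) / 2) * z + ((a + \<i> * b) / 2) * cnj z = Re z * a + Im z * b"
        by (simp add: complex_eq_iff field_simps)
      then have "r z * (((a - \<i> * b) / 2) * z + ((a + \<i> * b) / 2) * cnj z) = r z * (Re z * a + Im z * b)"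
        by simp
      ultimately show ?case unfolding fz by (simp only: power_int_1_right distrib_left mult_ac)
    qed
  qed measurable
next
  case (const c)
  then show ?case using fourier_null_scale[of r c] by (simp add: mult.commute)
next
  case (add f g)
  then show ?case using fourier_null_add[of "\<lambda>z. r z * complex_of_real (f z)" "\<lambda>z. r z * complex_of_real (g z)"]
    by (simp add: distrib_left)
next
  case (mult f g)
  from mult.IH(2)[OF mult.IH(1)[OF mult.prems]] show ?case by (simp add: mult.assoc)
qed

text \<open>Stone-Weierstrass on the unit circle: a uniform error \<open>e\<close> in the multiplier
  changes the integral by at most \<open>e\<close> times the mean of
  \<open>cmod (r z)\<close>.\<close>

lemma fourier_null_continuous:
  fixes g :: "complex \<Rightarrow> real"
  assumes r: "fourier_null r" and g: "continuous_on UNIV g"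
  shows "(\<integral>z. r z * complex_of_real (g z) \<partial>circle) = 0"
proof -
  have ri: "integrable circle r" and [measurable]: "r \<in> borel_measurable circle"
    using r by (auto simp: fourier_null_def)
  have [measurable]: "g \<in> borel_measurable borel" using g by (rule borel_measurable_continuous_onI)
  define R where "R = (\<integral>z. cmod (r z) \<partial>circle)"
  have R: "R \<ge> 0" by (simp add: R_def)
  have "bounded (g ` sphere 0 1)"
    by (intro compact_imp_bounded compact_continuous_image continuous_on_subset[OF g]) auto
  then obtain B where B: "\<And>z. cmod z = 1 \<Longrightarrow> \<bar>g z\<bar> \<le> B" by (fastforce simp: bounded_iff)
  have gi: "integrable circle (\<lambda>z. r z * complex_of_real (g z))"
  proof (rule Bochner_Integration.integrable_bound)
    show "integrable circle (\<lambda>z. B * cmod (r z))" using ri by auto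
    show "AE z in circle. norm (r z * complex_of_real (g z)) \<le> norm (B * cmod (r z))"
      using AE_circle_norm
    proof eventually_elim
      case (elim z)
      have "\<bar>g z\<bar> * cmod (r z) \<le> \<bar>B\<bar> * cmod (r z)" using B[OF elim] by (intro mult_right_mono) auto
      then show ?case by (simp add: norm_mult abs_mult mult.commute)
    qed
  qed measurable
  have "cmod (\<integral>z. r z * complex_of_real (g z) \<partial>circle) \<le> e * R" if e: "e > 0" for e
  proof -
    obtain p where p: "real_polynomial_function p" "\<And>x. x \<in> sphere (0::complex) 1 \<Longrightarrow> \<bar>g x - p x\<bar> < e"
      using Stone_Weierstrass_real_polynomial_function[OF compact_sphere continuous_on_subset[OF g subset_UNIV] e]
      by metis
    have n: "fourier_null (\<lambda>z. r z * complex_of_real (p z))" using p(1) r by (rule fourier_null_polynomial)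
    have "(\<integral>z. r z * complex_of_real (p z) * z powi 0 \<partial>circle) = 0"
      using n unfolding fourier_null_def by blast
    then have 0: "(\<integral>z. r z * complex_of_real (p z) \<partial>circle) = 0" by simp
    have pi: "integrable circle (\<lambda>z. r z * complex_of_real (p z))" using n by (simp add: fourier_null_def)
    have di: "integrable circle (\<lambda>z. r z * complex_of_real (g z) - r z * complex_of_real (p z))"
      using gi pi by auto
    have "(\<integral>z. r z * complex_of_real (g z) \<partial>circle)
        = (\<integral>z. r z * complex_of_real (g z) - r z * complex_of_real (p z) \<partial>circle)"
      using gi pi 0 by simp
    also have "cmod \<dots> \<le> (\<integral>z. cmod (r z * complex_of_real (g z) - r z * complex_of_real (p z)) \<partial>circle)"
      by (rule integral_norm_bound)
    also have "\<dots> \<le> (\<integral>z. e * cmod (r z) \<partial>circle)"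
    proof (rule integral_mono_AE)
      show "AE z in circle. cmod (r z * complex_of_real (g z) - r z * complex_of_real (p z)) \<le> e * cmod (r z)"
        using AE_circle_norm
      proof eventually_elim
        case (elim z)
        have "cmod (r z * complex_of_real (g z) - r z * complex_of_real (p z)) = \<bar>g z - p z\<bar> * cmod (r z)"
          by (simp add: norm_mult mult.commute flip: right_diff_distrib of_real_diff)
        also have "\<dots> \<le> e * cmod (r z)" using p(2)[of z] elim by (intro mult_right_mono) auto
        finally show ?case .
      qed
    qed (use ri di in auto)
    also have "\<dots> = e * R" by (simp add: R_def)
    finally show ?thesis .
  qed
  note * = this
  have "cmod (\<integral>z. r z * complex_of_real (g z) \<partial>circle) \<le> 0"
  proof (rule field_le_epsilon)
    fix e :: real assume e: "e > 0"
    \<comment> \<open>Dividing by \<open>R + 1\<close> covers the case \<open>R = 0\<close> as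
      well.\<close>
    have "cmod (\<integral>z. r z * complex_of_real (g z) \<partial>circle) \<le> (e / (R + 1)) * R"
      using e R by (intro *) simp
    also have "\<dots> \<le> e" using e R by (simp add: field_simps)
    finally show "cmod (\<integral>z. r z * complex_of_real (g z) \<partial>circle) \<le> 0 + e" by simp
  qed
  then show ?thesis by simp
qed

lemma fourier_null_closed:
  assumes r: "fourier_null r" and F: "closed F"
  shows "(LINT z:F|circle. r z) = 0"
proof (cases "F = {}")
  case False
  have ri: "integrable circle r" and [measurable]: "r \<in> borel_measurable circle"
    using r by (auto simp: fourier_null_def)
  have [measurable]: "F \<in> sets borel" using F by auto
  \<comment> \<open>Continuous functions decreasing to the indicator of the closed set
    \<open>F\<close>. The empty set was split off because \<open>infdist\<close> to it is 0 by
    convention, which would make every \<open>g n\<close> constantly 1.\<close>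
  define g where "g n z = max 0 (1 - real n * infdist z F)" for n z
  have gc: "continuous_on UNIV (g n)" for n
    unfolding g_def by (intro continuous_intros)
  have [measurable]: "g n \<in> borel_measurable borel" for n using gc by (rule borel_measurable_continuous_onI)
  have "(\<lambda>n. \<integral>z. r z * complex_of_real (g n z) \<partial>circle) \<longlonglongrightarrow> (\<integral>z. indicator F z *\<^sub>R r z \<partial>circle)"
  proof (rule integral_dominated_convergence[where w = "\<lambda>z. cmod (r z)"])
    show "AE z in circle. (\<lambda>n. r z * complex_of_real (g n z)) \<longlonglongrightarrow> indicator F z *\<^sub>R r z"
    proof (rule AE_I2)
      fix z
      have "(\<lambda>n. g n z) \<longlonglongrightarrow> indicator F z"
      proof (cases "z \<in> F")
        case True
        then show ?thesis by (simp add: g_def)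
      next
        case f: False
        then have pos: "infdist z F > 0" using F False by (simp add: infdist_pos_not_in_closed)
        obtain N where N: "1 / infdist z F < real N" using reals_Archimedean2 by blast
        have "\<forall>\<^sub>F n in sequentially. g n z = 0"
          using eventually_ge_at_top[of N]
        proof eventually_elim
          case (elim n)
          have "1 < real N * infdist z F" using N pos by (simp add: field_simps)
          also have "\<dots> \<le> real n * infdist z F" using elim pos by (intro mult_right_mono) auto
          finally show ?case by (simp add: g_def)
        qed
        with f show ?thesis by (simp add: tendsto_eventually)
      qed
      then have "(\<lambda>n. r z * complex_of_real (g n z)) \<longlonglongrightarrow> r z * complex_of_real (indicator F z)"
        by (intro tendsto_intros)
      then show "(\<lambda>n. r z * complex_of_real (g n z)) \<longlonglongrightarrow> indicator F z *\<^sub>R r z"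
        by (simp add: scaleR_conv_of_real mult.commute)
    qed
    show "AE z in circle. norm (r z * complex_of_real (g n z)) \<le> cmod (r z)" for n
      by (rule AE_I2) (auto simp: norm_mult g_def infdist_nonneg intro!: mult_left_le)
  qed (use ri in auto)
  moreover have "(\<integral>z. r z * complex_of_real (g n z) \<partial>circle) = 0" for n
    using r gc by (rule fourier_null_continuous)
  ultimately show ?thesis by (simp add: set_lebesgue_integral_def LIMSEQ_const_iff)
qed (simp add: set_lebesgue_integral_def)

text \<open>Dynkin's argument: closed sets are stable under intersection and generate the Borel
  sets, while the sets over which \<open>r\<close> integrates to 0 are closed under complements and
  disjoint countable unions.\<close>

lemma fourier_null_borel:
  assumes r: "fourier_null r" and A: "A \<in> sets borel"
  shows "(LINT z:A|circle. r z) = 0"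
proof -
  have ri: "integrable circle r" using r by (auto simp: fourier_null_def)
  have si: "set_integrable circle B r" if "B \<in> sets borel" for B
    using ri that by (auto simp: set_integrable_def intro: integrable_mult_indicator)
  have UNIV: "(LINT z:UNIV|circle. r z) = 0" using r by (rule fourier_null_closed) simp
  have "Int_stable (Collect closed :: complex set set)" by (auto simp: Int_stable_def)
  moreover have "Collect closed \<subseteq> Pow (UNIV :: complex set)" by simp
  moreover have "A \<in> sigma_sets UNIV (Collect closed)" using A by (simp add: borel_eq_closed)
  ultimately show ?thesis
  proof (induction rule: sigma_sets_induct_disjoint)
    case (basic A) then show ?case using fourier_null_closed[OF r] by simp
  next
    case empty then show ?case by (simp add: set_lebesgue_integral_def)
  next
    case (compl A)
    then have "A \<in> sets borel" by (simp add: borel_eq_closed)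
    then have "(LINT z:A \<union> (UNIV - A)|circle. r z) = (LINT z:A|circle. r z) + (LINT z:UNIV - A|circle. r z)"
      by (intro set_integral_Un si) auto
    with compl UNIV show ?case by simp
  next
    case (union A)
    then have "range A \<subseteq> sets borel" by (auto simp: borel_eq_closed)
    then have "(LINT z:(\<Union>i. A i)|circle. r z) = (\<Sum>i. (LINT z:(A i)|circle. r z))"
      using union by (intro lebesgue_integral_countable_add si) (auto simp: disjoint_family_on_def)
    with union show ?case by simp
  qed
qed

text \<open>Integrating over the set where \<open>Re (c * r z)\<close> is positive gives 0, so that
  set is null. The four choices 1, -1, i, -i of \<open>c\<close> then force
  \<open>r z = 0\<close>.\<close>

lemma fourier_null_AE:
  assumes r: "fourier_null r"
  shows "AE z in circle. r z = 0"
proof -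
  have ri: "integrable circle r" and rm [measurable]: "r \<in> borel_measurable circle"
    using r by (auto simp: fourier_null_def)
  have Re: "AE z in circle. Re (c * r z) \<le> 0" for c
  proof -
    define A where "A = {z. Re (c * r z) > 0}"
    have [measurable]: "r \<in> borel_measurable borel" using rm by (simp cong: measurable_cong_sets)
    have A [measurable]: "A \<in> sets borel" unfolding A_def by measurable
    have i: "integrable circle (\<lambda>z. indicator A z *\<^sub>R r z)"
      using ri A by (intro integrable_mult_indicator) auto
    have gen: "(\<integral>z. Re (c * v z) \<partial>circle) = Re (c * (\<integral>z. v z \<partial>circle))"
      if "integrable circle v" for v :: "complex \<Rightarrow> complex"
      using that by (subst integral_Re) auto
    have "(\<integral>z. Re (c * (indicator A z *\<^sub>R r z)) \<partial>circle) = Re (c * (LINT z:A|circle. r z))"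
      unfolding set_lebesgue_integral_def by (rule gen[OF i])
    also have "\<dots> = 0" using fourier_null_borel[OF r A] by simp
    finally have 0: "(\<integral>z. Re (c * (indicator A z *\<^sub>R r z)) \<partial>circle) = 0" .
    have "integrable circle (\<lambda>z. Re (c * (indicator A z *\<^sub>R r z)))"
      using i by (intro integrable_Re integrable_mult_right)
    moreover have "AE z in circle. 0 \<le> Re (c * (indicator A z *\<^sub>R r z))"
      by (rule AE_I2) (auto simp: A_def indicator_def)
    ultimately have "AE z in circle. Re (c * (indicator A z *\<^sub>R r z)) = 0"
      using integral_nonneg_eq_0_iff_AE 0 by blast
    then show ?thesis by eventually_elim (auto simp: A_def indicator_def split: if_splits)
  qed
  from Re[of 1] Re[of "-1"] Re[of "\<i>"] Re[of "-\<i>"] show ?thesis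
    by eventually_elim (simp add: complex_eq_iff)
qed

lemma fourier_coeff_unique:
  assumes "\<And>n. fourier_coeff f n = 0" shows "f = 0"
proof -
  have "fourier_null (rep_l2T f)"
    unfolding fourier_null_def
  proof safe
    show "integrable circle (rep_l2T f)"
      using represents_integrable_mult[OF represents_rep represents_const[of 1], of f] by simp
    show "(\<integral>z. rep_l2T f z * z powi n \<partial>circle) = 0" for n
      using assms[of "-n"] by (simp add: fourier_coeff_eq[OF represents_rep])
  qed
  then show ?thesis
    by (intro represents_eqI[OF represents_rep represents_zero] fourier_null_AE)
qed

section \<open>The Hardy space\<close>

lemma cinner_const_right: "cinner f (const_l2T c) = cnj c * fourier_coeff f 0"
proof -
  have "const_l2T c = c *\<^sub>C zpow 0" by (simp add: zpow_0 scaleC_const)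
  then show ?thesis by (simp add: cinner_scaleC_right fourier_coeff_cinner)
qed

lemma fourier_coeff_add: "fourier_coeff (f + g) n = fourier_coeff f n + fourier_coeff g n"
  by (simp add: fourier_coeff_cinner cinner_simps)

lemma fourier_coeff_diff: "fourier_coeff (f - g) n = fourier_coeff f n - fourier_coeff g n"
  by (simp add: fourier_coeff_cinner cinner_simps)

lemma fourier_coeff_scaleC: "fourier_coeff (c *\<^sub>C f) n = c * fourier_coeff f n"
  by (simp add: fourier_coeff_cinner cinner_simps)

lemma fourier_coeff_zero [simp]: "fourier_coeff 0 n = 0"
  by (simp add: fourier_coeff_cinner)

lemma fourier_coeff_const: "fourier_coeff (const_l2T c) n = (if n = 0 then c else 0)"
  using fourier_coeff_scaleC[of c "zpow 0" n] by (simp add: zpow_0 scaleC_const fourier_coeff_zpow[of 0 n, unfolded zpow_0])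

lemma fourier_coeff_id_mult: "fourier_coeff (id_l2T \<odot> f) n = fourier_coeff f (n - 1)"
  by (simp add: id_zpow fourier_coeff_mult_zpow)

lemma fourier_coeff_cnj_id_mult: "fourier_coeff (cnj_l2T id_l2T \<odot> f) n = fourier_coeff f (n + 1)"
  by (simp add: id_zpow cnj_zpow fourier_coeff_mult_zpow)

lemma disc_value_0: "disc_value f 0 = fourier_coeff f 0"
proof -
  have "(\<lambda>n. fourier_coeff f (int n) * 0 ^ n) sums (\<Sum>n\<in>{0}. fourier_coeff f (int n) * 0 ^ n)"
    by (rule sums_finite) auto
  then show ?thesis by (simp add: disc_value_def sums_iff)
qed

lemma closed_cinner_zero: "closed {f. cinner f g = 0}"
proof -
  have "continuous_on UNIV (\<lambda>f. cinner f g)"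
    by (rule linear_continuous_on[OF bounded_linear_cinner_left])
  then have "closed ((\<lambda>f. cinner f g) -` {0})"
    by (intro closed_vimage) auto
  then show ?thesis by (simp add: vimage_def)
qed

lemma csubspace_cinner_zero: "csubspace_l2T {f. cinner f g = 0}"
  by (auto simp: csubspace_l2T_def cinner_simps)

lemma csubspace_hardy: "csubspace_l2T hardy"
  by (auto simp: csubspace_l2T_def hardy_def fourier_coeff_add fourier_coeff_scaleC)

lemma closed_hardy: "closed hardy"
proof -
  have "hardy = (\<Inter>n\<in>{..<0}. {f. cinner f (zpow n) = 0})"
    by (auto simp: hardy_def fourier_coeff_cinner)
  moreover have "closed \<dots>" by (intro closed_INT ballI closed_cinner_zero)
  ultimately show ?thesis by simp
qed

lemmas hardy_intros = csubspace_l2T_zero[OF csubspace_hardy] csubspace_l2T_add[OF csubspace_hardy]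
  csubspace_l2T_diff[OF csubspace_hardy] csubspace_l2T_scaleC[OF csubspace_hardy]

lemma zpow_hardy: "n \<ge> 0 \<Longrightarrow> zpow n \<in> hardy"
  by (auto simp: hardy_def fourier_coeff_zpow)

lemma const_hardy: "const_l2T c \<in> hardy"
  by (auto simp: hardy_def fourier_coeff_const)

lemma id_mult_hardy: "f \<in> hardy \<Longrightarrow> id_l2T \<odot> f \<in> hardy"
  by (auto simp: hardy_def fourier_coeff_id_mult)

text \<open>Elements of \<open>hardy\<close> orthogonal to all nonnegative powers of z have only
  zero coefficients. This acts as an induction principle: a closed linear property has to be checked
  on these powers alone.\<close>

lemma hardy_subset:
  assumes M: "csubspace_l2T M" "closed M" and z: "\<And>n. n \<ge> 0 \<Longrightarrow> zpow n \<in> M"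
  shows "hardy \<subseteq> M"
proof -
  have "hardy \<subseteq> closure (M \<inter> hardy)"
  proof (rule closure_if_no_orth[OF csubspace_hardy _ _ closed_hardy])
    show "csubspace_l2T (M \<inter> hardy)" using M(1) csubspace_hardy by (auto simp: csubspace_l2T_def)
    fix f assume f: "f \<in> hardy" "\<And>g. g \<in> M \<inter> hardy \<Longrightarrow> cinner f g = 0"
    show "f = 0"
    proof (rule fourier_coeff_unique)
      fix n show "fourier_coeff f n = 0"
      proof (cases "n \<ge> 0")
        case True then show ?thesis using f(2) z zpow_hardy by (simp add: fourier_coeff_cinner)
      next
        case False then show ?thesis using f(1) by (auto simp: hardy_def)
      qed
    qed
  qed auto
  also have "\<dots> = M \<inter> hardy" using M(2) closed_hardy by (simp add: closed_Int)
  finally show ?thesis by auto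
qed

lemma hardy_orth:
  assumes "f \<in> hardy" "\<And>n. n \<ge> 0 \<Longrightarrow> fourier_coeff g n = 0"
  shows "cinner f g = 0"
proof -
  have "cinner (zpow n) g = 0" if "n \<ge> 0" for n
    using assms(2)[OF that] cinner_commute[of "zpow n" g] by (simp add: fourier_coeff_cinner)
  then have "hardy \<subseteq> {f. cinner f g = 0}"
    by (intro hardy_subset csubspace_cinner_zero closed_cinner_zero) auto
  with assms(1) show ?thesis by auto
qed

section \<open>The symmetries \<open>hat_op\<close> and \<open>J_op\<close> on Fourier
  coefficients\<close>

lemma hat_zpow [simp]: "hat_op (zpow n) = zpow n"
  by (rule represents_eqI[OF represents_hat[OF represents_zpow] represents_zpow]) simp

lemma fourier_coeff_hat: "fourier_coeff (hat_op f) n = cnj (fourier_coeff f n)"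
proof -
  have "cinner (hat_op f) (zpow n) = cinner (zpow n) f" using cinner_hat[of f "zpow n"] by simp
  then show ?thesis using cinner_commute[of "zpow n" f] by (simp add: fourier_coeff_cinner)
qed

lemma hat_hardy: "f \<in> hardy \<Longrightarrow> hat_op f \<in> hardy"
  by (simp add: hardy_def fourier_coeff_hat)

lemma fourier_coeff_J: "fourier_coeff (J_op f) n = fourier_coeff f (- n - 1)"
proof -
  have "fourier_coeff (J_op f) n = cinner (cnj_l2T (hat_op f)) (cnj_l2T (hat_op (zpow (- n - 1))))"
    by (simp add: J_op_eq fourier_coeff_cnj_id_mult cnj_zpow add.commute)
       (simp add: fourier_coeff_cinner)
  also have "\<dots> = fourier_coeff f (- n - 1)"
    by (simp only: cinner_cnj cinner_hat fourier_coeff_cinner)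
  finally show ?thesis .
qed

lemma J_op_add: "J_op (f + g) = J_op f + J_op g"
  by (simp add: J_op_eq hat_op_add cnj_l2T_add mult_l2T_add_right ess_bounded_intros)

text \<open>\<open>J_op\<close> reverses the coefficients by n \<mapsto> -n - 1, so it exchanges the
  Hardy space with its orthogonal complement. This allows the projection inside a truncated Hankel
  operator to be moved outside.\<close>

lemma orth_proj_J: "orth_proj hardy (J_op \<psi>) = J_op (\<psi> - orth_proj hardy \<psi>)"
proof (rule orth_proj_unique[OF csubspace_hardy])
  let ?p = "orth_proj hardy \<psi>"
  have p: "?p \<in> hardy" by (rule orth_proj_in[OF csubspace_hardy closed_hardy])
  have "fourier_coeff (\<psi> - ?p) n = 0" if "n \<ge> 0" for n
    using orth_proj_orth[OF csubspace_hardy closed_hardy zpow_hardy[OF that], of \<psi>]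
    by (simp add: fourier_coeff_cinner)
  then show "J_op (\<psi> - ?p) \<in> hardy" by (simp add: hardy_def fourier_coeff_J)
  fix h assume h: "h \<in> hardy"
  have "J_op \<psi> - J_op (\<psi> - ?p) = J_op ?p"
    using J_op_add[of "\<psi> - ?p" ?p] by simp
  moreover have "cinner h (J_op ?p) = 0"
    using h p by (intro hardy_orth) (auto simp: fourier_coeff_J hardy_def)
  ultimately show "cinner (J_op \<psi> - J_op (\<psi> - ?p)) h = 0"
    using cinner_commute[of h "J_op ?p"] by simp
qed

section \<open>The backward shift\<close>

text \<open>The map f \<mapsto> (f - f(0)) / z. On the Hardy space it is adjoint to multiplication
  by z, and it leaves every model space invariant, where it becomes the adjoint of
  \<open>shift_op\<close>.\<close>

definition backshift :: "l2T \<Rightarrow> l2T" where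
  "backshift f = cnj_l2T id_l2T \<odot> (f - const_l2T (fourier_coeff f 0))"

lemma unimodular_cnj_id: "unimodular (cnj_l2T id_l2T)"
  by (simp add: unimodular_cnj unimodular_id)

lemmas ess_bounded_cnj_id = unimodular_ess_bounded[OF unimodular_cnj_id]

lemma fourier_coeff_backshift:
  "fourier_coeff (backshift f) n = (if n = - 1 then 0 else fourier_coeff f (n + 1))"
  by (auto simp: backshift_def fourier_coeff_cnj_id_mult fourier_coeff_diff fourier_coeff_const)

lemma backshift_hardy: "f \<in> hardy \<Longrightarrow> backshift f \<in> hardy"
  by (auto simp: hardy_def fourier_coeff_backshift)

lemma id_mult_backshift: "id_l2T \<odot> backshift f = f - const_l2T (fourier_coeff f 0)"
  by (simp add: backshift_def unimodular_cancel unimodular_id)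

lemma backshift_add: "backshift (f + g) = backshift f + backshift g"
proof -
  have "const_l2T (a + b) = const_l2T a + const_l2T b" for a b
    using scaleC_add_left[of a b "const_l2T 1"] by (simp add: scaleC_const)
  then have "f + g - const_l2T (fourier_coeff (f + g) 0)
      = (f - const_l2T (fourier_coeff f 0)) + (g - const_l2T (fourier_coeff g 0))"
    by (simp add: fourier_coeff_add)
  then show ?thesis by (simp only: backshift_def mult_l2T_add_right[OF ess_bounded_cnj_id])
qed

lemma backshift_scaleC: "backshift (c *\<^sub>C f) = c *\<^sub>C backshift f"
  by (simp add: backshift_def fourier_coeff_scaleC ess_bounded_cnj_id scaleC_diff_right scaleC_const
      flip: mult_l2T_scaleC_right)

lemma ess_bounded_backshift: "ess_bounded f \<Longrightarrow> ess_bounded (backshift f)"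
  unfolding backshift_def by (intro ess_bounded_intros)

lemma norm_backshift: "norm (backshift f) \<le> norm f"
proof -
  let ?c = "const_l2T (fourier_coeff f 0)"
  have "cinner (f - ?c) ?c = 0"
    by (simp add: cinner_const_right fourier_coeff_diff fourier_coeff_const)
  then have "(f - ?c) \<bullet> ?c = 0" by (simp add: inner_l2T_def)
  then have "(norm f)\<^sup>2 = (norm (f - ?c))\<^sup>2 + (norm ?c)\<^sup>2"
    using norm_add_Pythagorean[of "f - ?c" ?c] by (simp add: orthogonal_def)
  then have "(norm (f - ?c))\<^sup>2 \<le> (norm f)\<^sup>2" by simp
  then have "norm (f - ?c) \<le> norm f" by (rule power2_le_imp_le) simp
  then show ?thesis by (simp add: backshift_def norm_unimodular unimodular_cnj_id)
qed

lemma norm_backshift_pow: "norm ((backshift ^^ n) f) \<le> norm f"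
  by (induction n) (auto intro: order_trans[OF norm_backshift])

lemma backshift_pow_hardy: "f \<in> hardy \<Longrightarrow> (backshift ^^ n) f \<in> hardy"
  by (induction n) (auto intro: backshift_hardy)

lemma backshift_pow_add: "(backshift ^^ n) (f + g) = (backshift ^^ n) f + (backshift ^^ n) g"
  by (induction n) (auto simp: backshift_add)

lemma backshift_pow_scaleC: "(backshift ^^ n) (c *\<^sub>C f) = c *\<^sub>C (backshift ^^ n) f"
  by (induction n) (auto simp: backshift_scaleC)

lemma fourier_coeff_backshift_pow:
  "k \<ge> 0 \<Longrightarrow> fourier_coeff ((backshift ^^ n) f) k = fourier_coeff f (k + int n)"
  by (induction n arbitrary: k) (auto simp: fourier_coeff_backshift algebra_simps)

text \<open>The iterates eventually annihilate each nonnegative power of z, and since they are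
  contractions the set of \<open>f\<close> with this convergence is closed.\<close>

lemma backshift_pow_tendsto_zero:
  assumes "f \<in> hardy" shows "(\<lambda>n. (backshift ^^ n) f) \<longlonglongrightarrow> 0"
proof -
  let ?M = "{f. (\<lambda>n. (backshift ^^ n) f) \<longlonglongrightarrow> 0}"
  have "hardy \<subseteq> ?M"
  proof (rule hardy_subset)
    have "(backshift ^^ n) 0 = 0" for n using backshift_pow_scaleC[of n 0 0] by simp
    moreover have "c *\<^sub>C f \<in> ?M" if "f \<in> ?M" for c f
    proof -
      have "(\<lambda>n. c *\<^sub>C (backshift ^^ n) f) \<longlonglongrightarrow> c *\<^sub>C 0"
        using that by (intro bounded_linear.tendsto[OF bounded_linear_scaleC]) simp
      then show ?thesis by (simp add: backshift_pow_scaleC)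
    qed
    moreover have "f + g \<in> ?M" if "f \<in> ?M" "g \<in> ?M" for f g
    proof -
      have "(\<lambda>n. (backshift ^^ n) f + (backshift ^^ n) g) \<longlonglongrightarrow> 0 + 0"
        using that by (intro tendsto_add) simp_all
      then show ?thesis by (simp add: backshift_pow_add)
    qed
    ultimately show "csubspace_l2T ?M" unfolding csubspace_l2T_def by simp
    show "closed ?M"
    proof (rule closed_sequential_limits[THEN iffD2], intro allI impI)
      fix x l assume xl: "(\<forall>n. x n \<in> ?M) \<and> x \<longlonglongrightarrow> l"
      show "l \<in> ?M"
      proof (simp, rule LIMSEQ_I)
        fix e :: real assume e: "e > 0"
        obtain k where "norm (x k - l) < e / 2" using xl e LIMSEQ_D[of x l "e/2"] by auto
        then have k: "norm (l - x k) < e / 2" by (simp add: norm_minus_commute)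
        have "(\<lambda>n. (backshift ^^ n) (x k)) \<longlonglongrightarrow> 0" using xl by auto
        then obtain N where N: "\<And>n. n \<ge> N \<Longrightarrow> norm ((backshift ^^ n) (x k)) < e / 2"
          using LIMSEQ_D[of "\<lambda>n. (backshift ^^ n) (x k)" 0 "e/2"] e by auto
        show "\<exists>no. \<forall>n\<ge>no. norm ((backshift ^^ n) l - 0) < e"
        proof (intro exI[of _ N] allI impI)
          fix n assume n: "N \<le> n"
          have "(backshift ^^ n) l = (backshift ^^ n) (l - x k) + (backshift ^^ n) (x k)"
            by (simp flip: backshift_pow_add)
          then have "norm ((backshift ^^ n) l) \<le> norm ((backshift ^^ n) (l - x k)) + norm ((backshift ^^ n) (x k))"
            by (metis norm_triangle_ineq)
          with k N[OF n] norm_backshift_pow[of n "l - x k"] show "norm ((backshift ^^ n) l - 0) < e" by simp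
        qed
      qed
    qed
    fix n :: int assume "n \<ge> 0"
    have "(backshift ^^ m) (zpow n) = 0" if "m \<ge> nat (n + 1)" for m
    proof (rule fourier_coeff_unique)
      fix k show "fourier_coeff ((backshift ^^ m) (zpow n)) k = 0"
      proof (cases "k \<ge> 0")
        case True then show ?thesis using that by (simp add: fourier_coeff_backshift_pow fourier_coeff_zpow)
      next
        case False then show ?thesis
          using backshift_pow_hardy[OF zpow_hardy[OF \<open>n \<ge> 0\<close>], of m] by (simp add: hardy_def)
      qed
    qed
    then have "\<forall>\<^sub>F m in sequentially. (backshift ^^ m) (zpow n) = 0"
      by (auto simp: eventually_sequentially)
    then show "zpow n \<in> ?M" by (simp add: tendsto_eventually)
  qed
  with assms show ?thesis by auto
qed

lemma cinner_backshift:
  assumes "f \<in> hardy" shows "cinner (id_l2T \<odot> f) g = cinner f (backshift g)"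
proof -
  have "cinner (id_l2T \<odot> f) (const_l2T c) = 0" for c
    using assms by (simp add: cinner_const_right fourier_coeff_id_mult hardy_def)
  then have "cinner (id_l2T \<odot> f) g = cinner (id_l2T \<odot> f) (g - const_l2T (fourier_coeff g 0))"
    by (simp add: cinner_simps)
  also have "\<dots> = cinner f (backshift g)"
    by (simp add: backshift_def cinner_mult_left ess_bounded_id)
  finally show ?thesis .
qed

section \<open>Bounded multipliers and pairings on the Hardy space\<close>

lemma bounded_linear_mult_l2T:
  assumes "ess_bounded a" shows "bounded_linear (\<lambda>f. a \<odot> f)"
proof -
  obtain c where c: "AE z in circle. cmod (rep_l2T a z) \<le> c"
    using assms ess_bounded_iff[OF represents_rep] by auto
  have "norm (a \<odot> f) \<le> norm f * \<bar>c\<bar>" for f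
  proof -
    have [measurable]: "rep_l2T f \<in> borel_measurable circle"
      using represents_square_integrable[OF represents_rep, of f] by (simp add: square_integrable_def)
    have "ennreal ((norm (a \<odot> f))\<^sup>2) = (\<integral>\<^sup>+z. ennreal ((cmod (rep_l2T a z * rep_l2T f z))\<^sup>2) \<partial>circle)"
      by (intro norm_eq_represents represents_mult represents_rep disjI1 assms)
    also have "\<dots> \<le> (\<integral>\<^sup>+z. ennreal (\<bar>c\<bar>\<^sup>2) * ennreal ((cmod (rep_l2T f z))\<^sup>2) \<partial>circle)"
    proof (rule nn_integral_mono_AE)
      show "AE z in circle. ennreal ((cmod (rep_l2T a z * rep_l2T f z))\<^sup>2)
          \<le> ennreal (\<bar>c\<bar>\<^sup>2) * ennreal ((cmod (rep_l2T f z))\<^sup>2)"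
        using c
      proof eventually_elim
        case (elim z)
        have "(cmod (rep_l2T a z))\<^sup>2 \<le> \<bar>c\<bar>\<^sup>2" using elim by (intro power_mono) auto
        then have "(cmod (rep_l2T a z))\<^sup>2 * (cmod (rep_l2T f z))\<^sup>2 \<le> \<bar>c\<bar>\<^sup>2 * (cmod (rep_l2T f z))\<^sup>2"
          by (rule mult_right_mono) simp
        then have "ennreal ((cmod (rep_l2T a z))\<^sup>2 * (cmod (rep_l2T f z))\<^sup>2) \<le> ennreal (\<bar>c\<bar>\<^sup>2 * (cmod (rep_l2T f z))\<^sup>2)"
          by (rule ennreal_leI)
        then show ?case by (simp only: norm_mult power_mult_distrib ennreal_mult zero_le_power2)
      qed
    qed
    also have "\<dots> = ennreal (\<bar>c\<bar>\<^sup>2) * ennreal ((norm f)\<^sup>2)"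
      by (subst nn_integral_cmult) (simp_all add: norm_eq_represents[OF represents_rep])
    also have "\<dots> = ennreal ((norm f * \<bar>c\<bar>)\<^sup>2)"
      by (simp only: power_mult_distrib ennreal_mult zero_le_power2 mult.commute)
    finally have "(norm (a \<odot> f))\<^sup>2 \<le> (norm f * \<bar>c\<bar>)\<^sup>2"
      by (subst (asm) ennreal_le_iff) simp_all
    then show ?thesis by (rule power2_le_imp_le) simp
  qed
  then show ?thesis
    by (intro bounded_linear_intro[where K = "\<bar>c\<bar>"])
       (simp_all add: mult_l2T_add_right assms scaleR_scaleC mult_l2T_scaleC_right)
qed

text \<open>For \<open>h\<close> a nonnegative power of z the product only shifts the coefficients
  of \<open>a\<close>; continuity of multiplication by \<open>a\<close> extends this to all
  \<open>h\<close>.\<close>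

lemma bounded_mult_hardy:
  assumes a: "a \<in> hardy" "ess_bounded a" and h: "h \<in> hardy"
  shows "a \<odot> h \<in> hardy"
proof -
  have "hardy \<subseteq> {h. a \<odot> h \<in> hardy}"
  proof (rule hardy_subset)
    have "a \<odot> 0 = 0" using mult_l2T_scaleC_right[OF a(2), of 0 0] by simp
    then show "csubspace_l2T {h. a \<odot> h \<in> hardy}"
      by (simp add: csubspace_l2T_def mult_l2T_add_right a mult_l2T_scaleC_right hardy_intros)
    have "continuous_on UNIV (\<lambda>h. a \<odot> h)"
      by (rule linear_continuous_on[OF bounded_linear_mult_l2T[OF a(2)]])
    then have "closed ((\<lambda>h. a \<odot> h) -` hardy)"
      by (intro closed_vimage closed_hardy)
    then show "closed {h. a \<odot> h \<in> hardy}" by (simp add: vimage_def)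
    fix n :: int assume "n \<ge> 0"
    then show "zpow n \<in> {h. a \<odot> h \<in> hardy}"
      using a(1) by (auto simp: hardy_def mult_l2T_commute[of a] fourier_coeff_mult_zpow)
  qed
  with h show ?thesis by auto
qed

lemma fourier_coeff_cnj: "fourier_coeff (cnj_l2T f) n = cnj (fourier_coeff f (- n))"
  using cinner_cnj[of f "zpow (- n)"] cinner_commute[of f "zpow (- n)"]
  by (simp add: fourier_coeff_cinner cnj_zpow)

text \<open>The coefficients of \<open>f\<close> and of \<open>cnj_l2T g\<close> overlap at index 0
  only.\<close>

lemma cinner_hardy_cnj:
  assumes "f \<in> hardy" "g \<in> hardy"
  shows "cinner f (cnj_l2T g) = fourier_coeff f 0 * fourier_coeff g 0"
proof -
  have "cinner f (cnj_l2T g - const_l2T (cnj (fourier_coeff g 0))) = 0"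
    using assms by (intro hardy_orth) (auto simp: fourier_coeff_cnj fourier_coeff_diff fourier_coeff_const hardy_def)
  then show ?thesis by (simp add: cinner_simps cinner_const_right)
qed

lemma cinner_backshift_pow:
  "f \<in> hardy \<Longrightarrow> cinner (zpow (int n) \<odot> f) g = cinner f ((backshift ^^ n) g)"
proof (induction n arbitrary: f g)
  case 0 then show ?case by (simp add: zpow_0 mult_l2T_const)
next
  case (Suc n)
  have "zpow (int (Suc n)) \<odot> f = id_l2T \<odot> (zpow (int n) \<odot> f)"
    by (simp add: id_zpow mult_l2T_assoc ess_bounded_zpow mult_zpow add.commute)
  moreover have "zpow (int n) \<odot> f \<in> hardy"
    using Suc.prems by (auto simp: hardy_def fourier_coeff_mult_zpow)
  ultimately show ?case using Suc by (simp add: cinner_backshift funpow_swap1)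
qed

lemma bounded_bilinear_cinner: "bounded_bilinear cinner"
proof
  show "\<exists>K. \<forall>a b. norm (cinner a b) \<le> norm a * norm b * K"
    by (rule exI[of _ 1]) (simp add: cinner_cauchy_schwarz)
qed (simp_all add: cinner_simps scaleR_scaleC scaleR_conv_of_real)

lemmas tendsto_cinner = bounded_bilinear.tendsto[OF bounded_bilinear_cinner]

text \<open>The symbol \<open>\<psi>\<close> may be unbounded, so it cannot be moved across
  directly. The bounded functions \<open>a\<close> and \<open>b\<close> are moved instead, with a
  global conjugation in between.\<close>

lemma cinner_mult_bounded:
  assumes "ess_bounded a" "ess_bounded b"
  shows "cinner (\<psi> \<odot> a) b = cinner a (cnj_l2T \<psi> \<odot> b)"
proof -
  have "cinner (\<psi> \<odot> a) b = cinner \<psi> (cnj_l2T a \<odot> b)"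
    by (subst mult_l2T_commute) (rule cinner_mult_left[OF assms(1)])
  also have "cnj_l2T a \<odot> b = b \<odot> cnj_l2T a" by (rule mult_l2T_commute)
  also have "cinner \<psi> (b \<odot> cnj_l2T a) = cinner (cnj_l2T (b \<odot> cnj_l2T a)) (cnj_l2T \<psi>)"
    by (simp only: cinner_cnj)
  also have "cnj_l2T (b \<odot> cnj_l2T a) = cnj_l2T b \<odot> a" by (simp add: cnj_l2T_mult assms)
  also have "cinner (cnj_l2T b \<odot> a) (cnj_l2T \<psi>) = cinner a (cnj_l2T \<psi> \<odot> b)"
    by (subst mult_l2T_commute[of "cnj_l2T \<psi>"]) (simp add: cinner_mult_right assms)
  finally show ?thesis .
qed

section \<open>Model spaces\<close>

locale inner_fn =
  fixes u :: l2T
  assumes inner: "inner_function u" and nonconst: "\<nexists>c. u = const_l2T c"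
begin

abbreviation K :: "l2T set" where "K \<equiv> model_space u"
abbreviation S :: "l2T \<Rightarrow> l2T" where "S \<equiv> shift_op u"
abbreviation L :: "l2T \<Rightarrow> l2T" where "L \<equiv> backshift"
abbreviation C :: "l2T \<Rightarrow> l2T" where "C \<equiv> C_op u"
abbreviation k :: l2T where "k \<equiv> k0 u"
abbreviation k' :: l2T where "k' \<equiv> k0_conj u"
abbreviation P :: "l2T \<Rightarrow> l2T" where "P \<equiv> P_model u"
definition t :: complex where "t = cnj (fourier_coeff u 0)"

lemma unimodular_u: "unimodular u" and u_hardy: "u \<in> hardy"
  using inner by (auto simp: inner_function_def)

lemmas bounded_u = unimodular_ess_bounded[OF unimodular_u]

lemma u_mult_hardy: "h \<in> hardy \<Longrightarrow> u \<odot> h \<in> hardy"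
  by (rule bounded_mult_hardy[OF u_hardy bounded_u])

lemma csubspace_K: "csubspace_l2T K"
  by (simp add: csubspace_l2T_def model_space_def cinner_simps hardy_intros)

lemma closed_K: "closed K"
proof -
  have "K = hardy \<inter> (\<Inter>h\<in>hardy. {f. cinner f (u \<odot> h) = 0})"
    by (auto simp: model_space_def)
  moreover have "closed \<dots>" by (intro closed_Int closed_hardy closed_INT ballI closed_cinner_zero)
  ultimately show ?thesis by simp
qed

lemmas K_zero = csubspace_l2T_zero[OF csubspace_K]
lemmas K_add = csubspace_l2T_add[OF csubspace_K]
lemmas K_diff = csubspace_l2T_diff[OF csubspace_K]
lemmas K_scaleC = csubspace_l2T_scaleC[OF csubspace_K]
lemmas K_intros = K_zero K_add K_diff K_scaleC

lemma K_hardy: "f \<in> K \<Longrightarrow> f \<in> hardy" by (simp add: model_space_def)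

lemma K_orth: "f \<in> K \<Longrightarrow> h \<in> hardy \<Longrightarrow> cinner f (u \<odot> h) = 0" by (simp add: model_space_def)

lemma u_eq: "u = u \<odot> const_l2T 1" by (simp add: mult_l2T_const_right)

lemma K_orth_u: "f \<in> K \<Longrightarrow> cinner f u = 0"
  using K_orth[OF _ const_hardy, of f 1] u_eq by simp

lemma cinner_u_u: "cinner u u = 1"
  using cinner_unimodular[OF unimodular_u, of "const_l2T 1" "const_l2T 1"] u_eq
  by (simp add: cinner_const_right fourier_coeff_const)

lemma P_K: "P f \<in> K" by (rule orth_proj_in[OF csubspace_K closed_K])

lemma cinner_P: "h \<in> K \<Longrightarrow> cinner (P f) h = cinner f h"
  by (rule cinner_orth_proj[OF csubspace_K closed_K])

lemma P_eqI: "g \<in> K \<Longrightarrow> (\<And>h. h \<in> K \<Longrightarrow> cinner f h = cinner g h) \<Longrightarrow> P f = g"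
  by (rule orth_proj_unique[OF csubspace_K]) (simp_all add: cinner_simps)

lemma K_eqI: "f \<in> K \<Longrightarrow> g \<in> K \<Longrightarrow> (\<And>h. h \<in> K \<Longrightarrow> cinner f h = cinner g h) \<Longrightarrow> f = g"
  using K_diff[of f g] cinner_eq_zero_iff[of "f - g"] by (metis cinner_diff_left eq_iff_diff_eq_0)

subsection \<open>The conjugation\<close>

lemma C_eq: "C f = (u \<odot> cnj_l2T id_l2T) \<odot> cnj_l2T f"
  by (simp add: C_op_def cnj_l2T_mult ess_bounded_id mult_l2T_assoc bounded_u ess_bounded_cnj_id)

lemma unimodular_w: "unimodular (u \<odot> cnj_l2T id_l2T)"
  by (intro unimodular_mult unimodular_u unimodular_cnj_id)

lemmas bounded_w = unimodular_ess_bounded[OF unimodular_w]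

lemma cinner_C: "cinner (C f) (C g) = cinner g f"
  by (simp add: C_eq cinner_unimodular unimodular_w cinner_cnj)

lemma C_C [simp]: "C (C f) = f"
  by (simp add: C_eq cnj_l2T_mult bounded_w unimodular_cancel unimodular_w)

lemma C_add: "C (f + g) = C f + C g"
  by (simp add: C_eq cnj_l2T_add mult_l2T_add_right bounded_w)

lemma C_scaleC: "C (c *\<^sub>C f) = cnj c *\<^sub>C C f"
  by (simp add: C_eq cnj_l2T_scaleC mult_l2T_scaleC_right bounded_w)

lemma C_diff: "C (f - g) = C f - C g"
  using C_add[of "f - g" g] by (simp add: algebra_simps)

lemma C_zero [simp]: "C 0 = 0" using C_add[of 0 0] by simp

lemma norm_C: "norm (C f) = norm f"
  by (rule norm_l2T_cinner) (rule cinner_C)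

lemma bounded_linear_C: "bounded_linear C"
  by (rule bounded_linear_intro[where K = 1]) (simp_all add: C_add scaleR_scaleC C_scaleC norm_C)

lemma ess_bounded_C: "ess_bounded f \<Longrightarrow> ess_bounded (C f)"
  unfolding C_eq by (intro ess_bounded_mult bounded_w ess_bounded_cnj)

lemma cinner_C_left: "cinner (C f) g = cinner (C g) f"
  using cinner_C[of f "C g"] by simp

text \<open>\<open>C\<close> exchanges the two parts of the orthogonal complement of
  \<open>K\<close>: it sends negative powers of z into u times the Hardy space, and
  \<open>u \<odot> h\<close> to the conjugate of z h, which is orthogonal to the Hardy
  space.\<close>

lemma C_K: assumes "f \<in> K" shows "C f \<in> K"
proof -
  have "fourier_coeff (C f) n = 0" if n: "n < 0" for n
  proof -
    have "fourier_coeff (C f) n = cinner (C (zpow n)) f"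
      unfolding fourier_coeff_cinner by (rule cinner_C_left)
    also have "C (zpow n) = u \<odot> zpow (- 1 - n)"
      by (simp add: C_op_def id_zpow mult_zpow cnj_zpow)
    also have "cinner \<dots> f = 0"
      using K_orth[OF assms zpow_hardy[of "- 1 - n"]] n cinner_commute[of "u \<odot> zpow (- 1 - n)" f] by simp
    finally show ?thesis .
  qed
  then have h: "C f \<in> hardy" by (simp add: hardy_def)
  have "cinner (C f) (u \<odot> h) = 0" if h: "h \<in> hardy" for h
  proof -
    have "C (u \<odot> h) = cnj_l2T (id_l2T \<odot> h)"
      unfolding C_op_def mult_l2T_left_commute[OF ess_bounded_id bounded_u] cnj_l2T_mult[OF bounded_u]
      by (rule unimodular_cancel[OF unimodular_u])
    then have "cinner (C f) (u \<odot> h) = cinner (cnj_l2T (id_l2T \<odot> h)) f"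
      using cinner_C_left[of f "u \<odot> h"] by simp
    also have "\<dots> = cnj (cinner f (cnj_l2T (id_l2T \<odot> h)))" by (rule cinner_commute)
    also have "cinner f (cnj_l2T (id_l2T \<odot> h)) = fourier_coeff f 0 * fourier_coeff (id_l2T \<odot> h) 0"
      by (rule cinner_hardy_cnj[OF K_hardy[OF assms] id_mult_hardy[OF h]])
    also have "fourier_coeff (id_l2T \<odot> h) 0 = 0"
      using h by (simp add: fourier_coeff_id_mult hardy_def)
    finally show ?thesis by simp
  qed
  with h show ?thesis by (simp add: model_space_def)
qed

subsection \<open>The kernels at the origin\<close>

lemma k_eq: "k = const_l2T 1 - t *\<^sub>C u"
  by (simp add: k0_def disc_value_0 t_def)

lemma fourier_coeff_u_mult: 
  assumes "h \<in> hardy" shows "fourier_coeff (u \<odot> h) 0 = cnj t * fourier_coeff h 0"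
proof -
  have "u \<odot> h = u \<odot> (id_l2T \<odot> backshift h) + fourier_coeff h 0 *\<^sub>C u"
    by (simp add: id_mult_backshift mult_l2T_diff_right bounded_u mult_l2T_const_right)
  also have "u \<odot> (id_l2T \<odot> backshift h) = id_l2T \<odot> (u \<odot> backshift h)"
    by (rule mult_l2T_left_commute[OF bounded_u ess_bounded_id])
  finally show ?thesis
    using u_mult_hardy[OF backshift_hardy[OF assms]]
    by (simp add: fourier_coeff_add fourier_coeff_id_mult hardy_def fourier_coeff_scaleC t_def)
qed

lemma k_K: "k \<in> K"
proof -
  have "cinner k (u \<odot> h) = 0" if h: "h \<in> hardy" for h
  proof -
    have "cinner (const_l2T 1) (u \<odot> h) = cnj (fourier_coeff (u \<odot> h) 0)"
      using cinner_commute[of "const_l2T 1" "u \<odot> h"] by (simp add: cinner_const_right)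
    moreover have "cinner u (u \<odot> h) = cnj (fourier_coeff h 0)"
      using cinner_unimodular[OF unimodular_u, of "const_l2T 1" h] u_eq
        cinner_commute[of "const_l2T 1" h] by (simp add: cinner_const_right)
    ultimately show ?thesis using h by (simp add: k_eq cinner_simps fourier_coeff_u_mult)
  qed
  then show ?thesis by (auto simp: model_space_def k_eq intro!: hardy_intros const_hardy u_hardy)
qed

text \<open>So \<open>k\<close> is the reproducing kernel of \<open>K\<close> at the origin: the
  multiple of \<open>u\<close> in it is invisible to \<open>K\<close>.\<close>

lemma cinner_k: "f \<in> K \<Longrightarrow> cinner f k = fourier_coeff f 0"
  by (simp add: k_eq cinner_simps cinner_const_right K_orth_u)

lemma k'_eq_C: "k' = C k" by (simp add: k0_conj_def)

lemma C_k: "C k = k'" and C_k': "C k' = k" by (simp_all add: k'_eq_C)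

lemma k'_K: "k' \<in> K" unfolding k'_eq_C by (rule C_K[OF k_K])

lemma k'_eq: "k' = backshift u"
proof -
  have "C (const_l2T 1) = cnj_l2T id_l2T \<odot> u"
    by (simp add: C_op_def mult_l2T_const_right cnj_l2T_scaleC mult_l2T_commute)
  moreover have "C u = cnj_l2T id_l2T"
    by (simp add: C_op_def mult_l2T_commute[of id_l2T u] cnj_l2T_mult bounded_u unimodular_cancel unimodular_u)
  ultimately show ?thesis
    by (simp add: k'_eq_C k_eq C_diff C_scaleC backshift_def mult_l2T_diff_right ess_bounded_cnj_id
        mult_l2T_const_right t_def)
qed

lemma cinner_k': "f \<in> K \<Longrightarrow> cinner f k' = cinner (id_l2T \<odot> f) u"
  by (simp add: k'_eq cinner_backshift K_hardy)

lemma cinner_k_k: "cinner k k = 1 - t * cnj t"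
  by (simp add: cinner_k k_K) (simp add: k_eq fourier_coeff_diff fourier_coeff_scaleC fourier_coeff_const t_def)

lemma k_nonzero: "k \<noteq> 0"
proof
  assume "k = 0"
  then have 1: "const_l2T 1 = t *\<^sub>C u" by (simp add: k_eq)
  have "t \<noteq> 0"
  proof
    assume "t = 0"
    then have "fourier_coeff (const_l2T 1) 0 = 0" using 1 by simp
    then show False by (simp add: fourier_coeff_const)
  qed
  then have "u = const_l2T (1 / t)"
    using arg_cong[OF 1, of "\<lambda>f. (1 / t) *\<^sub>C f"] by (simp add: scaleC_scaleC scaleC_const)
  with nonconst show False by blast
qed

text \<open>Positivity of \<open>norm k\<close> takes the place of the maximum principle for
  u(0).\<close>

lemma t_less: "cmod t < 1"
proof -
  have "(norm k)\<^sup>2 > 0" using k_nonzero by simp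
  moreover have "complex_of_real ((norm k)\<^sup>2) = complex_of_real (1 - (cmod t)\<^sup>2)"
    using cinner_k_k cinner_self[of k] complex_norm_square[of t] by simp
  then have "(norm k)\<^sup>2 = 1 - (cmod t)\<^sup>2" by (simp only: of_real_eq_iff)
  ultimately have "(cmod t)\<^sup>2 < 1\<^sup>2" by simp
  then show ?thesis by (rule power2_less_imp_less) simp
qed

subsection \<open>The compressed shift and its adjoint\<close>

lemma L_K: assumes "f \<in> K" shows "L f \<in> K"
proof -
  have "cinner (L f) (u \<odot> h) = 0" if h: "h \<in> hardy" for h
  proof -
    have "cinner (L f) (u \<odot> h) = cnj (cinner (id_l2T \<odot> (u \<odot> h)) f)"
      using cinner_backshift[OF u_mult_hardy[OF h], of f] cinner_commute[of "L f" "u \<odot> h"] by simp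
    also have "id_l2T \<odot> (u \<odot> h) = u \<odot> (id_l2T \<odot> h)"
      by (rule mult_l2T_left_commute[OF ess_bounded_id bounded_u])
    also have "cnj (cinner \<dots> f) = 0"
      using K_orth[OF assms id_mult_hardy[OF h]] cinner_commute[of f "u \<odot> (id_l2T \<odot> h)"] by simp
    finally show ?thesis .
  qed
  then show ?thesis using backshift_hardy[OF K_hardy[OF assms]] by (simp add: model_space_def)
qed

lemma L_diff: "L (f - g) = L f - L g"
  using backshift_add[of "f - g" g] by (simp add: algebra_simps)

lemma S_K: "S f \<in> K" by (simp add: shift_op_def P_K)

lemma cinner_S: "f \<in> K \<Longrightarrow> g \<in> K \<Longrightarrow> cinner (S f) g = cinner f (L g)"
  by (simp add: shift_op_def cinner_P cinner_backshift K_hardy)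

lemma cinner_L: "f \<in> K \<Longrightarrow> g \<in> K \<Longrightarrow> cinner (L f) g = cinner f (S g)"
  using cinner_S[of g f] cinner_commute by metis

text \<open>z f is orthogonal to z u h for every \<open>h\<close> in the Hardy space, so its
  component in u times that space is a multiple of \<open>u\<close>, with coefficient
  \<open>cinner (id_l2T \<odot> f) u = cinner f k'\<close>.\<close>

lemma S_eq: assumes "f \<in> K" shows "S f = id_l2T \<odot> f - cinner f k' *\<^sub>C u"
  unfolding shift_op_def
proof (rule P_eqI)
  let ?c = "cinner f k'"
  have c: "cinner (id_l2T \<odot> f) u = ?c" using assms by (simp add: cinner_k')
  have "cinner (id_l2T \<odot> f - ?c *\<^sub>C u) (u \<odot> h) = 0" if h: "h \<in> hardy" for h
  proof -
    have "h = id_l2T \<odot> backshift h + const_l2T (fourier_coeff h 0)"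
      by (simp add: id_mult_backshift)
    then have "u \<odot> h = u \<odot> (id_l2T \<odot> backshift h) + fourier_coeff h 0 *\<^sub>C u"
      using mult_l2T_add_right[OF bounded_u] mult_l2T_const_right by metis
    also have "u \<odot> (id_l2T \<odot> backshift h) = id_l2T \<odot> (u \<odot> backshift h)"
      by (rule mult_l2T_left_commute[OF bounded_u ess_bounded_id])
    finally have uh: "u \<odot> h = id_l2T \<odot> (u \<odot> backshift h) + fourier_coeff h 0 *\<^sub>C u" .
    have "cinner (id_l2T \<odot> f) (id_l2T \<odot> (u \<odot> backshift h)) = 0"
      by (simp add: cinner_unimodular unimodular_id K_orth assms backshift_hardy h)
    moreover have "cinner u (u \<odot> h) = cnj (fourier_coeff h 0)"
      using cinner_unimodular[OF unimodular_u, of "const_l2T 1" h] u_eq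
        cinner_commute[of "const_l2T 1" h] by (simp add: cinner_const_right)
    moreover have "cinner (id_l2T \<odot> f) (u \<odot> h) = cinner (id_l2T \<odot> f) (id_l2T \<odot> (u \<odot> backshift h))
        + cnj (fourier_coeff h 0) * ?c"
      unfolding uh by (simp add: cinner_simps c)
    ultimately show ?thesis by (simp add: cinner_simps)
  qed
  moreover have "id_l2T \<odot> f - ?c *\<^sub>C u \<in> hardy"
    by (intro hardy_intros id_mult_hardy K_hardy assms u_hardy)
  ultimately show "id_l2T \<odot> f - ?c *\<^sub>C u \<in> K" by (simp add: model_space_def)
  show "cinner (id_l2T \<odot> f) h = cinner (id_l2T \<odot> f - ?c *\<^sub>C u) h" if "h \<in> K" for h
    using K_orth_u[OF that] cinner_commute[of u h] by (simp add: cinner_simps)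
qed

lemma S_add: "f \<in> K \<Longrightarrow> g \<in> K \<Longrightarrow> S (f + g) = S f + S g"
  by (rule K_eqI) (simp_all add: S_K K_intros cinner_S cinner_simps)

lemma S_scaleC: "f \<in> K \<Longrightarrow> S (c *\<^sub>C f) = c *\<^sub>C S f"
  by (rule K_eqI) (simp_all add: S_K K_intros cinner_S cinner_simps)

lemma S_diff: "f \<in> K \<Longrightarrow> g \<in> K \<Longrightarrow> S (f - g) = S f - S g"
  by (rule K_eqI) (simp_all add: S_K K_intros cinner_S cinner_simps)

lemma norm_S: assumes "f \<in> K" shows "norm (S f) \<le> norm f"
proof -
  have "complex_of_real ((norm (S f))\<^sup>2) = cinner f (L (S f))"
    using assms by (simp only: cinner_self[symmetric] cinner_S S_K)
  then have "(norm (S f))\<^sup>2 = cmod (cinner f (L (S f)))"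
    by (metis norm_of_real abs_power2)
  also have "\<dots> \<le> norm f * norm (S f)"
    using cinner_cauchy_schwarz[of f "L (S f)"] norm_backshift[of "S f"]
    by (meson mult_left_mono norm_ge_zero order_trans)
  finally have "norm (S f) * norm (S f) \<le> norm f * norm (S f)" by (simp add: power2_eq_square)
  then show ?thesis
    by (cases "norm (S f) = 0") (simp_all add: mult_le_cancel_right)
qed

lemma ess_bounded_S: "f \<in> K \<Longrightarrow> ess_bounded f \<Longrightarrow> ess_bounded (S f)"
  by (simp add: S_eq ess_bounded_intros bounded_u)

lemma C_S: assumes "f \<in> K" shows "C (S f) = L (C f)"
proof -
  have "C u = cnj_l2T id_l2T"
    by (simp add: C_op_def mult_l2T_commute[of id_l2T u] cnj_l2T_mult bounded_u unimodular_cancel unimodular_u)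
  moreover have "C (id_l2T \<odot> f) = cnj_l2T id_l2T \<odot> C f"
    by (simp add: C_eq cnj_l2T_mult ess_bounded_id mult_l2T_left_commute bounded_w ess_bounded_cnj_id)
  moreover have "fourier_coeff (C f) 0 = cnj (cinner f k')"
    using cinner_k[OF C_K[OF assms]] cinner_C[of f k'] cinner_commute[of k' f] by (simp add: C_k')
  ultimately show ?thesis
    using assms by (simp add: S_eq C_diff C_scaleC backshift_def mult_l2T_diff_right ess_bounded_cnj_id
        mult_l2T_const_right)
qed

lemma C_L: assumes "f \<in> K" shows "C (L f) = S (C f)"
  using C_S[OF C_K[OF assms]] by (metis C_C)

text \<open>By \<open>S_eq\<close> the two sides differ by a multiple of \<open>u\<close>. The
  difference lies in \<open>K\<close>, which is orthogonal to \<open>u\<close>, so the multiple is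
  0.\<close>

lemma S_L: assumes "f \<in> K" shows "S (L f) = f - cinner f k *\<^sub>C k"
proof -
  have "\<exists>c. S (L f) - (f - cinner f k *\<^sub>C k) = c *\<^sub>C u"
  proof
    have "c *\<^sub>C k = const_l2T c - (c * t) *\<^sub>C u" for c
      by (simp add: k_eq scaleC_diff_right scaleC_const scaleC_scaleC)
    then show "S (L f) - (f - cinner f k *\<^sub>C k) = (- cinner (L f) k' - cinner f k * t) *\<^sub>C u"
      unfolding S_eq[OF L_K[OF assms]] id_mult_backshift cinner_k[OF assms, symmetric]
      by (simp add: scaleC_diff_left scaleC_minus_left)
  qed
  then obtain c where c: "S (L f) - (f - cinner f k *\<^sub>C k) = c *\<^sub>C u" by blast
  have "S (L f) - (f - cinner f k *\<^sub>C k) \<in> K" by (intro K_intros S_K assms k_K)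
  then have "c = 0" using K_orth_u c cinner_u_u by (metis cinner_scaleC_left mult.right_neutral)
  with c show ?thesis by simp
qed

lemma L_S: assumes "f \<in> K" shows "L (S f) = f - cinner f k' *\<^sub>C k'"
proof -
  have "L (S f) = C (C (L (C (C (S f)))))" by simp
  also have "\<dots> = C (S (L (C f)))" using assms by (simp add: C_S C_L L_K C_K)
  also have "\<dots> = f - cnj (cinner (C f) k) *\<^sub>C k'"
    using assms by (simp add: S_L C_K C_diff C_scaleC C_k)
  also have "cnj (cinner (C f) k) = cinner f k'"
    using cinner_C_left[of f k] cinner_commute[of f k'] by (simp add: C_k)
  finally show ?thesis .
qed

lemma L_k: "L k = - t *\<^sub>C k'"
proof -
  have "backshift (const_l2T 1) = 0"
    using mult_l2T_scaleC_right[OF ess_bounded_cnj_id, of 0 0] by (simp add: backshift_def fourier_coeff_const)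
  then show ?thesis by (simp add: k_eq L_diff backshift_scaleC k'_eq scaleC_minus_left)
qed

lemma S_k': "S k' = - cnj t *\<^sub>C k"
  using C_L[OF k_K] by (simp add: L_k C_scaleC C_k C_k' )

section \<open>Bounded functions in the model space\<close>

lemma L_pow_K: "f \<in> K \<Longrightarrow> (L ^^ n) f \<in> K"
  by (induction n) (auto intro: L_K)

lemma ess_bounded_L_pow: "ess_bounded f \<Longrightarrow> ess_bounded ((L ^^ n) f)"
  by (induction n) (auto intro: ess_bounded_backshift)

lemma ess_bounded_k: "ess_bounded k"
  unfolding k_eq by (intro ess_bounded_intros bounded_u)

text \<open>The bounded functions in \<open>K\<close> include all \<open>S\<^sup>n k\<close>, and \<open>\<langle>f, S\<^sup>n k\<rangle>\<close> is the \<open>n\<close>-th Fourier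
  coefficient of \<open>f\<close>.\<close>

lemma K_bounded_orth:
  assumes "f \<in> K" "\<And>g. g \<in> K \<Longrightarrow> ess_bounded g \<Longrightarrow> cinner f g = 0"
  shows "f = 0"
proof (rule fourier_coeff_unique)
  fix n
  have *: "fourier_coeff f (int m) = 0"
    if "f \<in> K" "\<And>g. g \<in> K \<Longrightarrow> ess_bounded g \<Longrightarrow> cinner f g = 0" for f m
    using that
  proof (induction m arbitrary: f)
    case 0
    then show ?case using cinner_k[of f] k_K ess_bounded_k by simp
  next
    case (Suc m)
    have "fourier_coeff (L f) (int m) = 0"
      by (rule Suc.IH) (use Suc.prems in \<open>simp_all add: L_K cinner_L S_K ess_bounded_S\<close>)
    then show ?case by (simp add: fourier_coeff_backshift add.commute)
  qed
  show "fourier_coeff f n = 0"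
  proof (cases "n \<ge> 0")
    case True then show ?thesis using *[OF assms, of "nat n"] by simp
  next
    case False then show ?thesis using K_hardy[OF assms(1)] by (simp add: hardy_def)
  qed
qed

lemma K_bounded_dense: "K \<subseteq> closure {f \<in> K. ess_bounded f}"
proof (rule closure_if_no_orth[OF csubspace_K _ _ closed_K])
  have "ess_bounded 0" using ess_bounded_const[of 0] by simp
  then show "csubspace_l2T {f \<in> K. ess_bounded f}"
    by (simp add: csubspace_l2T_def K_intros ess_bounded_intros)
qed (auto intro: K_bounded_orth)

lemma K_bounded_sequence:
  assumes "f \<in> K"
  obtains x where "\<And>n. x n \<in> K" "\<And>n. ess_bounded (x n)" "x \<longlonglongrightarrow> f"
  using assms K_bounded_dense closure_sequential[of f "{f \<in> K. ess_bounded f}"] by blast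

section \<open>Bounded operators on the model space\<close>

abbreviation bop :: "(l2T \<Rightarrow> l2T) \<Rightarrow> bool" where "bop \<equiv> bounded_operator_on K"

lemma bop_K: "bop A \<Longrightarrow> f \<in> K \<Longrightarrow> A f \<in> K"
  and bop_add: "bop A \<Longrightarrow> f \<in> K \<Longrightarrow> g \<in> K \<Longrightarrow> A (f + g) = A f + A g"
  and bop_scaleC: "bop A \<Longrightarrow> f \<in> K \<Longrightarrow> A (c *\<^sub>C f) = c *\<^sub>C A f"
  by (simp_all add: bounded_operator_on_def)

lemma bop_diff: "bop A \<Longrightarrow> f \<in> K \<Longrightarrow> g \<in> K \<Longrightarrow> A (f - g) = A f - A g"
  using bop_add[of A "f - g" g] by (simp add: K_intros)

lemma bop_norm:
  assumes "bop A" obtains c where "c \<ge> 0" "\<And>f. f \<in> K \<Longrightarrow> norm (A f) \<le> c * norm f"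
proof -
  obtain c where c: "\<And>f. f \<in> K \<Longrightarrow> norm (A f) \<le> c * norm f"
    using assms unfolding bounded_operator_on_def by blast
  have "norm (A f) \<le> \<bar>c\<bar> * norm f" if "f \<in> K" for f
    by (rule order_trans[OF c[OF that] mult_right_mono]) simp_all
  then show ?thesis using that[of "\<bar>c\<bar>"] by simp
qed

lemma bopI:
  assumes "\<And>f. f \<in> K \<Longrightarrow> A f \<in> K"
    and "\<And>f g. f \<in> K \<Longrightarrow> g \<in> K \<Longrightarrow> A (f + g) = A f + A g"
    and "\<And>c f. f \<in> K \<Longrightarrow> A (c *\<^sub>C f) = c *\<^sub>C A f"
    and "\<And>f. f \<in> K \<Longrightarrow> norm (A f) \<le> B * norm f"
  shows "bop A"
  using assms unfolding bounded_operator_on_def by blast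

lemma bop_S: "bop S"
  by (rule bopI[where B = 1]) (simp_all add: S_K S_add S_scaleC norm_S)

lemma bop_L: "bop L"
  by (rule bopI[where B = 1]) (simp_all add: L_K backshift_add backshift_scaleC norm_backshift)

lemma bop_comp:
  assumes "bop A" "bop B" shows "bop (\<lambda>f. A (B f))"
proof -
  obtain a where a: "a \<ge> 0" "\<And>f. f \<in> K \<Longrightarrow> norm (A f) \<le> a * norm f" using bop_norm[OF assms(1)] by blast
  obtain b where b: "b \<ge> 0" "\<And>f. f \<in> K \<Longrightarrow> norm (B f) \<le> b * norm f" using bop_norm[OF assms(2)] by blast
  show ?thesis
  proof (rule bopI[where B = "a * b"])
    fix f assume f: "f \<in> K"
    have "norm (A (B f)) \<le> a * norm (B f)" by (rule a(2)[OF bop_K[OF assms(2) f]])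
    also have "\<dots> \<le> a * (b * norm f)" using a b f by (intro mult_left_mono) auto
    finally show "norm (A (B f)) \<le> a * b * norm f" by (simp add: mult.assoc)
  qed (simp_all add: bop_K[OF assms(1)] bop_K[OF assms(2)]
    bop_add[OF assms(1)] bop_add[OF assms(2)]
    bop_scaleC[OF assms(1)] bop_scaleC[OF assms(2)])
qed

lemma bop_plus:
  assumes "bop A" "bop B" shows "bop (\<lambda>f. A f + B f)"
proof -
  obtain a where a: "a \<ge> 0" "\<And>f. f \<in> K \<Longrightarrow> norm (A f) \<le> a * norm f" using bop_norm[OF assms(1)] by blast
  obtain b where b: "b \<ge> 0" "\<And>f. f \<in> K \<Longrightarrow> norm (B f) \<le> b * norm f" using bop_norm[OF assms(2)] by blast
  show ?thesis
  proof (rule bopI[where B = "a + b"])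
    fix f assume f: "f \<in> K"
    have "norm (A f + B f) \<le> norm (A f) + norm (B f)" by (rule norm_triangle_ineq)
    with a(2)[OF f] b(2)[OF f] show "norm (A f + B f) \<le> (a + b) * norm f" by (simp add: distrib_right)
  qed (simp_all add: bop_K[OF assms(1)] bop_K[OF assms(2)]
    bop_add[OF assms(1)] bop_add[OF assms(2)]
    bop_scaleC[OF assms(1)] bop_scaleC[OF assms(2)] K_intros scaleC_add_right)
qed

lemma bop_scale:
  assumes "bop A" shows "bop (\<lambda>f. c *\<^sub>C A f)"
proof -
  obtain a where a: "a \<ge> 0" "\<And>f. f \<in> K \<Longrightarrow> norm (A f) \<le> a * norm f" using bop_norm[OF assms(1)] by blast
  show ?thesis
  proof (rule bopI[where B = "cmod c * a"])
    show "norm (c *\<^sub>C A f) \<le> cmod c * a * norm f" if "f \<in> K" for f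
      using mult_left_mono[OF a(2)[OF that], of "cmod c"] by (simp add: norm_scaleC mult.assoc)
  qed (simp_all add: bop_K[OF assms] bop_add[OF assms] bop_scaleC[OF assms] K_intros scaleC_add_right scaleC_scaleC mult.commute)
qed

lemma bop_minus: "bop A \<Longrightarrow> bop B \<Longrightarrow> bop (\<lambda>f. A f - B f)"
  using bop_plus[of A "\<lambda>f. (- 1) *\<^sub>C B f"] bop_scale[of B "-1"] by (simp add: scaleC_minus_left)

lemma bop_id: "bop (\<lambda>f. f)"
  by (rule bopI[where B = 1]) simp_all

lemma bop_rank_one:
  assumes "x \<in> K" shows "bop (\<lambda>f. cinner f y *\<^sub>C x)"
proof (rule bopI[where B = "norm y * norm x"])
  show "norm (cinner f y *\<^sub>C x) \<le> norm y * norm x * norm f" for f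
    using mult_right_mono[OF cinner_cauchy_schwarz[of f y], of "norm x"]
    by (simp add: norm_scaleC mult_ac)
qed (simp_all add: assms K_intros cinner_simps scaleC_add_left scaleC_scaleC)

lemma bop_conj:
  assumes "bop A" shows "bop (\<lambda>f. C (A (C f)))"
proof -
  obtain a where a: "a \<ge> 0" "\<And>f. f \<in> K \<Longrightarrow> norm (A f) \<le> a * norm f" using bop_norm[OF assms(1)] by blast
  show ?thesis
  proof (rule bopI[where B = a])
    show "norm (C (A (C f))) \<le> a * norm f" if "f \<in> K" for f
      using a(2)[OF C_K[OF that]] by (simp add: norm_C)
  qed (simp_all add: bop_K[OF assms] bop_add[OF assms] bop_scaleC[OF assms] C_K C_add C_scaleC)
qed

lemma bop_tendsto:
  assumes "bop A" "\<And>n. x n \<in> K" "f \<in> K" "x \<longlonglongrightarrow> f"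
  shows "(\<lambda>n. A (x n)) \<longlonglongrightarrow> A f"
proof -
  obtain a where a: "a \<ge> 0" "\<And>f. f \<in> K \<Longrightarrow> norm (A f) \<le> a * norm f" using bop_norm[OF assms(1)] by blast
  have le: "norm (A (x n) - A f) \<le> a * norm (x n - f)" for n
    using a(2)[OF K_diff[OF assms(2)[of n] assms(3)]] by (simp only: bop_diff[OF assms(1) assms(2,3)])
  have "(\<lambda>n. a * norm (x n - f)) \<longlonglongrightarrow> a * norm (f - f)"
    using assms(4) by (intro tendsto_intros)
  then have "(\<lambda>n. a * norm (x n - f)) \<longlonglongrightarrow> 0" by simp
  then have "(\<lambda>n. A (x n) - A f) \<longlonglongrightarrow> 0"
    by (rule Lim_null_comparison[OF always_eventually[OF allI[OF le]]])
  then show ?thesis by (rule LIM_zero_cancel)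
qed

text \<open>A symbol prescribes an operator only on bounded functions; density carries such
  identities to all of \<open>K\<close>.\<close>

lemma bop_eq_bounded:
  assumes "bop A" "bop B" "\<And>f. f \<in> K \<Longrightarrow> ess_bounded f \<Longrightarrow> A f = B f" "f \<in> K"
  shows "A f = B f"
proof -
  obtain x where x: "\<And>n. x n \<in> K" "\<And>n. ess_bounded (x n)" "x \<longlonglongrightarrow> f"
    using K_bounded_sequence[OF assms(4)] by blast
  have "(\<lambda>n. A (x n)) \<longlonglongrightarrow> A f" by (rule bop_tendsto[OF assms(1) x(1) assms(4) x(3)])
  moreover have "(\<lambda>n. A (x n)) \<longlonglongrightarrow> B f"
    using bop_tendsto[OF assms(2) x(1) assms(4) x(3)] assms(3)[OF x(1) x(2)] by simp
  ultimately show ?thesis by (rule LIMSEQ_unique)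
qed

section \<open>Sarason's characterisation of truncated Toeplitz operators\<close>

definition displacement :: "(l2T \<Rightarrow> l2T) \<Rightarrow> l2T \<Rightarrow> l2T" where
  "displacement A f = A f - S (A (L f))"

lemma bop_displacement: "bop A \<Longrightarrow> bop (displacement A)"
  unfolding displacement_def by (intro bop_minus bop_comp[OF bop_S bop_comp[OF _ bop_L]])

text \<open>Multiplication by the conjugate of z is unitary and drops out of the second form, which
  becomes that of f - f(0) and g - g(0). Only terms containing one of these two constants survive,
  whence the rank of at most two.\<close>

lemma displacement_symbol:
  assumes f: "f \<in> K" "ess_bounded f" and g: "g \<in> K"
  shows "cinner (\<phi> \<odot> f) g - cinner (\<phi> \<odot> L f) (L g) =
    cinner f k * cinner \<phi> g + cinner k g * (cinner f (cnj_l2T \<phi>) - cinner f k * cinner \<phi> (const_l2T 1))"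
proof -
  define a b where "a = fourier_coeff f 0" and "b = fourier_coeff g 0"
  have ab: "cinner f k = a" "cinner k g = cnj b"
    using cinner_k[OF f(1)] cinner_k[OF g] cinner_commute[of k g] by (simp_all add: a_def b_def)
  have fa: "ess_bounded (f - const_l2T a)" using f by (intro ess_bounded_intros)
  have "\<phi> \<odot> L f = cnj_l2T id_l2T \<odot> (\<phi> \<odot> (f - const_l2T a))"
    using mult_l2T_left_commute[of "f - const_l2T a" "cnj_l2T id_l2T" \<phi>]
    by (simp add: backshift_def a_def[symmetric] fa ess_bounded_cnj_id mult_l2T_commute[of \<phi>]
        mult_l2T_assoc[symmetric])
  then have "cinner (\<phi> \<odot> L f) (L g) = cinner (\<phi> \<odot> (f - const_l2T a)) (g - const_l2T b)"
    by (simp add: backshift_def b_def[symmetric] cinner_unimodular unimodular_cnj_id)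
  also have "\<phi> \<odot> (f - const_l2T a) = \<phi> \<odot> f - a *\<^sub>C \<phi>"
    using f(2) fa by (simp add: mult_l2T_commute[of \<phi>] mult_l2T_const[symmetric]) (rule represents_eqI,
        (rule represents_intros represents_rep disjI1 fa f ess_bounded_const)+, simp add: algebra_simps)
  finally have e: "cinner (\<phi> \<odot> L f) (L g) = cinner (\<phi> \<odot> f) g - a * cinner \<phi> g
      - cnj b * (cinner (\<phi> \<odot> f) (const_l2T 1) - a * cinner \<phi> (const_l2T 1))"
    using cinner_scaleC_right[of _ b "const_l2T 1"] by (simp add: cinner_simps scaleC_const algebra_simps)
  have "cinner (\<phi> \<odot> f) (const_l2T 1) = cinner f (cnj_l2T \<phi>)"
    using cinner_mult_bounded[OF f(2) ess_bounded_const, of \<phi> 1] by (simp add: mult_l2T_const_right)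
  then show ?thesis unfolding e ab by (simp add: algebra_simps)
qed

lemma toeplitz_displacement:
  assumes "A \<in> trunc_toeplitz u"
  obtains \<psi> \<xi> where "\<psi> \<in> K" "\<xi> \<in> K"
    "\<And>f. f \<in> K \<Longrightarrow> displacement A f = cinner f k *\<^sub>C \<psi> + cinner f \<xi> *\<^sub>C k"
proof -
  obtain \<phi> where A: "bop A" and \<phi>: "\<And>f. f \<in> K \<Longrightarrow> ess_bounded f \<Longrightarrow> A f = P (\<phi> \<odot> f)"
    using assms by (auto simp: trunc_toeplitz_def)
  define c where "c = cinner \<phi> (const_l2T 1)"
  \<comment> \<open>Read off from \<open>displacement_symbol\<close>; the multiple of
    \<open>k\<close> removes the constant coefficient of the symbol, which would otherwise be
    counted in both terms.\<close>
  define \<psi> \<xi> where "\<psi> = P \<phi>" and "\<xi> = P (cnj_l2T \<phi>) - cnj c *\<^sub>C k"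
  have K: "\<psi> \<in> K" "\<xi> \<in> K" unfolding \<psi>_def \<xi>_def by (intro K_intros P_K k_K)+
  have P': "cinner f (P h) = cinner f h" if "f \<in> K" for f h
    using cinner_P[OF that, of h] cinner_commute by metis
  have "displacement A f = cinner f k *\<^sub>C \<psi> + cinner f \<xi> *\<^sub>C k" if f: "f \<in> K" for f
  proof (rule bop_eq_bounded[OF _ _ _ f])
    show "bop (displacement A)" by (rule bop_displacement[OF A])
    show "bop (\<lambda>f. cinner f k *\<^sub>C \<psi> + cinner f \<xi> *\<^sub>C k)" by (intro bop_plus bop_rank_one K k_K)
    fix f assume f: "f \<in> K" "ess_bounded f"
    show "displacement A f = cinner f k *\<^sub>C \<psi> + cinner f \<xi> *\<^sub>C k"
    proof (rule K_eqI)
      show "displacement A f \<in> K" by (rule bop_K[OF bop_displacement[OF A] f(1)])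
      show "cinner f k *\<^sub>C \<psi> + cinner f \<xi> *\<^sub>C k \<in> K" by (intro K_intros K k_K)
      fix g assume g: "g \<in> K"
      have "cinner (displacement A f) g = cinner (\<phi> \<odot> f) g - cinner (\<phi> \<odot> L f) (L g)"
        using f g by (simp add: displacement_def cinner_simps cinner_S bop_K[OF A] L_K \<phi> ess_bounded_backshift cinner_P P_K)
      also have "\<dots> = cinner (cinner f k *\<^sub>C \<psi> + cinner f \<xi> *\<^sub>C k) g"
        unfolding displacement_symbol[OF f g] using f g
        by (simp add: cinner_simps \<psi>_def \<xi>_def cinner_P P' c_def)
      finally show "cinner (displacement A f) g = cinner (cinner f k *\<^sub>C \<psi> + cinner f \<xi> *\<^sub>C k) g" .
    qed
  qed
  with K show ?thesis using that by blast
qed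

text \<open>For an analytic symbol the power of \<open>L\<close> on the right can be moved to the
  left as a power of z and past \<open>\<psi>\<close>. Then \<open>\<psi>\<close> is shifted onto
  the fixed bounded \<open>g\<close>, leaving a constant times the norm of
  \<open>(L ^^ n) f\<close>. This avoids any bound on \<open>\<psi>\<close>.\<close>

lemma symbol_form_tendsto_zero:
  assumes \<psi>: "\<psi> \<in> hardy" and f: "f \<in> K" "ess_bounded f" and g: "ess_bounded g"
  shows "(\<lambda>n. cinner (\<psi> \<odot> (L ^^ n) f) ((L ^^ n) g)) \<longlonglongrightarrow> 0"
proof (rule Lim_null_comparison)
  have "cmod (cinner (\<psi> \<odot> (L ^^ n) f) ((L ^^ n) g)) \<le> norm ((L ^^ n) f) * norm (cnj_l2T \<psi> \<odot> g)" for n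
  proof -
    let ?f = "(L ^^ n) f"
    have fb: "ess_bounded ?f" "?f \<in> hardy"
      using f by (simp_all add: ess_bounded_L_pow L_pow_K K_hardy)
    have h: "\<psi> \<odot> ?f \<in> hardy"
      using bounded_mult_hardy[OF fb(2,1) \<psi>] by (simp add: mult_l2T_commute)
    have "cinner (\<psi> \<odot> ?f) ((L ^^ n) g) = cinner (zpow (int n) \<odot> (\<psi> \<odot> ?f)) g"
      by (simp add: cinner_backshift_pow[OF h])
    also have "zpow (int n) \<odot> (\<psi> \<odot> ?f) = \<psi> \<odot> (zpow (int n) \<odot> ?f)"
    proof -
      have "zpow (int n) \<odot> (?f \<odot> \<psi>) = (zpow (int n) \<odot> ?f) \<odot> \<psi>"
        by (rule mult_l2T_assoc[OF ess_bounded_zpow fb(1)])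
      then show ?thesis by (simp only: mult_l2T_commute[of \<psi>])
    qed
    also have "cinner \<dots> g = cinner (zpow (int n) \<odot> ?f) (cnj_l2T \<psi> \<odot> g)"
      by (rule cinner_mult_bounded) (intro ess_bounded_mult ess_bounded_zpow fb g)+
    also have "cmod \<dots> \<le> norm (zpow (int n) \<odot> ?f) * norm (cnj_l2T \<psi> \<odot> g)"
      by (rule cinner_cauchy_schwarz)
    finally show ?thesis by (simp add: norm_unimodular unimodular_zpow)
  qed
  then show "\<forall>\<^sub>F n in sequentially. norm (cinner (\<psi> \<odot> (L ^^ n) f) ((L ^^ n) g))
      \<le> norm ((L ^^ n) f) * norm (cnj_l2T \<psi> \<odot> g)" by simp
  have "(\<lambda>n. norm ((L ^^ n) f) * norm (cnj_l2T \<psi> \<odot> g)) \<longlonglongrightarrow> norm (0::l2T) * norm (cnj_l2T \<psi> \<odot> g)"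
    by (intro tendsto_intros backshift_pow_tendsto_zero K_hardy f)
  then show "(\<lambda>n. norm ((L ^^ n) f) * norm (cnj_l2T \<psi> \<odot> g)) \<longlonglongrightarrow> 0" by simp
qed

text \<open>The operator \<open>A\<close> and its candidate symbol \<open>\<psi> + cnj \<xi>\<close> have the same displacement, so the
  difference \<open>F\<close> of their forms is invariant under \<open>L \<times> L\<close>, and \<open>L\<^sup>n\<close> tends to \<open>0\<close> strongly.\<close>

lemma displacement_toeplitz:
  assumes A: "bop A" and K: "\<psi> \<in> K" "\<xi> \<in> K"
    and d: "\<And>f. f \<in> K \<Longrightarrow> displacement A f = cinner f k *\<^sub>C \<psi> + cinner f \<xi> *\<^sub>C k"
  shows "A \<in> trunc_toeplitz u"
proof -
  define \<phi> where "\<phi> = \<psi> + cnj_l2T \<xi>"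
  have \<phi>_mult: "\<phi> \<odot> f = \<psi> \<odot> f + cnj_l2T \<xi> \<odot> f" if "ess_bounded f" for f
    unfolding \<phi>_def by (rule mult_l2T_add_left[OF that])
  define F where "F f g = cinner (A f) g - cinner (\<phi> \<odot> f) g" for f g
  have step: "F f g = F (L f) (L g)" if f: "f \<in> K" "ess_bounded f" and g: "g \<in> K" for f g
  proof -
    have 1: "cinner (A f) g - cinner (A (L f)) (L g) = cinner f k * cinner \<psi> g + cinner f \<xi> * cinner k g"
      using arg_cong[OF d[OF f(1)], of "\<lambda>x. cinner x g"] f g
      by (simp add: displacement_def cinner_simps cinner_S bop_K[OF A] L_K)
    have "cinner (cnj_l2T \<xi>) g = cnj (fourier_coeff \<xi> 0) * cinner k g"
      using cinner_hardy_cnj[OF K_hardy[OF g] K_hardy[OF K(2)]] cinner_k[OF g]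
        cinner_commute[of "cnj_l2T \<xi>" g] cinner_commute[of k g] by (simp add: mult.commute)
    then have 2: "cinner \<phi> g = cinner \<psi> g + cnj (fourier_coeff \<xi> 0) * cinner k g"
      by (simp add: \<phi>_def cinner_simps)
    have 3: "cinner f (cnj_l2T \<phi>) = cinner f k * fourier_coeff \<psi> 0 + cinner f \<xi>"
      using cinner_hardy_cnj[OF K_hardy[OF f(1)] K_hardy[OF K(1)]] cinner_k[OF f(1)]
      by (simp add: \<phi>_def cnj_l2T_add cinner_simps)
    have 4: "cinner \<phi> (const_l2T 1) = fourier_coeff \<psi> 0 + cnj (fourier_coeff \<xi> 0)"
      by (simp add: \<phi>_def cinner_const_right fourier_coeff_add fourier_coeff_cnj)
    show ?thesis
      using displacement_symbol[OF f g, of \<phi>] 1 unfolding F_def 2 3 4 by (simp add: algebra_simps)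
  qed
  have iter: "F f g = F ((L ^^ n) f) ((L ^^ n) g)" if f: "f \<in> K" "ess_bounded f" and g: "g \<in> K" for f g n
    by (induction n) (simp_all add: step[symmetric] L_pow_K ess_bounded_L_pow f g)
  have zero: "F f g = 0" if f: "f \<in> K" "ess_bounded f" and g: "g \<in> K" "ess_bounded g" for f g
  proof -
    have Lf: "(\<lambda>n. (L ^^ n) h) \<longlonglongrightarrow> 0" if "h \<in> K" for h
      by (rule backshift_pow_tendsto_zero[OF K_hardy[OF that]])
    have "(\<lambda>n. A ((L ^^ n) f)) \<longlonglongrightarrow> A 0"
      by (rule bop_tendsto[OF A L_pow_K[OF f(1)] K_zero Lf[OF f(1)]])
    from tendsto_cinner[OF this Lf[OF g(1)]]
    have 1: "(\<lambda>n. cinner (A ((L ^^ n) f)) ((L ^^ n) g)) \<longlonglongrightarrow> 0" by simp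
    have 2: "(\<lambda>n. cinner (\<psi> \<odot> (L ^^ n) f) ((L ^^ n) g)) \<longlonglongrightarrow> 0"
      by (rule symbol_form_tendsto_zero[OF K_hardy[OF K(1)] f g(2)])
    \<comment> \<open>The coanalytic part is the conjugate of an analytic one with \<open>f\<close>
      and \<open>g\<close> exchanged, so \<open>symbol_form_tendsto_zero\<close> applies to it
      too.\<close>
    have "cinner (cnj_l2T \<xi> \<odot> a) b = cnj (cinner (\<xi> \<odot> b) a)" if "ess_bounded a" "ess_bounded b" for a b
      using cinner_mult_bounded[OF that(2,1), of \<xi>] cinner_commute[of b "cnj_l2T \<xi> \<odot> a"] by simp
    then have "cinner (cnj_l2T \<xi> \<odot> (L ^^ n) f) ((L ^^ n) g) = cnj (cinner (\<xi> \<odot> (L ^^ n) g) ((L ^^ n) f))" for n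
      using f g ess_bounded_L_pow by blast
    moreover have "(\<lambda>n. cnj (cinner (\<xi> \<odot> (L ^^ n) g) ((L ^^ n) f))) \<longlonglongrightarrow> cnj 0"
      by (intro tendsto_cnj symbol_form_tendsto_zero[OF K_hardy[OF K(2)] g f(2)])
    ultimately have 3: "(\<lambda>n. cinner (cnj_l2T \<xi> \<odot> (L ^^ n) f) ((L ^^ n) g)) \<longlonglongrightarrow> 0" by simp
    have "(\<lambda>n. F ((L ^^ n) f) ((L ^^ n) g)) \<longlonglongrightarrow> 0 - (0 + 0)"
      using tendsto_diff[OF 1 tendsto_add[OF 2 3]]
      by (simp add: F_def \<phi>_mult ess_bounded_L_pow f cinner_simps)
    then show ?thesis by (simp add: iter[OF f g(1), symmetric] LIMSEQ_const_iff)
  qed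
  have "A f = P (\<phi> \<odot> f)" if f: "f \<in> K" "ess_bounded f" for f
  proof -
    have "A f - P (\<phi> \<odot> f) = 0"
    proof (rule K_bounded_orth)
      show "A f - P (\<phi> \<odot> f) \<in> K" by (intro K_intros P_K bop_K[OF A] f)
      show "cinner (A f - P (\<phi> \<odot> f)) g = 0" if "g \<in> K" "ess_bounded g" for g
        using zero[OF f that] that by (simp add: cinner_simps cinner_P F_def)
    qed
    then show ?thesis by simp
  qed
  with A show ?thesis by (auto simp: trunc_toeplitz_def)
qed

section \<open>Conjugation symmetry of truncated Toeplitz operators\<close>

lemma toeplitz_bop: "A \<in> trunc_toeplitz u \<Longrightarrow> bop A"
  by (simp add: trunc_toeplitz_def)

text \<open>On bounded functions \<open>C\<close> is conjugation followed by a unimodular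
  multiplier, which commutes with the symbol and cancels in the inner product. Density of bounded
  functions gives the general case.\<close>

lemma toeplitz_C_symmetric:
  assumes "A \<in> trunc_toeplitz u" "f \<in> K" "g \<in> K"
  shows "cinner (A (C f)) (C g) = cinner (A g) f"
proof -
  obtain \<phi> where A: "bop A" and \<phi>: "\<And>f. f \<in> K \<Longrightarrow> ess_bounded f \<Longrightarrow> A f = P (\<phi> \<odot> f)"
    using assms by (auto simp: trunc_toeplitz_def)
  have b: "cinner (A (C f)) (C g) = cinner (A g) f"
    if f: "f \<in> K" "ess_bounded f" and g: "g \<in> K" "ess_bounded g" for f g
  proof -
    let ?w = "u \<odot> cnj_l2T id_l2T"
    have "cinner (A (C f)) (C g) = cinner (\<phi> \<odot> C f) (C g)"
      using f g by (simp add: \<phi> C_K ess_bounded_C cinner_P)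
    also have "\<dots> = cinner (?w \<odot> (\<phi> \<odot> cnj_l2T f)) (?w \<odot> cnj_l2T g)"
    proof -
      have "?w \<odot> (cnj_l2T f \<odot> \<phi>) = (?w \<odot> cnj_l2T f) \<odot> \<phi>"
        by (rule mult_l2T_assoc[OF bounded_w ess_bounded_cnj[OF f(2)]])
      then show ?thesis by (simp only: C_eq mult_l2T_commute[of \<phi>])
    qed
    also have "\<dots> = cinner (\<phi> \<odot> cnj_l2T f) (cnj_l2T g)" by (simp add: cinner_unimodular unimodular_w)
    also have "\<dots> = cinner \<phi> (f \<odot> cnj_l2T g)"
      by (simp add: mult_l2T_commute[of \<phi>] cinner_mult_left ess_bounded_cnj f)
    also have "\<dots> = cinner (\<phi> \<odot> g) f"
      by (simp add: mult_l2T_commute[of \<phi>] mult_l2T_commute[of f] cinner_mult_left g)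
    also have "\<dots> = cinner (A g) f" using f g by (simp add: \<phi> cinner_P)
    finally show ?thesis .
  qed
  obtain x where x: "\<And>n. x n \<in> K" "\<And>n. ess_bounded (x n)" "x \<longlonglongrightarrow> f"
    using K_bounded_sequence[OF assms(2)] by blast
  obtain y where y: "\<And>n. y n \<in> K" "\<And>n. ess_bounded (y n)" "y \<longlonglongrightarrow> g"
    using K_bounded_sequence[OF assms(3)] by blast
  have Ct: "(\<lambda>n. C (z n)) \<longlonglongrightarrow> C h" if "z \<longlonglongrightarrow> h" for z h
    using that by (rule bounded_linear.tendsto[OF bounded_linear_C])
  have "(\<lambda>n. cinner (A (C (x n))) (C (y n))) \<longlonglongrightarrow> cinner (A (C f)) (C g)"
    by (intro tendsto_cinner bop_tendsto[OF A] C_K Ct x y assms)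
  moreover have "(\<lambda>n. cinner (A (C (x n))) (C (y n))) \<longlonglongrightarrow> cinner (A g) f"
    unfolding b[OF x(1,2) y(1,2)] by (intro tendsto_cinner bop_tendsto[OF A] x y assms)
  ultimately show ?thesis by (rule LIMSEQ_unique)
qed

section \<open>Complex symmetric operators\<close>

text \<open>Weak form of "the adjoint is \<open>C A C\<close>". It covers both truncated Toeplitz
  operators and the generalised shifts.\<close>

definition csym :: "(l2T \<Rightarrow> l2T) \<Rightarrow> bool" where
  "csym A \<longleftrightarrow> bop A \<and> (\<forall>f\<in>K. \<forall>g\<in>K. cinner (A f) g = cinner f (C (A (C g))))"

text \<open>The Hilbert space adjoint when \<open>csym A\<close> holds; for other operators just the
  conjugate by \<open>C\<close>.\<close>

definition adj :: "(l2T \<Rightarrow> l2T) \<Rightarrow> l2T \<Rightarrow> l2T" where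
  "adj A f = C (A (C f))"

lemma cinner_C_right: "cinner f (C g) = cinner g (C f)"
  using cinner_C[of "C f" g] by simp

lemma csym_bop: "csym A \<Longrightarrow> bop A" by (simp add: csym_def)

lemma csym_adj_eq: "csym A \<Longrightarrow> f \<in> K \<Longrightarrow> g \<in> K \<Longrightarrow> cinner (A f) g = cinner f (adj A g)"
  by (simp add: csym_def adj_def)

lemma csym_symmetric: "csym A \<Longrightarrow> f \<in> K \<Longrightarrow> g \<in> K \<Longrightarrow> cinner (A f) g = cinner (A (C g)) (C f)"
  by (simp add: csym_def cinner_C_right[of f])

lemma adj_adj [simp]: "adj (adj A) = A"
  by (simp add: adj_def fun_eq_iff)

lemma bop_adj: "bop A \<Longrightarrow> bop (adj A)"
  unfolding adj_def[abs_def] by (rule bop_conj)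

lemma csym_adj: assumes "csym A" shows "csym (adj A)"
  unfolding csym_def
proof (intro conjI ballI)
  show "bop (adj A)" using assms by (simp add: csym_bop bop_adj)
  fix f g assume fg: "f \<in> K" "g \<in> K"
  have "cinner (adj A f) g = cnj (cinner g (adj A f))" by (rule cinner_commute)
  also have "\<dots> = cnj (cinner (A g) f)" using fg assms by (simp add: csym_adj_eq)
  also have "\<dots> = cinner f (A g)" by (rule cinner_commute[symmetric])
  finally show "cinner (adj A f) g = cinner f (C (adj A (C g)))" by (simp add: adj_def)
qed

lemma toeplitz_csym: assumes "A \<in> trunc_toeplitz u" shows "csym A"
  unfolding csym_def
proof (intro conjI ballI)
  show "bop A" using assms by (rule toeplitz_bop)
  fix f g assume fg: "f \<in> K" "g \<in> K"
  show "cinner (A f) g = cinner f (C (A (C g)))"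
    using toeplitz_C_symmetric[OF assms fg(2,1)] toeplitz_C_symmetric[OF assms C_K[OF fg(1)] C_K[OF fg(2)]]
    by (simp add: cinner_C_right[of f])
qed

section \<open>Normalised displacement\<close>

text \<open>Multiples of \<open>k\<close> can be traded between the two Sarason terms. Orthogonality
  to \<open>k\<close> removes this freedom, and \<open>c\<close> collects the multiples.\<close>

definition normal_disp :: "(l2T \<Rightarrow> l2T) \<Rightarrow> l2T \<Rightarrow> l2T \<Rightarrow> complex \<Rightarrow> bool" where
  "normal_disp A \<psi> \<xi> c \<longleftrightarrow> \<psi> \<in> K \<and> \<xi> \<in> K \<and> cinner \<psi> k = 0 \<and> cinner \<xi> k = 0 \<and>
     (\<forall>f\<in>K. displacement A f = cinner f k *\<^sub>C \<psi> + cinner f \<xi> *\<^sub>C k + (c * cinner f k) *\<^sub>C k)"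

lemma cinner_k_k_nonzero: "cinner k k \<noteq> 0"
  using k_nonzero by (simp add: cinner_eq_zero_iff)

lemma toeplitz_normal_disp:
  assumes "A \<in> trunc_toeplitz u" obtains \<psi> \<xi> c where "normal_disp A \<psi> \<xi> c"
proof -
  obtain \<psi> \<xi> where K: "\<psi> \<in> K" "\<xi> \<in> K"
    and d: "\<And>f. f \<in> K \<Longrightarrow> displacement A f = cinner f k *\<^sub>C \<psi> + cinner f \<xi> *\<^sub>C k"
    using toeplitz_displacement[OF assms] by blast
  define a b where "a = cinner \<psi> k / cinner k k" and "b = cinner \<xi> k / cinner k k"
  have "normal_disp A (\<psi> - a *\<^sub>C k) (\<xi> - b *\<^sub>C k) (a + cnj b)"
    unfolding normal_disp_def
  proof (intro conjI ballI)
    show "cinner (\<psi> - a *\<^sub>C k) k = 0" "cinner (\<xi> - b *\<^sub>C k) k = 0"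
      using cinner_k_k_nonzero by (simp_all add: cinner_simps a_def b_def)
    fix f assume "f \<in> K"
    from d[OF this] show "displacement A f = cinner f k *\<^sub>C (\<psi> - a *\<^sub>C k) + cinner f (\<xi> - b *\<^sub>C k) *\<^sub>C k
        + ((a + cnj b) * cinner f k) *\<^sub>C k"
      by (simp add: cinner_simps scaleC_diff_right scaleC_diff_left scaleC_add_left scaleC_scaleC
          distrib_left distrib_right mult.commute)
  qed (intro K_intros K k_K)+
  then show ?thesis by (rule that)
qed

lemma normal_disp_toeplitz:
  assumes "bop A" "normal_disp A \<psi> \<xi> c" shows "A \<in> trunc_toeplitz u"
proof (rule displacement_toeplitz[OF assms(1)])
  show "\<psi> + c *\<^sub>C k \<in> K" "\<xi> \<in> K" using assms(2) by (auto simp: normal_disp_def intro!: K_intros k_K)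
  show "displacement A f = cinner f k *\<^sub>C (\<psi> + c *\<^sub>C k) + cinner f \<xi> *\<^sub>C k" if "f \<in> K" for f
    using assms(2) that by (simp add: normal_disp_def scaleC_add_right scaleC_scaleC mult.commute)
qed

text \<open>Displacement commutes with taking adjoints, and the adjoint exchanges the two factors of
  each rank-one term.\<close>

lemma normal_disp_adj:
  assumes A: "csym A" and d: "normal_disp A \<psi> \<xi> c"
  shows "normal_disp (adj A) \<xi> \<psi> (cnj c)"
  unfolding normal_disp_def
proof (intro conjI ballI)
  show K: "\<xi> \<in> K" "\<psi> \<in> K" "cinner \<xi> k = 0" "cinner \<psi> k = 0" using d by (auto simp: normal_disp_def)
  have bA: "bop A" "bop (adj A)" using A by (simp_all add: csym_bop bop_adj)
  have AK: "\<And>f. f \<in> K \<Longrightarrow> A f \<in> K" "\<And>f. f \<in> K \<Longrightarrow> adj A f \<in> K" using bA bop_K by blast+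
  fix f assume f: "f \<in> K"
  show "displacement (adj A) f = cinner f k *\<^sub>C \<xi> + cinner f \<psi> *\<^sub>C k + (cnj c * cinner f k) *\<^sub>C k"
  proof (rule K_eqI)
    show "displacement (adj A) f \<in> K" by (rule bop_K[OF bop_displacement[OF bA(2)] f])
    show "cinner f k *\<^sub>C \<xi> + cinner f \<psi> *\<^sub>C k + (cnj c * cinner f k) *\<^sub>C k \<in> K" by (intro K_intros K k_K)
    fix g assume g: "g \<in> K"
    have ad: "cinner (adj A x) y = cinner x (A y)" if "x \<in> K" "y \<in> K" for x y
      using csym_adj_eq[OF csym_adj[OF A] that] by simp
    have "cinner (displacement (adj A) f) g = cinner f (displacement A g)"
      using f g by (simp add: displacement_def cinner_simps cinner_S ad AK L_K cinner_L[symmetric] S_K)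
    also have "\<dots> = cinner (cinner f k *\<^sub>C \<xi> + cinner f \<psi> *\<^sub>C k + (cnj c * cinner f k) *\<^sub>C k) g"
      using d g cinner_commute[of k g] cinner_commute[of \<xi> g] by (simp add: normal_disp_def cinner_simps)
    finally show "cinner (displacement (adj A) f) g
        = cinner (cinner f k *\<^sub>C \<xi> + cinner f \<psi> *\<^sub>C k + (cnj c * cinner f k) *\<^sub>C k) g" .
  qed
qed

section \<open>Adjoints, multiples and scalar truncated Toeplitz operators\<close>

lemma toeplitz_adj: "A \<in> trunc_toeplitz u \<Longrightarrow> adj A \<in> trunc_toeplitz u"
  by (metis toeplitz_normal_disp normal_disp_toeplitz normal_disp_adj toeplitz_csym bop_adj toeplitz_bop)

lemma toeplitz_cong:
  assumes "A \<in> trunc_toeplitz u" "\<And>f. f \<in> K \<Longrightarrow> B f = A f" shows "B \<in> trunc_toeplitz u"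
proof -
  have "bop A" using assms(1) by (rule toeplitz_bop)
  then have "bop B" using assms(2) unfolding bounded_operator_on_def by (simp add: K_intros)
  then show ?thesis using assms by (auto simp: trunc_toeplitz_def)
qed

lemma toeplitz_scale:
  assumes "A \<in> trunc_toeplitz u" shows "(\<lambda>f. c *\<^sub>C A f) \<in> trunc_toeplitz u"
proof -
  obtain \<psi> \<xi> d where d: "normal_disp A \<psi> \<xi> d" using toeplitz_normal_disp[OF assms] .
  have A: "bop A" using assms by (rule toeplitz_bop)
  have "normal_disp (\<lambda>f. c *\<^sub>C A f) (c *\<^sub>C \<psi>) (cnj c *\<^sub>C \<xi>) (c * d)"
    unfolding normal_disp_def
  proof (intro conjI ballI)
    fix f assume f: "f \<in> K"
    have "displacement (\<lambda>f. c *\<^sub>C A f) f = c *\<^sub>C displacement A f"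
      using f bop_K[OF A] by (simp add: displacement_def scaleC_diff_right S_scaleC L_K)
    then show "displacement (\<lambda>f. c *\<^sub>C A f) f
      = cinner f k *\<^sub>C c *\<^sub>C \<psi> + cinner f (cnj c *\<^sub>C \<xi>) *\<^sub>C k + (c * d * cinner f k) *\<^sub>C k"
      using d f by (simp add: normal_disp_def scaleC_add_right scaleC_scaleC cinner_simps mult_ac)
  qed (use d in \<open>auto simp: normal_disp_def cinner_simps intro: K_intros\<close>)
  then show ?thesis by (rule normal_disp_toeplitz[OF bop_scale[OF A]])
qed

text \<open>Iterating \<open>A = S A L\<close> bounds \<open>norm (A f)\<close> by the norm of
  \<open>A ((L ^^ n) f)\<close>, as \<open>S\<close> is a contraction, and the iterates of
  \<open>L\<close> tend to 0 strongly.\<close>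

lemma displacement_zero:
  assumes A: "bop A" and d: "\<And>f. f \<in> K \<Longrightarrow> displacement A f = 0" and f: "f \<in> K"
  shows "A f = 0"
proof -
  have "norm (A f) \<le> norm (A ((L ^^ n) f))" for n
  proof (induction n)
    case (Suc n)
    have "A ((L ^^ n) f) = S (A (L ((L ^^ n) f)))"
      using d[OF L_pow_K[OF f, of n]] by (simp add: displacement_def)
    also have "norm \<dots> \<le> norm (A (L ((L ^^ n) f)))"
      by (intro norm_S bop_K[OF A] L_K L_pow_K f)
    finally show ?case using Suc by simp
  qed simp
  moreover have "(\<lambda>n. norm (A ((L ^^ n) f))) \<longlonglongrightarrow> norm (A 0)"
    by (intro tendsto_norm bop_tendsto[OF A] L_pow_K f K_zero backshift_pow_tendsto_zero K_hardy)
  moreover have "A 0 = 0" using bop_scaleC[OF A K_zero, of 0] by simp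
  ultimately have "norm (A f) \<le> 0" by (intro LIMSEQ_le_const) auto
  then show ?thesis by simp
qed

lemma displacement_id: "f \<in> K \<Longrightarrow> displacement (\<lambda>f. f) f = cinner f k *\<^sub>C k"
  by (simp add: displacement_def S_L)

text \<open>The identity has displacement \<open>cinner f k *\<^sub>C k\<close>, so subtracting
  \<open>c\<close> times it from \<open>A\<close> leaves zero displacement.\<close>

lemma normal_disp_scalar:
  assumes A: "bop A" and d: "normal_disp A 0 0 c" and f: "f \<in> K"
  shows "A f = c *\<^sub>C f"
proof -
  have "A f - c *\<^sub>C f = 0"
  proof (rule displacement_zero[OF _ _ f])
    show "bop (\<lambda>f. A f - c *\<^sub>C f)" by (intro bop_minus A bop_scale bop_id)
    fix f assume f: "f \<in> K"
    have "displacement (\<lambda>f. A f - c *\<^sub>C f) f = displacement A f - c *\<^sub>C displacement (\<lambda>f. f) f"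
      using f bop_K[OF A] by (simp add: displacement_def S_diff S_scaleC L_K K_intros scaleC_diff_right)
    also have "\<dots> = 0" using d f by (simp add: normal_disp_def displacement_id scaleC_scaleC)
    finally show "displacement (\<lambda>f. A f - c *\<^sub>C f) f = 0" .
  qed
  then show ?thesis by simp
qed

section \<open>Products of truncated Toeplitz operators\<close>

text \<open>On the orthogonal complement of \<open>k\<close> in \<open>K\<close>, this is the conjugation \<open>f \<mapsto> u \<sqdot> cnj f\<close>.\<close>

definition V :: "l2T \<Rightarrow> l2T" where "V f = S (C f)"

lemma V_K: "V f \<in> K" by (simp add: V_def S_K)

lemma V_scaleC: "f \<in> K \<Longrightarrow> V (c *\<^sub>C f) = cnj c *\<^sub>C V f"
  by (simp add: V_def C_scaleC S_scaleC C_K)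

lemma cinner_V_k:
  assumes "f \<in> K" "cinner f k = 0" shows "cinner (V f) k = 0"
proof -
  have "cinner (C f) k' = cinner k f" using cinner_C[of f k] by (simp add: C_k)
  then show ?thesis using assms cinner_commute[of k f]
    by (simp add: V_def cinner_S C_K k_K L_k cinner_simps)
qed

text \<open>\<open>V (V f)\<close> equals \<open>S (L f)\<close>, which differs from
  \<open>f\<close> by a multiple of \<open>k\<close> only.\<close>

lemma V_V:
  assumes "f \<in> K" "cinner f k = 0" shows "V (V f) = f"
  using assms by (simp add: V_def C_S C_K S_L)

text \<open>Solves the linear system for \<open>cinner (A k) g\<close> and
  \<open>cinner (S (A k')) g\<close>; terms along \<open>k\<close> vanish because \<open>g\<close>
  is orthogonal to it.\<close>

lemma cinner_A_kernels:
  assumes A: "csym A" and d: "normal_disp A \<psi> \<xi> c" and g: "g \<in> K" "cinner g k = 0"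
  shows "cinner (S (A k')) g = cinner (V \<xi>) g - cnj t * cinner \<psi> g"
    and "cinner (A k) g = cinner \<psi> g - t * cinner (V \<xi>) g"
proof -
  let ?A' = "adj A"
  have d': "normal_disp ?A' \<xi> \<psi> (cnj c)" by (rule normal_disp_adj[OF A d])
  have bA: "bop A" "bop ?A'" using A by (simp_all add: csym_bop bop_adj)
  have K: "\<psi> \<in> K" "\<xi> \<in> K" "cinner \<psi> k = 0" "cinner \<xi> k = 0" using d by (auto simp: normal_disp_def)
  have kg: "cinner k g = 0" using cinner_commute[of k g] g by simp
  have S_Lk: "S (B (L k)) = - t *\<^sub>C S (B k')" if "bop B" for B
    using bop_K[OF that k'_K] by (simp add: L_k bop_scaleC[OF that k'_K] S_scaleC)
  have "cinner k \<xi> = 0" "cinner k \<psi> = 0" using cinner_commute[of k] K by simp_all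
  then have Ak: "A k = cinner k k *\<^sub>C \<psi> - t *\<^sub>C S (A k') + (c * cinner k k) *\<^sub>C k"
    and A'k: "?A' k = cinner k k *\<^sub>C \<xi> - t *\<^sub>C S (?A' k') + (cnj c * cinner k k) *\<^sub>C k"
    using d d' k_K S_Lk[OF bA(1)] S_Lk[OF bA(2)]
    by (auto simp: normal_disp_def displacement_def scaleC_minus_left algebra_simps)
  have Ak1: "cinner (A k) g = cinner k k * cinner \<psi> g - t * cinner (S (A k')) g"
    unfolding Ak by (simp add: cinner_simps kg)
  \<comment> \<open>\<open>A k'\<close> is the conjugate of \<open>adj A k\<close>, so the
    displacement of the adjoint at \<open>k\<close> supplies the second equation.\<close>
  have "S (A k') = S (C (?A' k))" by (simp add: adj_def C_k)
  also have "C (?A' k) = cnj (cinner k k) *\<^sub>C C \<xi> - cnj t *\<^sub>C C (S (?A' k')) + (c * cnj (cinner k k)) *\<^sub>C k'"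
    unfolding A'k by (simp add: C_add C_diff C_scaleC C_k)
  also have "C (S (?A' k')) = L (A k)"
    using bop_K[OF bA(1) k_K] by (simp add: adj_def C_S C_K C_k' )
  finally have "S (A k') = cnj (cinner k k) *\<^sub>C V \<xi> - cnj t *\<^sub>C S (L (A k)) + (c * cnj (cinner k k)) *\<^sub>C S k'"
    using K bop_K[OF bA(1) k_K]
    by (simp add: S_add S_diff S_scaleC V_def K_intros C_K L_K k'_K)
  moreover have "cinner (S (L (A k))) g = cinner (A k) g"
    using bop_K[OF bA(1) k_K] by (simp add: S_L cinner_simps kg)
  moreover have "cinner (S k') g = 0" by (simp add: S_k' cinner_simps kg)
  moreover have "cnj (cinner k k) = cinner k k" using cinner_commute[of k k] by simp
  ultimately have a1: "cinner (S (A k')) g = cinner k k * cinner (V \<xi>) g - cnj t * cinner (A k) g"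
    by (simp add: cinner_simps)
  have kk: "cinner k k = 1 - t * cnj t" by (rule cinner_k_k)
  have "cinner k k * cinner (S (A k')) g = cinner k k * (cinner (V \<xi>) g - cnj t * cinner \<psi> g)"
    using a1 unfolding Ak1 kk by (simp add: algebra_simps)
  then show a: "cinner (S (A k')) g = cinner (V \<xi>) g - cnj t * cinner \<psi> g"
    using cinner_k_k_nonzero by simp
  show "cinner (A k) g = cinner \<psi> g - t * cinner (V \<xi>) g"
    unfolding Ak1 a kk by (simp add: algebra_simps)
qed

text \<open>Both \<open>B f\<close> and \<open>adj A g\<close> are a multiple of \<open>k\<close>
  plus a vector in the range of \<open>S\<close>, say \<open>S b\<close> and \<open>S a\<close>. In
  the expanded inner product, \<open>cinner (S b) (S a)\<close> is \<open>cinner b a\<close> up to a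
  rank-one term by \<open>L_S\<close>, and \<open>cinner b a\<close> is exactly what the
  displacement subtracts.\<close>

lemma displacement_product:
  assumes A: "csym A" and dA: "normal_disp A \<psi> \<xi> c"
    and B: "csym B" and dB: "normal_disp B \<psi>' \<xi>' c'"
    and f: "f \<in> K" "cinner f k = 0" and g: "g \<in> K" "cinner g k = 0"
  shows "cinner (displacement (\<lambda>f. A (B f)) f) g
    = cinner f \<xi>' * cinner \<psi> g - cinner f (V \<psi>') * cinner (V \<xi>) g"
proof -
  let ?A' = "adj A" and ?B' = "adj B"
  have dA': "normal_disp ?A' \<xi> \<psi> (cnj c)" by (rule normal_disp_adj[OF A dA])
  have dB': "normal_disp ?B' \<xi>' \<psi>' (cnj c')" by (rule normal_disp_adj[OF B dB])
  have AK: "\<And>f. f \<in> K \<Longrightarrow> A f \<in> K" and A'K: "\<And>f. f \<in> K \<Longrightarrow> ?A' f \<in> K"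
    and BK: "\<And>f. f \<in> K \<Longrightarrow> B f \<in> K" and B'K: "\<And>f. f \<in> K \<Longrightarrow> ?B' f \<in> K"
    using A B bop_K bop_adj csym_bop by blast+
  have Bf: "B f = cinner f \<xi>' *\<^sub>C k + S (B (L f))"
    using dB f by (auto simp: normal_disp_def displacement_def algebra_simps)
  have A'g: "?A' g = cinner g \<psi> *\<^sub>C k + S (?A' (L g))"
    using dA' g by (auto simp: normal_disp_def displacement_def algebra_simps)
  define b a where "b = B (L f)" and "a = ?A' (L g)"
  have ab: "a \<in> K" "b \<in> K" using f g by (simp_all add: a_def b_def BK A'K L_K)
  \<comment> \<open>Here \<open>cinner_A_kernels\<close> is applied to \<open>adj B\<close>, whose
    symbols are exchanged; hence \<open>V \<psi>'\<close> and not \<open>V \<xi>'\<close>.\<close>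
  have x: "cinner b k' = cinner f (V \<psi>') - t * cinner f \<xi>'"
  proof -
    have "cinner b k' = cinner f (S (?B' k'))"
      using f by (simp add: b_def csym_adj_eq[OF B] L_K k'_K cinner_L B'K)
    also have "\<dots> = cnj (cinner (S (?B' k')) f)" by (rule cinner_commute)
    also have "\<dots> = cinner f (V \<psi>') - t * cinner f \<xi>'"
      unfolding cinner_A_kernels(1)[OF csym_adj[OF B] dB' f]
      using cinner_commute[of f "V \<psi>'"] cinner_commute[of f \<xi>'] by simp
    finally show ?thesis .
  qed
  have y: "cinner k' a = cinner (V \<xi>) g - cnj t * cinner \<psi> g"
  proof -
    have "cinner a k' = cinner g (S (A k'))"
      using g csym_adj_eq[OF csym_adj[OF A], of "L g" k'] by (simp add: a_def L_K k'_K cinner_L AK)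
    then have "cinner k' a = cinner (S (A k')) g"
      using cinner_commute[of k' a] cinner_commute[of "S (A k')" g] by simp
    then show ?thesis by (simp add: cinner_A_kernels(1)[OF A dA g])
  qed
  have "cinner (A (B f)) g = cinner (B f) (?A' g)"
    using f g by (simp add: csym_adj_eq[OF A] BK)
  also have "\<dots> = cinner (cinner f \<xi>' *\<^sub>C k + S b) (cinner g \<psi> *\<^sub>C k + S a)"
    by (subst Bf, subst A'g) (simp only: a_def b_def)
  also have "\<dots> = cinner f \<xi>' * cinner \<psi> g * cinner k k + cinner f \<xi>' * cinner k (S a)
      + cinner \<psi> g * cinner (S b) k + cinner (S b) (S a)"
    using cinner_commute[of \<psi> g] by (simp add: cinner_simps algebra_simps)
  also have "cinner (S b) k = - cnj t * cinner b k'"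
    using ab by (simp add: cinner_S k_K L_k cinner_simps)
  also have "cinner k (S a) = - t * cinner k' a"
    using ab cinner_L[OF k_K ab(1)] by (simp add: L_k cinner_simps)
  also have "cinner (S b) (S a) = cinner b a - cinner b k' * cinner k' a"
    using ab cinner_commute[of k' a] by (simp add: cinner_S S_K L_S cinner_simps)
  finally have AB: "cinner (A (B f)) g = cinner f \<xi>' * cinner \<psi> g * (1 - t * cnj t)
      - t * cinner f \<xi>' * cinner k' a - cnj t * cinner \<psi> g * cinner b k'
      + cinner b a - cinner b k' * cinner k' a"
    by (simp add: cinner_k_k algebra_simps)
  have "cinner (S (A (B (L f)))) g = cinner (A b) (L g)"
    using g ab by (simp add: b_def[symmetric] cinner_S AK)
  also have "\<dots> = cinner b a"
    using g ab by (simp add: csym_adj_eq[OF A] L_K a_def)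
  finally have "cinner (displacement (\<lambda>f. A (B f)) f) g = cinner (A (B f)) g - cinner b a"
    by (simp add: displacement_def cinner_simps)
  \<comment> \<open>After substitution every term containing \<open>t\<close> cancels.\<close>
  then show ?thesis unfolding AB x y by (simp add: algebra_simps)
qed

text \<open>A truncated Toeplitz product has zero compression to the complement of \<open>k\<close>,
  so two rank-one operators coincide there. Either both vanish or their factors are proportional,
  with reciprocal ratios up to conjugation.\<close>

lemma toeplitz_product_cases:
  assumes A: "csym A" and dA: "normal_disp A \<psi> \<xi> c"
    and B: "csym B" and dB: "normal_disp B \<psi>' \<xi>' c'"
    and AB: "(\<lambda>f. A (B f)) \<in> trunc_toeplitz u"
  shows "(\<psi> = 0 \<and> \<xi> = 0) \<or> (\<psi>' = 0 \<and> \<xi>' = 0) \<or> (\<psi> = 0 \<and> \<psi>' = 0) \<or>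
    (\<exists>\<alpha>. V \<xi> = \<alpha> *\<^sub>C \<psi> \<and> V \<xi>' = \<alpha> *\<^sub>C \<psi>')"
proof -
  have K: "\<psi> \<in> K" "\<xi> \<in> K" "cinner \<psi> k = 0" "cinner \<xi> k = 0"
    "\<psi>' \<in> K" "\<xi>' \<in> K" "cinner \<psi>' k = 0" "cinner \<xi>' k = 0"
    using dA dB by (auto simp: normal_disp_def)
  obtain p q e where pq: "normal_disp (\<lambda>f. A (B f)) p q e" using toeplitz_normal_disp[OF AB] .
  have eq: "cinner f \<xi>' * cinner \<psi> g = cinner f (V \<psi>') * cinner (V \<xi>) g"
    if "f \<in> K" "cinner f k = 0" "g \<in> K" "cinner g k = 0" for f g
  proof -
    have "cinner (displacement (\<lambda>f. A (B f)) f) g = 0"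
      using pq that cinner_commute[of k g] by (simp add: normal_disp_def cinner_simps)
    then show ?thesis using displacement_product[OF A dA B dB that] by simp
  qed
  have V_inj: "x = 0" if "V x = 0" "x \<in> K" "cinner x k = 0" for x
    using V_V[OF that(2,3)] that(1) S_scaleC[OF K_zero, of 0] by (simp add: V_def)
  have eq2: "cinner f \<xi>' *\<^sub>C \<psi> = cinner f (V \<psi>') *\<^sub>C V \<xi>" if f: "f \<in> K" "cinner f k = 0" for f
  proof -
    \<comment> \<open>The difference is itself orthogonal to \<open>k\<close>, so it may serve as
      test vector \<open>g\<close> and has norm zero.\<close>
    let ?x = "cinner f \<xi>' *\<^sub>C \<psi> - cinner f (V \<psi>') *\<^sub>C V \<xi>"
    have "?x \<in> K" "cinner ?x k = 0" using K by (simp_all add: K_intros V_K cinner_simps cinner_V_k)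
    from eq[OF f this] have "cinner ?x ?x = 0" by (simp only: cinner_diff_left cinner_scaleC_left) simp
    then show ?thesis by (simp add: cinner_eq_zero_iff)
  qed
  show ?thesis
  proof (cases "\<psi>' = 0")
    case True
    then have "cinner \<xi>' \<xi>' *\<^sub>C \<psi> = 0"
      using eq2[OF K(6,8)] S_scaleC[OF K_zero, of 0] by (simp add: V_def)
    then have "cinner \<psi> \<psi> * cinner \<xi>' \<xi>' = 0" by (metis cinner_scaleC_left cinner_zero_left mult.commute)
    with True show ?thesis by (auto simp: cinner_eq_zero_iff)
  next
    case False
    have V\<psi>': "V \<psi>' \<in> K" "cinner (V \<psi>') k = 0" using K by (simp_all add: V_K cinner_V_k)
    have nz: "cinner (V \<psi>') (V \<psi>') \<noteq> 0"
      using V_inj K(5,7) False by (auto simp: cinner_eq_zero_iff)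
    \<comment> \<open>The ratio obtained by evaluating the equality of rank-one operators at
      \<open>V \<psi>'\<close>.\<close>
    define \<alpha> where "\<alpha> = cinner (V \<psi>') \<xi>' / cinner (V \<psi>') (V \<psi>')"
    have "cinner (V \<psi>') (V \<psi>') *\<^sub>C V \<xi> = cinner (V \<psi>') \<xi>' *\<^sub>C \<psi>"
      using eq2[OF V\<psi>'] by simp
    then have "(1 / cinner (V \<psi>') (V \<psi>')) *\<^sub>C cinner (V \<psi>') (V \<psi>') *\<^sub>C V \<xi>
        = (1 / cinner (V \<psi>') (V \<psi>')) *\<^sub>C cinner (V \<psi>') \<xi>' *\<^sub>C \<psi>" by simp
    then have \<alpha>: "V \<xi> = \<alpha> *\<^sub>C \<psi>" using nz by (simp add: scaleC_scaleC \<alpha>_def)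
    show ?thesis
    proof (cases "\<psi> = 0")
      case True
      then show ?thesis using \<alpha> V_inj[OF _ K(2,4)] by simp
    next
      case nz\<psi>: False
      \<comment> \<open>Comparing the functionals in front of the nonzero vector
        \<open>\<psi>\<close> transfers the same \<open>\<alpha>\<close> to the symbols of
        \<open>B\<close>.\<close>
      have "\<xi>' - cnj \<alpha> *\<^sub>C V \<psi>' = 0"
      proof -
        let ?y = "\<xi>' - cnj \<alpha> *\<^sub>C V \<psi>'"
        have y: "?y \<in> K" "cinner ?y k = 0" using K V\<psi>' by (simp_all add: K_intros cinner_simps)
        have "cinner ?y ?y * cinner \<psi> \<psi> = 0"
          using eq[OF y K(1,3)] unfolding \<alpha>
          by (simp only: cinner_diff_right[of ?y] cinner_scaleC_right[of ?y] cinner_scaleC_left[of \<alpha>])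
             (simp add: algebra_simps)
        with nz\<psi> show ?thesis by (simp add: cinner_eq_zero_iff)
      qed
      then have "\<xi>' = cnj \<alpha> *\<^sub>C V \<psi>'" by simp
      then have "V \<xi>' = \<alpha> *\<^sub>C \<psi>'" using K by (simp add: V_scaleC V_K V_V)
      with \<alpha> show ?thesis by blast
    qed
  qed
qed

section \<open>Generalised compressed shifts\<close>

lemma shift_pert_disc_eq:
  "shift_pert_disc u \<alpha> f = S f + (\<alpha> / (1 - \<alpha> * t)) *\<^sub>C cinner f k' *\<^sub>C k"
  by (simp add: shift_pert_disc_def rank_one_def disc_value_0 t_def)

lemma bop_shift_pert_disc: "bop (shift_pert_disc u \<alpha>)"
  unfolding shift_pert_disc_eq[abs_def]
  by (intro bop_plus bop_S bop_scale bop_rank_one k_K)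

text \<open>\<open>C\<close> turns \<open>S\<close> into \<open>L\<close> and exchanges
  \<open>k\<close> with \<open>k'\<close>, so it carries the perturbation to its adjoint as
  well.\<close>

lemma csym_shift_pert_disc: "csym (shift_pert_disc u \<alpha>)"
  unfolding csym_def
proof (intro conjI ballI)
  show "bop (shift_pert_disc u \<alpha>)" by (rule bop_shift_pert_disc)
  fix f g assume fg: "f \<in> K" "g \<in> K"
  let ?c = "\<alpha> / (1 - \<alpha> * t)"
  have "cinner (C g) k' = cinner k g" using cinner_C[of g k] by (simp add: C_k)
  moreover have "C (S (C g)) = L g" using fg by (simp add: C_S C_K)
  ultimately have "C (shift_pert_disc u \<alpha> (C g)) = L g + cnj ?c *\<^sub>C cnj (cinner k g) *\<^sub>C k'"
    unfolding shift_pert_disc_eq by (simp only: C_add C_scaleC C_k)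
  then show "cinner (shift_pert_disc u \<alpha> f) g = cinner f (C (shift_pert_disc u \<alpha> (C g)))"
    using fg by (simp add: shift_pert_disc_eq cinner_simps cinner_S)
qed

lemma adjoint_on_csym:
  assumes A: "csym A" and g: "g \<in> K" shows "adjoint_on K A g = adj A g"
  unfolding adjoint_on_def
proof (rule the_equality)
  have K: "adj A g \<in> K" by (rule bop_K[OF bop_adj[OF csym_bop[OF A]] g])
  then show "adj A g \<in> K \<and> (\<forall>f\<in>K. cinner (A f) g = cinner f (adj A g))"
    using A g by (simp add: csym_adj_eq)
  fix h assume h: "h \<in> K \<and> (\<forall>f\<in>K. cinner (A f) g = cinner f h)"
  show "h = adj A g"
  proof (rule K_eqI)
    fix f assume f: "f \<in> K"
    have "cinner f h = cinner f (adj A g)" using h f g A by (metis csym_adj_eq)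
    then show "cinner h f = cinner (adj A g) f" using cinner_commute by metis
  qed (use h K in auto)
qed

lemma shift_pert_K:
  assumes "f \<in> K"
  shows "cmod \<alpha> \<le> 1 \<Longrightarrow> shift_pert u (Finite \<alpha>) f = shift_pert_disc u \<alpha> f"
    and "cmod \<alpha> > 1 \<Longrightarrow> shift_pert u (Finite \<alpha>) f = adj (shift_pert_disc u (1 / cnj \<alpha>)) f"
    and "shift_pert u Infinity f = adj (shift_pert_disc u 0) f"
  using assms by (simp_all add: adjoint_on_csym csym_shift_pert_disc)

lemma csym_cong:
  assumes "csym A" "\<And>f. f \<in> K \<Longrightarrow> B f = A f" shows "csym B"
  using assms unfolding csym_def bounded_operator_on_def by (simp add: K_intros C_K)

text \<open>Outside the closed disc the parameter 1 / cnj \<alpha> lies inside it, so only disc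
  parameters and their adjoints have to be treated.\<close>

lemma shift_pert_cases:
  obtains \<beta> where "cmod \<beta> \<le> 1" "\<And>f. f \<in> K \<Longrightarrow> shift_pert u \<alpha> f = shift_pert_disc u \<beta> f"
  | \<beta> where "cmod \<beta> \<le> 1" "\<And>f. f \<in> K \<Longrightarrow> shift_pert u \<alpha> f = adj (shift_pert_disc u \<beta>) f"
proof (cases \<alpha>)
  case (Finite a)
  show ?thesis
  proof (cases "cmod a \<le> 1")
    case True then show ?thesis using that(1)[of a] shift_pert_K(1) Finite by blast
  next
    case False
    then have "cmod (1 / cnj a) \<le> 1" by (simp add: norm_divide divide_le_eq)
    then show ?thesis using that(2)[of "1 / cnj a"] shift_pert_K(2) Finite False by auto
  qed
next
  case Infinity then show ?thesis using that(2)[of 0] shift_pert_K(3) by auto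
qed

lemma csym_shift_pert: "csym (shift_pert u \<alpha>)"
  by (rule shift_pert_cases[of \<alpha>])
     (metis csym_cong csym_shift_pert_disc csym_adj)+

lemma one_minus_alpha_t: "cmod \<alpha> \<le> 1 \<Longrightarrow> 1 - \<alpha> * t \<noteq> 0"
proof
  assume a: "cmod \<alpha> \<le> 1" and "1 - \<alpha> * t = 0"
  then have "cmod \<alpha> * cmod t = 1" by (metis eq_iff_diff_eq_0 norm_mult norm_one)
  moreover have "cmod \<alpha> * cmod t \<le> 1 * cmod t" using a by (rule mult_right_mono) simp
  ultimately show False using t_less by simp
qed

text \<open>The commutator \<open>X\<close> maps into the span of \<open>k\<close> and satisfies \<open>\<langle>X f, g\<rangle> = - \<langle>X C g, C f\<rangle>\<close>, hence
  vanishes.\<close>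

lemma normal_disp_commutes:
  assumes A: "csym A" and d: "normal_disp A \<psi> \<xi> c" and V: "V \<xi> = \<alpha> *\<^sub>C \<psi>" and \<alpha>: "cmod \<alpha> \<le> 1"
    and f: "f \<in> K"
  shows "A (shift_pert_disc u \<alpha> f) = shift_pert_disc u \<alpha> (A f)"
proof -
  let ?T = "shift_pert_disc u \<alpha>"
  define a where "a = \<alpha> / (1 - \<alpha> * t)"
  have T: "?T f = S f + a *\<^sub>C cinner f k' *\<^sub>C k" for f by (simp add: shift_pert_disc_eq a_def)
  have bA: "bop A" and AK: "\<And>f. f \<in> K \<Longrightarrow> A f \<in> K" using A csym_bop bop_K by blast+
  have TK: "\<And>f. f \<in> K \<Longrightarrow> ?T f \<in> K" using bop_shift_pert_disc bop_K by blast
  define X where "X f = A (?T f) - ?T (A f)" for f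
  have XK: "X f \<in> K" if "f \<in> K" for f using that by (simp add: X_def AK TK K_diff)
  have orth: "cinner (X f) g = 0" if f: "f \<in> K" and g: "g \<in> K" "cinner g k = 0" for f g
  proof -
    have kg: "cinner k g = 0" using cinner_commute[of k g] g by simp
    \<comment> \<open>The displacement is evaluated at \<open>S f\<close> because \<open>L S\<close>
      is the identity up to the rank-one term of \<open>L_S\<close>; this exposes the commutator of
      \<open>A\<close> and \<open>S\<close>.\<close>
    have "displacement A (S f) = A (S f) - S (A f) + cinner f k' *\<^sub>C S (A k')"
      using f by (simp add: displacement_def L_S bop_diff[OF bA] bop_scaleC[OF bA] K_intros k'_K S_diff AK S_scaleC)
    then have "cinner (displacement A (S f)) g
        = cinner (A (S f)) g - cinner (S (A f)) g + cinner f k' * cinner (S (A k')) g"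
      by (simp add: cinner_simps)
    moreover have "cinner (displacement A (S f)) g = cinner (S f) k * cinner \<psi> g"
      using d f by (simp add: normal_disp_def S_K cinner_simps kg)
    moreover have "cinner (S f) k = - cnj t * cinner f k'"
      using f by (simp add: cinner_S k_K L_k cinner_simps)
    ultimately have 1: "cinner (A (S f)) g - cinner (S (A f)) g
        = - cnj t * cinner f k' * cinner \<psi> g - cinner f k' * cinner (S (A k')) g"
      by (simp add: algebra_simps)
    have "A (?T f) = A (S f) + a *\<^sub>C cinner f k' *\<^sub>C A k"
      using f by (simp add: T bop_add[OF bA] bop_scaleC[OF bA] S_K K_intros k_K)
    then have "cinner (X f) g = cinner (A (S f)) g - cinner (S (A f)) g + a * cinner f k' * cinner (A k) g"
      by (simp add: X_def T[of "A f"] cinner_simps kg)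
    also have "\<dots> = cinner f k' * (a * (1 - t * \<alpha>) - \<alpha>) * cinner \<psi> g"
      unfolding 1 cinner_A_kernels[OF A d g] V by (simp add: cinner_simps algebra_simps)
    \<comment> \<open>The equation that determines the coefficient in
      \<open>shift_pert_disc\<close>.\<close>
    also have "a * (1 - t * \<alpha>) - \<alpha> = 0"
      using one_minus_alpha_t[OF \<alpha>] by (simp add: a_def mult.commute)
    finally show ?thesis by simp
  qed
  have anti: "cinner (X f) g = - cinner (X (C g)) (C f)" if "f \<in> K" "g \<in> K" for f g
  proof -
    have "cinner (A (?T f)) g = cinner (?T (A (C g))) (C f)"
    proof -
      have "cinner (A (?T f)) g = cinner (?T f) (adj A g)" using that by (intro csym_adj_eq A TK)
      also have "\<dots> = cinner (?T (C (adj A g))) (C f)"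
        using that by (intro csym_symmetric csym_shift_pert_disc) (simp_all add: adj_def AK C_K)
      finally show ?thesis by (simp add: adj_def)
    qed
    moreover have "cinner (?T (A f)) g = cinner (A (?T (C g))) (C f)"
    proof -
      have "cinner (?T (A f)) g = cinner (A f) (adj ?T g)"
        using that by (intro csym_adj_eq csym_shift_pert_disc AK)
      also have "\<dots> = cinner (A (C (adj ?T g))) (C f)"
        using that by (intro csym_symmetric A) (simp_all add: adj_def TK C_K)
      finally show ?thesis by (simp add: adj_def)
    qed
    ultimately show ?thesis by (simp add: X_def cinner_simps)
  qed
  have kX: "cinner (X f) k = 0" if f: "f \<in> K" for f
  proof -
    \<comment> \<open>Removes the component of \<open>f\<close> along \<open>k'\<close>. The
      conjugate of the remainder is orthogonal to \<open>k\<close>, so \<open>anti\<close> and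
      \<open>orth\<close> dispose of it.\<close>
    define s where "s = cinner f k' / cinner k k"
    have kk: "cinner k' k' = cinner k k" using cinner_C[of k k] by (simp add: C_k)
    have f1: "f - s *\<^sub>C k' \<in> K" "cinner (f - s *\<^sub>C k') k' = 0"
      using f cinner_k_k_nonzero by (simp_all add: K_intros k'_K cinner_simps s_def kk)
    have "cinner (C (f - s *\<^sub>C k')) k = cnj (cinner (f - s *\<^sub>C k') k')"
      using cinner_C[of "f - s *\<^sub>C k'" k'] cinner_commute[of k' "f - s *\<^sub>C k'"] by (simp only: C_k')
    then have "cinner (C (f - s *\<^sub>C k')) k = 0" using f1 by simp
    then have 1: "cinner (X (f - s *\<^sub>C k')) k = 0"
      using anti[OF f1(1) k_K] orth[OF k'_K C_K[OF f1(1)]] by (simp add: C_k)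
    \<comment> \<open>Since \<open>C\<close> exchanges \<open>k\<close> and \<open>k'\<close>,
      antisymmetry makes this number equal to its own negative.\<close>
    have 2: "cinner (X k') k = 0"
      using anti[OF k'_K k_K] by (simp add: C_k C_k')
    have "bop X" unfolding X_def[abs_def]
      by (intro bop_minus bop_comp[OF bA bop_shift_pert_disc] bop_comp[OF bop_shift_pert_disc bA])
    then have "X f = X (f - s *\<^sub>C k') + s *\<^sub>C X k'"
      using bop_add[of X "f - s *\<^sub>C k'" "s *\<^sub>C k'"] bop_scaleC[of X k' s] f1 k'_K by (simp add: K_intros)
    with 1 2 show ?thesis by (simp add: cinner_simps)
  qed
  have "X f = 0"
  proof -
    have "cinner (X f) k = 0" by (rule kX[OF f])
    from orth[OF f XK[OF f] this] show ?thesis by (simp add: cinner_eq_zero_iff)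
  qed
  then show ?thesis by (simp add: X_def)
qed

section \<open>Operators commuting with a generalised compressed shift\<close>

lemma commutes_adj:
  assumes "\<And>f. f \<in> K \<Longrightarrow> adj A (T f) = T (adj A f)" "f \<in> K"
  shows "A (adj T f) = adj T (A f)"
  using assms(1)[OF C_K[OF assms(2)]] by (metis adj_def C_C)

text \<open>Commutation evaluated at \<open>L f\<close>, combined with \<open>S_L\<close>, is
  already a displacement formula. \<open>Y\<close> is a separate argument because a product of
  complex symmetric operators need not be complex symmetric; it rewrites
  \<open>cinner (X (L f)) k'\<close> as a functional of \<open>f\<close>.\<close>

lemma commutes_toeplitz_disc:
  assumes X: "bop X" "bop Y" and ad: "\<And>f g. f \<in> K \<Longrightarrow> g \<in> K \<Longrightarrow> cinner (X f) g = cinner f (Y g)"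
    and comm: "\<And>f. f \<in> K \<Longrightarrow> X (shift_pert_disc u \<alpha> f) = shift_pert_disc u \<alpha> (X f)"
  shows "X \<in> trunc_toeplitz u"
proof -
  define a where "a = \<alpha> / (1 - \<alpha> * t)"
  have T: "shift_pert_disc u \<alpha> f = S f + a *\<^sub>C cinner f k' *\<^sub>C k" for f by (simp add: shift_pert_disc_eq a_def)
  have XK: "\<And>f. f \<in> K \<Longrightarrow> X f \<in> K" and YK: "\<And>f. f \<in> K \<Longrightarrow> Y f \<in> K" using X bop_K by blast+
  show ?thesis
  proof (rule displacement_toeplitz[OF X(1)])
    show "(1 + a * t) *\<^sub>C X k \<in> K" "cnj a *\<^sub>C S (Y k') \<in> K" by (intro K_intros XK k_K S_K)+
    fix f assume f: "f \<in> K"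
    have "S (X (L f)) + a *\<^sub>C cinner (X (L f)) k' *\<^sub>C k = X (S (L f)) + a *\<^sub>C cinner (L f) k' *\<^sub>C X k"
      using comm[OF L_K[OF f]] f unfolding T
      by (simp add: bop_add[OF X(1)] bop_scaleC[OF X(1)] S_K K_intros k_K)
    moreover have "X (S (L f)) = X f - cinner f k *\<^sub>C X k"
      using f by (simp add: S_L bop_diff[OF X(1)] bop_scaleC[OF X(1)] K_intros k_K)
    moreover have "cinner (X (L f)) k' = cinner f (S (Y k'))"
      using f by (simp add: ad L_K k'_K cinner_L YK)
    moreover have "cinner (L f) k' = - t * cinner f k"
      using f by (simp add: cinner_L k'_K S_k' cinner_simps)
    ultimately have "S (X (L f)) = X f - cinner f k *\<^sub>C X k - (a * t * cinner f k) *\<^sub>C X k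
        - (a * cinner f (S (Y k'))) *\<^sub>C k"
      by (simp add: scaleC_scaleC scaleC_minus_left scaleC_minus_right algebra_simps)
    then show "displacement X f = cinner f k *\<^sub>C (1 + a * t) *\<^sub>C X k + cinner f (cnj a *\<^sub>C S (Y k')) *\<^sub>C k"
      by (simp add: displacement_def scaleC_scaleC scaleC_add_left scaleC_add_right cinner_simps algebra_simps)
  qed
qed

text \<open>If the shift is the adjoint of a disc one, conjugating by \<open>C\<close> moves the
  relation to \<open>adj X\<close> and the disc, and \<open>toeplitz_adj\<close> returns to
  \<open>X\<close>.\<close>

lemma commutes_toeplitz:
  assumes X: "bop X" "bop Y" and ad: "\<And>f g. f \<in> K \<Longrightarrow> g \<in> K \<Longrightarrow> cinner (X f) g = cinner f (Y g)"
    and comm: "\<And>f. f \<in> K \<Longrightarrow> X (shift_pert u \<alpha> f) = shift_pert u \<alpha> (X f)"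
  shows "X \<in> trunc_toeplitz u"
proof (rule shift_pert_cases[of \<alpha>])
  fix \<beta> assume "cmod \<beta> \<le> 1" and *: "\<And>f. f \<in> K \<Longrightarrow> shift_pert u \<alpha> f = shift_pert_disc u \<beta> f"
  show ?thesis
    by (rule commutes_toeplitz_disc[OF X ad]) (use comm * bop_K[OF X(1)] in auto)
next
  fix \<beta> assume "cmod \<beta> \<le> 1" and *: "\<And>f. f \<in> K \<Longrightarrow> shift_pert u \<alpha> f = adj (shift_pert_disc u \<beta>) f"
  have "adj X \<in> trunc_toeplitz u"
  proof (rule commutes_toeplitz_disc[where Y = "adj Y" and \<alpha> = \<beta>])
    show "bop (adj X)" "bop (adj Y)" using X by (simp_all add: bop_adj)
    show "cinner (adj X f) g = cinner f (adj Y g)" if "f \<in> K" "g \<in> K" for f g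
      using ad[OF C_K[OF that(1)] C_K[OF that(2)]] cinner_commute[of "C f" "Y (C g)"] cinner_C_left[of "X (C f)" g]
        cinner_C_right[of f "Y (C g)"] cinner_commute[of "C g" "X (C f)"] 
      by (simp add: adj_def)
    show "adj X (shift_pert_disc u \<beta> f) = shift_pert_disc u \<beta> (adj X f)" if "f \<in> K" for f
      using commutes_adj[of "adj X" "adj (shift_pert_disc u \<beta>)" f] comm * that bop_K[OF X(1)] by simp
  qed
  then have "adj (adj X) \<in> trunc_toeplitz u" by (rule toeplitz_adj)
  then show ?thesis by simp
qed

lemma toeplitz_product_iff:
  assumes A: "A \<in> trunc_toeplitz u" and B: "B \<in> trunc_toeplitz u"
  shows "(\<lambda>f. A (B f)) \<in> trunc_toeplitz u \<longleftrightarrow>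
    (\<exists>c. (\<forall>f\<in>K. A f = c *\<^sub>C f) \<or> (\<forall>f\<in>K. B f = c *\<^sub>C f)) \<or>
    (\<exists>\<alpha>. (\<forall>f\<in>K. A (shift_pert u \<alpha> f) = shift_pert u \<alpha> (A f)) \<and>
         (\<forall>f\<in>K. B (shift_pert u \<alpha> f) = shift_pert u \<alpha> (B f)))"
    (is "?l \<longleftrightarrow> ?sc \<or> ?comm")
proof
  have sA: "csym A" and sB: "csym B" and bA: "bop A" and bB: "bop B"
    using A B by (simp_all add: toeplitz_csym toeplitz_bop)
  obtain \<psi> \<xi> c where dA: "normal_disp A \<psi> \<xi> c" using toeplitz_normal_disp[OF A] .
  obtain \<psi>' \<xi>' c' where dB: "normal_disp B \<psi>' \<xi>' c'" using toeplitz_normal_disp[OF B] .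
  {
    assume ?l
    from toeplitz_product_cases[OF sA dA sB dB this]
    consider "\<psi> = 0" "\<xi> = 0" | "\<psi>' = 0" "\<xi>' = 0" | "\<psi> = 0" "\<psi>' = 0"
      | \<alpha> where "V \<xi> = \<alpha> *\<^sub>C \<psi>" "V \<xi>' = \<alpha> *\<^sub>C \<psi>'" by blast
    then show "?sc \<or> ?comm"
    proof cases
      case 1
      then show ?thesis using normal_disp_scalar[OF bA] dA by blast
    next
      case 2
      then show ?thesis using normal_disp_scalar[OF bB] dB by blast
    next
      case 3
      \<comment> \<open>For the adjoints the roles of the symbols are exchanged, so a vanishing
        first symbol is the relation with parameter 0, whose counterpart on the original side is
        infinity.\<close>
      have V0: "V 0 = 0 *\<^sub>C x" for x using S_scaleC[OF K_zero, of 0] by (simp add: V_def)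
      have "M (shift_pert u Infinity f) = shift_pert u Infinity (M f)"
        if M: "csym M" "normal_disp M 0 x d" and f: "f \<in> K" for M x d f
        unfolding shift_pert_K(3)[OF f] shift_pert_K(3)[OF bop_K[OF csym_bop[OF M(1)] f]]
        by (rule commutes_adj[where A = M and T = "shift_pert_disc u 0",
              OF normal_disp_commutes[OF csym_adj[OF M(1)] normal_disp_adj[OF M] V0] f]) simp_all
      then show ?thesis using 3 sA sB dA dB by blast
    next
      case 4
      have "M (shift_pert u (Finite \<alpha>) f) = shift_pert u (Finite \<alpha>) (M f)"
        if M: "csym M" "normal_disp M y x d" and V: "V x = \<alpha> *\<^sub>C y" and f: "f \<in> K" for M y x d f
      proof (cases "cmod \<alpha> \<le> 1")
        case True
        show ?thesis
          unfolding shift_pert_K(1)[OF f True] shift_pert_K(1)[OF bop_K[OF csym_bop[OF M(1)] f] True]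
          by (rule normal_disp_commutes[OF M V True f])
      next
        case False
        have xy: "x \<in> K" "cinner x k = 0" "y \<in> K" using M by (auto simp: normal_disp_def)
        \<comment> \<open>Applying the conjugation \<open>V\<close> inverts the relation, and the
          adjoint satisfies it with a parameter inside the disc.\<close>
        have "x = cnj \<alpha> *\<^sub>C V y" using V_V[OF xy(1,2)] V xy by (simp add: V_scaleC)
        moreover have "\<alpha> \<noteq> 0" using False by auto
        ultimately have V': "V y = (1 / cnj \<alpha>) *\<^sub>C x" by (simp add: scaleC_scaleC)
        have le: "cmod (1 / cnj \<alpha>) \<le> 1" using False by (simp add: norm_divide divide_le_eq)
        from False have gt: "cmod \<alpha> > 1" by simp
        show ?thesis
          unfolding shift_pert_K(2)[OF f gt] shift_pert_K(2)[OF bop_K[OF csym_bop[OF M(1)] f] gt]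
          by (rule commutes_adj[where A = M and T = "shift_pert_disc u (1 / cnj \<alpha>)",
              OF normal_disp_commutes[OF csym_adj[OF M(1)] normal_disp_adj[OF M] V' le] f])
      qed
      then show ?thesis using 4 sA sB dA dB by blast
    qed
  }
  assume "?sc \<or> ?comm"
  then show ?l
  proof
    assume ?sc
    then obtain c where "(\<forall>f\<in>K. A f = c *\<^sub>C f) \<or> (\<forall>f\<in>K. B f = c *\<^sub>C f)" by blast
    then show ?l
    proof
      assume "\<forall>f\<in>K. A f = c *\<^sub>C f"
      then show ?l using bop_K[OF bB] by (intro toeplitz_cong[OF toeplitz_scale[OF B, of c]]) simp
    next
      assume "\<forall>f\<in>K. B f = c *\<^sub>C f"
      then show ?l using bop_scaleC[OF bA] by (intro toeplitz_cong[OF toeplitz_scale[OF A, of c]]) simp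
    qed
  next
    assume ?comm
    then obtain \<alpha> where
      \<alpha>: "\<And>f. f \<in> K \<Longrightarrow> A (shift_pert u \<alpha> f) = shift_pert u \<alpha> (A f)"
        "\<And>f. f \<in> K \<Longrightarrow> B (shift_pert u \<alpha> f) = shift_pert u \<alpha> (B f)" by blast
    show ?l
    proof (rule commutes_toeplitz[OF bop_comp[OF bA bB]
          bop_comp[OF bop_adj[OF bB] bop_adj[OF bA]]])
      \<comment> \<open>The adjoint of the product is the product of the adjoints in reverse
        order.\<close>
      show "cinner (A (B f)) g = cinner f (adj B (adj A g))" if "f \<in> K" "g \<in> K" for f g
        using that by (simp add: csym_adj_eq[OF sA] csym_adj_eq[OF sB] bop_K[OF bB] bop_K[OF bop_adj[OF bA]])
      show "A (B (shift_pert u \<alpha> f)) = shift_pert u \<alpha> (A (B f))" if "f \<in> K" for f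
        using that by (simp add: \<alpha> bop_K[OF bB])
    qed
  qed
qed

end

section \<open>Truncated Hankel operators\<close>

locale real_inner_fn = inner_fn +
  assumes real: "u = hat_op u"
begin

abbreviation D :: "l2T \<Rightarrow> l2T" where "D \<equiv> D_op u"

lemma D_eq: "D f = C (hat_op f)" by (simp add: D_op_def)

lemma hat_K: assumes "f \<in> K" shows "hat_op f \<in> K"
proof -
  have "cinner (hat_op f) (u \<odot> h) = 0" if h: "h \<in> hardy" for h
  proof -
    have "cinner (hat_op f) (u \<odot> h) = cinner (hat_op f) (hat_op (u \<odot> hat_op h))"
      by (simp add: hat_op_mult bounded_u flip: real)
    also have "\<dots> = cnj (cinner f (u \<odot> hat_op h))" by (simp only: cinner_hat) (rule cinner_commute)
    also have "\<dots> = 0" by (simp add: K_orth assms hat_hardy h)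
    finally show ?thesis .
  qed
  then show ?thesis using hat_hardy[OF K_hardy[OF assms]] by (simp add: model_space_def)
qed

lemma hat_C: "hat_op (C f) = C (hat_op f)"
  by (simp add: C_op_def hat_op_mult bounded_u hat_op_cnj ess_bounded_id flip: real)

lemma cnj_t: "cnj t = t"
  using fourier_coeff_hat[of u 0] real by (simp add: t_def)

lemma hat_k: "hat_op k = k"
  by (simp add: k_eq hat_op_diff hat_op_scaleC cnj_t flip: real)

lemma hat_k': "hat_op k' = k'"
  by (simp add: k'_eq_C hat_C hat_k)

lemma cinner_hat_k': "cinner (hat_op f) k' = cnj (cinner f k')"
  using cinner_hat[of f k'] cinner_commute[of k' f] by (simp add: hat_k')

lemma hat_S: "f \<in> K \<Longrightarrow> hat_op (S f) = S (hat_op f)"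
  by (simp add: S_eq hat_K hat_op_diff hat_op_mult ess_bounded_id hat_op_scaleC cinner_hat_k' flip: real)

text \<open>\<open>hat_op\<close> is antilinear and fixes \<open>u\<close>, \<open>k\<close> and
  \<open>k'\<close>, and \<open>t\<close> is real; only the parameter is conjugated.\<close>

lemma hat_shift_pert_disc:
  "f \<in> K \<Longrightarrow> hat_op (shift_pert_disc u \<alpha> f) = shift_pert_disc u (cnj \<alpha>) (hat_op f)"
  by (simp add: shift_pert_disc_eq hat_op_add hat_S hat_op_scaleC cinner_hat_k' hat_k cnj_t)

lemma hat_shift_pert:
  assumes f: "f \<in> K"
  shows "hat_op (shift_pert u \<alpha> f) = shift_pert u (ext_cnj \<alpha>) (hat_op f)"
proof -
  have adj: "hat_op (adj (shift_pert_disc u \<beta>) f) = adj (shift_pert_disc u (cnj \<beta>)) (hat_op f)" for \<beta>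
    using f by (simp add: adj_def hat_C hat_shift_pert_disc C_K)
  show ?thesis
  proof (cases \<alpha>)
    case (Finite a)
    show ?thesis
    proof (cases "cmod a \<le> 1")
      case True
      then have "cmod (cnj a) \<le> 1" by simp
      with True f show ?thesis unfolding Finite ext_cnj.simps
        by (simp only: shift_pert_K(1) hat_shift_pert_disc hat_K)
    next
      case False
      then have "cmod a > 1" "cmod (cnj a) > 1" by simp_all
      with f show ?thesis unfolding Finite ext_cnj.simps
        by (simp only: shift_pert_K(2) adj hat_K complex_cnj_divide complex_cnj_one)
    qed
  next
    case Infinity
    then show ?thesis using f adj[of 0] by (simp only: ext_cnj.simps shift_pert_K(3) hat_K complex_cnj_zero)
  qed
qed

lemma D_K: "f \<in> K \<Longrightarrow> D f \<in> K" by (simp add: D_eq C_K hat_K)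

lemma D_D [simp]: "D (D f) = f" by (simp add: D_eq hat_C)

lemma ess_bounded_D: "ess_bounded f \<Longrightarrow> ess_bounded (D f)"
  by (simp add: D_eq ess_bounded_C ess_bounded_hat)

lemma bop_D: "bop D"
proof (rule bopI[where B = 1])
  show "norm (D f) \<le> 1 * norm f" for f
    using norm_l2T_cinner[OF cinner_hat, of f] by (simp add: D_eq norm_C)
qed (simp_all add: D_eq C_K hat_K C_add C_scaleC hat_op_add hat_op_scaleC)

text \<open>Since \<open>D\<close> is \<open>C\<close> after \<open>hat_op\<close>, the inner
  \<open>C\<close> of the adjoint cancels and \<open>hat_op\<close> conjugates the parameter. This
  makes the twisted relation for \<open>B\<close> an ordinary commutation for \<open>B\<close> after
  \<open>D\<close>.\<close>

lemma adjoint_shift_pert_D: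
  assumes f: "f \<in> K"
  shows "adjoint_on K (shift_pert u (ext_cnj \<alpha>)) (D f) = D (shift_pert u \<alpha> f)"
  using f by (simp add: adjoint_on_csym csym_shift_pert D_K adj_def)
     (simp add: D_eq hat_shift_pert)

section \<open>Truncated Hankel operators as truncated Toeplitz operators\<close>

text \<open>By \<open>orth_proj_J\<close> the inner projection becomes an outer one onto the Hardy
  space, which \<open>P\<close> absorbs because \<open>K\<close> is contained in that space.\<close>

lemma P_J: "P (J_op (\<psi> - orth_proj hardy \<psi>)) = P (J_op \<psi>)"
proof (rule P_eqI[OF P_K])
  fix h assume h: "h \<in> K"
  show "cinner (J_op (\<psi> - orth_proj hardy \<psi>)) h = cinner (P (J_op \<psi>)) h"
    using h cinner_orth_proj[OF csubspace_hardy closed_hardy K_hardy[OF h], of "J_op \<psi>"]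
    by (simp add: cinner_P orth_proj_J)
qed

text \<open>Pointwise, the factors z and conj z from \<open>D\<close> and \<open>J_op\<close>
  cancel, and real symmetry turns u(conj z) into the conjugate of u(z). What remains is
  multiplication by the Toeplitz symbol conj u(z) \<phi>(conj z).\<close>

lemma J_mult_D:
  assumes f: "ess_bounded f"
  shows "J_op (\<phi> \<odot> D f) = (cnj_l2T u \<odot> cnj_l2T (hat_op \<phi>)) \<odot> f"
proof -
  let ?x = "cnj_l2T (hat_op \<phi>)"
  have "cnj_l2T (hat_op (D f)) = cnj_l2T u \<odot> (id_l2T \<odot> f)"
    by (simp add: D_eq hat_C) (simp add: C_op_def cnj_l2T_mult bounded_u)
  then have "J_op (\<phi> \<odot> D f) = cnj_l2T id_l2T \<odot> ((cnj_l2T u \<odot> (id_l2T \<odot> f)) \<odot> ?x)"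
    using f by (simp add: J_op_eq mult_l2T_commute[of \<phi>] hat_op_mult cnj_l2T_mult ess_bounded_D ess_bounded_hat)
  also have "\<dots> = (cnj_l2T id_l2T \<odot> (cnj_l2T u \<odot> (id_l2T \<odot> f))) \<odot> ?x"
    by (intro mult_l2T_assoc ess_bounded_intros bounded_u f)
  also have "cnj_l2T id_l2T \<odot> (cnj_l2T u \<odot> (id_l2T \<odot> f)) = cnj_l2T u \<odot> (cnj_l2T id_l2T \<odot> (id_l2T \<odot> f))"
    by (intro mult_l2T_left_commute ess_bounded_intros bounded_u)
  also have "\<dots> = cnj_l2T u \<odot> f" by (simp add: unimodular_cancel' unimodular_id)
  also have "(cnj_l2T u \<odot> f) \<odot> ?x = cnj_l2T u \<odot> (f \<odot> ?x)"
    by (intro mult_l2T_assoc[symmetric] ess_bounded_intros bounded_u f)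
  also have "\<dots> = f \<odot> (cnj_l2T u \<odot> ?x)"
    by (intro mult_l2T_left_commute ess_bounded_intros bounded_u f)
  also have "\<dots> = (cnj_l2T u \<odot> ?x) \<odot> f" by (rule mult_l2T_commute)
  finally show ?thesis .
qed

lemma hankel_iff: "B \<in> trunc_hankel u \<longleftrightarrow> (\<lambda>f. B (D f)) \<in> trunc_toeplitz u"
proof
  assume "B \<in> trunc_hankel u"
  then obtain \<phi> where B: "bop B" and \<phi>: "\<And>f. f \<in> K \<Longrightarrow> ess_bounded f \<Longrightarrow> B f = P (J_op (\<phi> \<odot> f))"
    by (auto simp: trunc_hankel_def P_J)
  have "B (D f) = P ((cnj_l2T u \<odot> cnj_l2T (hat_op \<phi>)) \<odot> f)" if "f \<in> K" "ess_bounded f" for f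
    using that by (simp add: \<phi> D_K ess_bounded_D J_mult_D)
  with bop_comp[OF B bop_D] show "(\<lambda>f. B (D f)) \<in> trunc_toeplitz u"
    unfolding trunc_toeplitz_def by blast
next
  assume T: "(\<lambda>f. B (D f)) \<in> trunc_toeplitz u"
  then obtain \<psi> where BD: "bop (\<lambda>f. B (D f))"
    and \<psi>: "\<And>f. f \<in> K \<Longrightarrow> ess_bounded f \<Longrightarrow> B (D f) = P (\<psi> \<odot> f)"
    unfolding trunc_toeplitz_def by blast
  have B: "bop B" using bop_comp[OF BD bop_D] by simp
  \<comment> \<open>Solves \<open>cnj_l2T u \<odot> cnj_l2T (hat_op \<phi>) = \<psi>\<close> for the
    Hankel symbol.\<close>
  define \<phi> where "\<phi> = hat_op (cnj_l2T (u \<odot> \<psi>))"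
  have "cnj_l2T u \<odot> cnj_l2T (hat_op \<phi>) = \<psi>"
    by (simp add: \<phi>_def unimodular_cancel' unimodular_u)
  then have J: "J_op (\<phi> \<odot> D f) = \<psi> \<odot> f" if "ess_bounded f" for f
    using J_mult_D[OF that, of \<phi>] by simp
  have "B f = P (J_op (\<phi> \<odot> f - orth_proj hardy (\<phi> \<odot> f)))" if f: "f \<in> K" "ess_bounded f" for f
    using \<psi>[OF D_K[OF f(1)] ess_bounded_D[OF f(2)]] J[OF ess_bounded_D[OF f(2)]] by (simp add: P_J)
  with B show "B \<in> trunc_hankel u" unfolding trunc_hankel_def by blast
qed

end

theorem theorem5p5:
  fixes u :: l2T and A B :: "l2T \<Rightarrow> l2T"
  assumes "inner_function u" and "\<nexists>c. u = const_l2T c" and "real_symmetric u"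
    and "A \<in> trunc_toeplitz u" and "B \<in> trunc_hankel u"
  shows "A \<circ> B \<in> trunc_hankel u \<longleftrightarrow>
    (\<exists>c. (\<forall>f\<in>model_space u. A f = c *\<^sub>C f) \<or> (\<forall>f\<in>model_space u. B f = c *\<^sub>C D_op u f)) \<or>
    (\<exists>\<alpha>. (\<forall>f\<in>model_space u. A (shift_pert u \<alpha> f) = shift_pert u \<alpha> (A f)) \<and>
         (\<forall>f\<in>model_space u. B (adjoint_on (model_space u) (shift_pert u (ext_cnj \<alpha>)) f)
            = shift_pert u \<alpha> (B f)))"
proof -
  interpret real_inner_fn u
    using assms by unfold_locales (simp_all add: real_symmetric_def)
  let ?B = "\<lambda>f. B (D f)"
  \<comment> \<open>\<open>D\<close> is an involution of \<open>K\<close>, so quantifying over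
    \<open>f\<close> and over \<open>D f\<close> is the same; this moves both conditions on
    \<open>B\<close> to \<open>?B\<close>.\<close>
  have all_D: "(\<forall>f\<in>K. Q f) \<longleftrightarrow> (\<forall>f\<in>K. Q (D f))" for Q
    by (metis D_D D_K)
  have scalar: "(\<forall>f\<in>K. B f = c *\<^sub>C D f) \<longleftrightarrow> (\<forall>f\<in>K. ?B f = c *\<^sub>C f)" for c
    by (subst all_D) simp
  have comm: "(\<forall>f\<in>K. B (adjoint_on K (shift_pert u (ext_cnj \<alpha>)) f) = shift_pert u \<alpha> (B f)) \<longleftrightarrow>
      (\<forall>f\<in>K. ?B (shift_pert u \<alpha> f) = shift_pert u \<alpha> (?B f))" for \<alpha>
    by (subst all_D) (simp add: adjoint_shift_pert_D del: shift_pert.simps)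
  have "A \<circ> B \<in> trunc_hankel u \<longleftrightarrow> (\<lambda>f. A (?B f)) \<in> trunc_toeplitz u"
    by (simp add: hankel_iff)
  also have "\<dots> \<longleftrightarrow> (\<exists>c. (\<forall>f\<in>K. A f = c *\<^sub>C f) \<or> (\<forall>f\<in>K. ?B f = c *\<^sub>C f)) \<or>
    (\<exists>\<alpha>. (\<forall>f\<in>K. A (shift_pert u \<alpha> f) = shift_pert u \<alpha> (A f)) \<and>
         (\<forall>f\<in>K. ?B (shift_pert u \<alpha> f) = shift_pert u \<alpha> (?B f)))"
    by (rule toeplitz_product_iff) (use assms hankel_iff in simp_all)
  finally show ?thesis unfolding scalar comm .
qed

end
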